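(* Let $\mathcal{G}$ be a finite-dimensional complex Lie algebra with a nondegenerate, symmetric, invariant bilinear form $B$, and let $\mu$ be an automorphism of $\mathcal{G}$ of finite order $N$ that preserves $B$ and has nonzero fixed points. Let $k\in\mathbb{C}\setminus i\mathbb{R}$, $z\in\mathbb{C}$ and $v_1,v_2\in\mathbb{C}\setminus\{0\}$ be such that $$\tau=\frac{kN}{2\pi i},\qquad \frac{v_1}{v_2}=\exp\Big(\frac{2\pi i z}{N}\Big),\qquad -\Im(\tau)<\Im(z)<0 .$$ Then the evaluation homomorphisms $\pi_{v_1},\pi_{v_2}:\ell(\mathcal{G},\mu)\to\mathcal{G}$ relate the $\ell(\mathcal{G},\mu)\otimes\ell(\mathcal{G},\mu)$-valued dynamical $r$-matrix $r^{k,+}$ to the $\mathcal{G}\otimes\mathcal{G}$-valued function $r^\tau$ (all defined in the context) by $$(\pi_{v_1}\otimes\pi_{v_2})\big(r^{k,+}(\omega)\big)=r^\tau(\omega,z)\qquad\forall\,\omega\in\mathcal{B}_k=\mathcal{B}^\tau ,$$ where the left-hand side is the infinite series in $\mathcal{G}\otimes\mathcal{G}$ obtained by applying $\pi_{v_1}\otimes\pi_{v_2}$ termwise to the series defining $r^{k,+}(\omega)$, and the equality means that this series converges to the right-hand side.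
   Context: Eigenspaces and loop algebra: $\mathcal{G}=\oplus_{a\in\mathcal{E}_\mu}\mathcal{G}_a$, where $\mathcal{G}_a=\{\xi\in\mathcal{G}\mid\mu(\xi)=e^{2\pi i a/N}\xi\}$ and $\mathcal{E}_\mu\subset\{0,\dots,N-1\}$ is the set of $a$ with $\mathcal{G}_a\neq\{0\}$; $0\in\mathcal{E}_\mu$. The twisted loop algebra $\ell(\mathcal{G},\mu)\subset\mathcal{G}\otimes\mathbb{C}[t,t^{-1}]$ is spanned by the elements $\xi^{n_a}:=\xi\otimes t^{n_a}$ with $\xi\in\mathcal{G}_a$, $a\in\mathcal{E}_\mu$, $n_a\in a+N\mathbb{Z}$; it is graded by the power of $t$ with homogeneous subspaces $\ell(\mathcal{G},\mu)_{n}=\mathcal{G}_a\otimes t^{n}$ for $n\in a+N\mathbb{Z}$, has bracket $[\xi^{n_a},\eta^{p_b}]=[\xi,\eta]^{n_a+p_b}$ and scalar product $\langle\xi^{n_a},\eta^{p_b}\rangle=\delta_{n_a,-p_b}B(\xi,\eta)$; $\mathcal{G}_0$ is identified with $\mathcal{G}_0\otimes t^0$. For $v\in\mathbb{C}\setminus\{0\}$ the evaluation homomorphism $\pi_v:\ell(\mathcal{G},\mu)\to\mathcal{G}$ is $\pi_v(\xi\otimes t^n)=v^n\xi$. The $r$-matrix $r^{k,+}$: let $f(w)=\frac12\coth\frac w2-\frac1w$ (with $f(0)=0$) and $F(w)=\frac12\coth\frac w2$. The set $\mathcal{B}_k\subset\mathcal{G}_0$ consists of those $\omega\in\mathcal{G}_0$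 such that: $\lambda_a+k(a+mN)\notin2\pi i\mathbb{Z}$ for all $m\in\mathbb{Z}$, all $a\in\mathcal{E}_\mu\setminus\{0\}$ and every eigenvalue $\lambda_a$ of $\mathrm{ad}\,\omega\vert_{\mathcal{G}_a}$; and, for every eigenvalue $\lambda_0$ of $\mathrm{ad}\,\omega\vert_{\mathcal{G}_0}$, $\lambda_0\notin2\pi i(\mathbb{Z}\setminus\{0\})$ and $\lambda_0+kmN\notin2\pi i\mathbb{Z}$ for all $m\in\mathbb{Z}\setminus\{0\}$. For $\omega\in\mathcal{B}_k$ the operator $R_k(\omega)\in\mathrm{End}(\ell(\mathcal{G},\mu))$ is $$R_k(\omega)\eta=f(\mathrm{ad}\,\omega)\eta\ \ (\eta\in\mathcal{G}_0),\qquad R_k(\omega)\xi^{n_a}=F(kn_a+\mathrm{ad}\,\omega)\xi^{n_a}\ \ (\xi\in\mathcal{G}_a,\ n_a\in a+N\mathbb{Z},\ n_a\neq0),$$ and $R_k^+(\omega)=R_k(\omega)+\frac12I$, $I$ being the identity. The associated tensor, an element of a completion of $\ell(\mathcal{G},\mu)\otimes\ell(\mathcal{G},\mu)$, is the formal series $$r^{k,+}(\omega)=\sum_{n\in\mathcal{E}_\mu+N\mathbb{Z}}\ \sum_i\big(R_k^+(\omega)T_i[n]\big)\otimes T^i[-n],$$ where $\{T_i[n]\}_i$ is a basis of $\ell(\mathcal{G},\mu)_n$ and $\{T^i[-n]\}_i$ is the dual basis of $\ell(\mathcal{G},\mu)_{-n}$, $\langle T_i[n],T^j[-n]\rangle=\delta_i^j$.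 The function $r^\tau$: for $\Im(\tau)>0$ put $\Omega=\mathbb{Z}+\tau\mathbb{Z}$, $$\theta_1(z\vert\tau)=-\sum_{j\in\mathbb{Z}}\exp\Big(\pi i(j+\tfrac12)^2\tau+2\pi i(j+\tfrac12)(z+\tfrac12)\Big),\qquad \chi(w,z\vert\tau)=\frac{1}{2\pi i}\frac{\theta_1(\frac{w}{2\pi i}+z\vert\tau)\theta_1'(0\vert\tau)}{\theta_1(z\vert\tau)\theta_1(\frac{w}{2\pi i}\vert\tau)},$$ $$\chi_a(w,z\vert\tau)=e^{\frac{2\pi i a z}{N}}\Big(\chi\big(w+2\pi i\tfrac aN\tau,z\vert\tau\big)-\frac{\delta_{a,0}}{w}\Big),\qquad a\in\{0,\dots,N-1\},$$ which is holomorphic on $(\mathbb{C}\setminus2\pi i\,\Omega_a)\times(\mathbb{C}\setminus\Omega)$ with $\Omega_a=(\Omega-\frac aN\tau)\setminus\{0\}$ (removable singularity at $w=0$ for $a=0$). Let $$\mathcal{B}^\tau=\{\omega\in\mathcal{G}_0\mid\text{the spectrum of }\mathrm{ad}\,\omega\vert_{\mathcal{G}_a}\text{ does not meet }2\pi i\,\Omega_a,\ \forall a\in\mathcal{E}_\mu\};$$ for $\tau=\frac{kN}{2\pi i}$ one has $\mathcal{B}^\tau=\mathcal{B}_k$. For $\omega\in\mathcal{B}^\tau$ and $z\in\mathbb{C}\setminus\Omega$, $\mathcal{R}_\tau(\omega,z)\in\mathrm{End}(\mathcal{G})$ is defined by $\mathcal{R}_\tau(\omega,z)\vert_{\mathcal{G}_a}=\chi_a(\mathrm{ad}\,\omega\vert_{\mathcal{G}_a},z\vert\tau)$,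 and $$r^\tau(\omega,z)=\sum_{\alpha,\beta}B(T_\alpha,\mathcal{R}_\tau(\omega,z)T_\beta)\,T^\alpha\otimes T^\beta$$ with dual bases $T_\alpha$, $T^\beta$ of $\mathcal{G}$, $B(T_\alpha,T^\beta)=\delta_\alpha^\beta$. Functions of operators on finite-dimensional spaces are defined by the holomorphic functional calculus, $H(A)=\frac{1}{2\pi i}\oint_\Gamma H(w)(wI-A)^{-1}dw$, with $\Gamma$ encircling each eigenvalue of $A$ inside the holomorphy domain of $H$. *)

theory Defs
  imports "HOL-Complex_Analysis.Complex_Analysis" "HOL-Library.Poly_Mapping"
begin

section \<open>Complex vector spaces\<close>

class complex_vector = ab_group_add +
  fixes scaleC :: "complex \<Rightarrow> 'a \<Rightarrow> 'a"  (infixr \<open>*\<^sub>C\<close> 75)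
  assumes scaleC_add_right: "c *\<^sub>C (x + y) = c *\<^sub>C x + c *\<^sub>C y"
    and scaleC_add_left: "(c + d) *\<^sub>C x = c *\<^sub>C x + d *\<^sub>C x"
    and scaleC_scaleC: "c *\<^sub>C d *\<^sub>C x = (c * d) *\<^sub>C x"
    and scaleC_one: "1 *\<^sub>C x = x"

global_interpretation complex_vector: vector_space "scaleC :: complex \<Rightarrow> 'a \<Rightarrow> 'a::complex_vector"
  by unfold_locales (rule scaleC_add_right scaleC_add_left scaleC_scaleC scaleC_one)+

abbreviation cspan :: "'a::complex_vector set \<Rightarrow> 'a set"
  where "cspan \<equiv> module.span scaleC"

abbreviation cdependent :: "'a::complex_vector set \<Rightarrow> bool"
  where "cdependent \<equiv> module.dependent scaleC"

abbreviation clinear :: "('a::complex_vector \<Rightarrow> 'b::complex_vector) \<Rightarrow> bool"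
  where "clinear \<equiv> Vector_Spaces.linear scaleC scaleC"

definition cbilinear :: "('a::complex_vector \<Rightarrow> 'b::complex_vector \<Rightarrow> 'c::complex_vector) \<Rightarrow> bool"
  where "cbilinear f \<longleftrightarrow> (\<forall>x. clinear (f x)) \<and> (\<forall>y. clinear (\<lambda>x. f x y))"

instantiation complex :: complex_vector
begin
definition scaleC_complex :: "complex \<Rightarrow> complex \<Rightarrow> complex"
  where "scaleC_complex = (*)"
instance by standard (simp_all add: scaleC_complex_def algebra_simps)
end

instantiation poly_mapping :: (type, complex_vector) complex_vector
begin
lift_definition scaleC_poly_mapping :: "complex \<Rightarrow> ('a \<Rightarrow>\<^sub>0 'b) \<Rightarrow> ('a \<Rightarrow>\<^sub>0 'b)"
  is "\<lambda>c f k. c *\<^sub>C f k"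
  by (erule rev_finite_subset) auto
instance
  by standard
    (transfer; simp add: fun_eq_iff scaleC_add_right scaleC_add_left scaleC_scaleC scaleC_one)+
end

lemma lookup_scaleC: "Poly_Mapping.lookup (c *\<^sub>C p) k = c *\<^sub>C Poly_Mapping.lookup p k"
  by transfer simp

definition is_cbasis :: "'a::complex_vector set \<Rightarrow> nat \<Rightarrow> (nat \<Rightarrow> 'a) \<Rightarrow> bool"
  where "is_cbasis V d T \<longleftrightarrow>
    inj_on T {..<d} \<and> \<not> cdependent (T ` {..<d}) \<and> cspan (T ` {..<d}) = V"

definition dual_bases ::
    "('a::complex_vector \<Rightarrow> 'b::complex_vector \<Rightarrow> complex) \<Rightarrow> 'a set \<Rightarrow> 'b set \<Rightarrow> nat
      \<Rightarrow> (nat \<Rightarrow> 'a) \<Rightarrow> (nat \<Rightarrow> 'b) \<Rightarrow> bool"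
  where "dual_bases \<beta> V W d T T' \<longleftrightarrow> is_cbasis V d T \<and> is_cbasis W d T' \<and>
    (\<forall>i<d. \<forall>j<d. \<beta> (T i) (T' j) = (if i = j then 1 else 0))"


section \<open>Tensor products\<close>

definition tensor_relators :: "('a::complex_vector \<times> 'b::complex_vector \<Rightarrow>\<^sub>0 complex) set"
  where "tensor_relators =
      {Poly_Mapping.single (x + x', y) 1 - Poly_Mapping.single (x, y) 1 - Poly_Mapping.single (x', y) 1 | x x' y. True}
    \<union> {Poly_Mapping.single (x, y + y') 1 - Poly_Mapping.single (x, y) 1 - Poly_Mapping.single (x, y') 1 | x y y'. True}
    \<union> {Poly_Mapping.single (c *\<^sub>C x, y) 1 - c *\<^sub>C Poly_Mapping.single (x, y) 1 | c x y. True}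
    \<union> {Poly_Mapping.single (x, c *\<^sub>C y) 1 - c *\<^sub>C Poly_Mapping.single (x, y) 1 | c x y. True}"

definition tensor_rel ::
    "('a::complex_vector \<times> 'b::complex_vector \<Rightarrow>\<^sub>0 complex) \<Rightarrow> ('a \<times> 'b \<Rightarrow>\<^sub>0 complex) \<Rightarrow> bool"
  where "tensor_rel p q \<longleftrightarrow> p - q \<in> cspan tensor_relators"

lemma equivp_tensor_rel:
  "equivp (tensor_rel :: ('a::complex_vector \<times> 'b::complex_vector \<Rightarrow>\<^sub>0 complex) \<Rightarrow> _)"
proof (rule equivpI)
  show "reflp (tensor_rel :: ('a \<times> 'b \<Rightarrow>\<^sub>0 complex) \<Rightarrow> _)"
    by (simp add: reflp_def tensor_rel_def complex_vector.span_zero)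
  show "symp (tensor_rel :: ('a \<times> 'b \<Rightarrow>\<^sub>0 complex) \<Rightarrow> _)"
  proof (rule sympI)
    fix p q :: "'a \<times> 'b \<Rightarrow>\<^sub>0 complex"
    assume "tensor_rel p q"
    then have "- (p - q) \<in> cspan tensor_relators"
      unfolding tensor_rel_def by (rule complex_vector.span_neg)
    then show "tensor_rel q p"
      by (simp add: tensor_rel_def)
  qed
  show "transp (tensor_rel :: ('a \<times> 'b \<Rightarrow>\<^sub>0 complex) \<Rightarrow> _)"
  proof (rule transpI)
    fix p q r :: "'a \<times> 'b \<Rightarrow>\<^sub>0 complex"
    assume "tensor_rel p q" "tensor_rel q r"
    then have "(p - q) + (q - r) \<in> cspan tensor_relators"
      unfolding tensor_rel_def by (rule complex_vector.span_add)
    then show "tensor_rel p r"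
      by (simp add: tensor_rel_def)
  qed
qed

quotient_type (overloaded) ('a, 'b) tensor =
    "'a::complex_vector \<times> 'b::complex_vector \<Rightarrow>\<^sub>0 complex" / tensor_rel
  by (rule equivp_tensor_rel)

instantiation tensor :: (complex_vector, complex_vector) complex_vector
begin

lift_definition zero_tensor :: "('a, 'b) tensor" is 0 .

lift_definition plus_tensor :: "('a, 'b) tensor \<Rightarrow> ('a, 'b) tensor \<Rightarrow> ('a, 'b) tensor"
  is "(+)"
  unfolding tensor_rel_def by (simp only: add_diff_add complex_vector.span_add)

lift_definition uminus_tensor :: "('a, 'b) tensor \<Rightarrow> ('a, 'b) tensor"
  is uminus
  unfolding tensor_rel_def by (simp only: minus_diff_minus complex_vector.span_neg)

lift_definition minus_tensor :: "('a, 'b) tensor \<Rightarrow> ('a, 'b) tensor \<Rightarrow> ('a, 'b) tensor"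
  is "(-)"
proof -
  fix p p' q q' :: "'a \<times> 'b \<Rightarrow>\<^sub>0 complex"
  assume "tensor_rel p p'" "tensor_rel q q'"
  moreover have "p - q - (p' - q') = (p - p') - (q - q')"
    by (simp add: algebra_simps)
  ultimately show "tensor_rel (p - q) (p' - q')"
    unfolding tensor_rel_def by (simp only: complex_vector.span_diff)
qed

lift_definition scaleC_tensor :: "complex \<Rightarrow> ('a, 'b) tensor \<Rightarrow> ('a, 'b) tensor"
  is scaleC
  unfolding tensor_rel_def
  by (simp only: complex_vector.span_scale flip: complex_vector.scale_right_diff_distrib)

instance
  by standard (transfer; simp add: algebra_simps scaleC_add_right scaleC_add_left scaleC_scaleC
      scaleC_one equivp_reflp[OF equivp_tensor_rel])+

end

lift_definition tensor_prod :: "'a::complex_vector \<Rightarrow> 'b::complex_vector \<Rightarrow> ('a, 'b) tensor"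
    (infixr \<open>\<otimes>\<close> 76)
  is "\<lambda>x y. Poly_Mapping.single (x, y) 1" .

text \<open>Tensor products carry the initial topology of all linear functionals, which in finite
  dimension is the unique Hausdorff vector space topology.\<close>

instantiation tensor :: (complex_vector, complex_vector) topological_space
begin
definition open_tensor :: "('a, 'b) tensor set \<Rightarrow> bool"
  where "open_tensor = generate_topology {\<phi> -` U | (\<phi> :: ('a, 'b) tensor \<Rightarrow> complex) U. clinear \<phi> \<and> open U}"
instance
proof
  show "open (UNIV :: ('a, 'b) tensor set)"
    unfolding open_tensor_def by (rule generate_topology.UNIV)
  show "open (S \<inter> T)" if "open S" "open T" for S T :: "('a, 'b) tensor set"
    using that unfolding open_tensor_def by (rule generate_topology.Int)
  show "open (\<Union> K)" if "\<forall>S\<in>K. open S" for K :: "('a, 'b) tensor set set"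
    using that unfolding open_tensor_def by (intro generate_topology.UN) blast
qed
end

definition tensor_map ::
    "('a::complex_vector \<Rightarrow> 'c::complex_vector) \<Rightarrow> ('b::complex_vector \<Rightarrow> 'd::complex_vector)
      \<Rightarrow> ('a, 'b) tensor \<Rightarrow> ('c, 'd) tensor"
  where "tensor_map f g = (THE h. clinear h \<and> (\<forall>x y. h (x \<otimes> y) = f x \<otimes> g y))"


section \<open>Functions of operators\<close>

definition spectrum_on :: "'a::complex_vector set \<Rightarrow> ('a \<Rightarrow> 'a) \<Rightarrow> complex set"
  where "spectrum_on V A = {\<nu>. \<exists>x\<in>V. x \<noteq> 0 \<and> A x = \<nu> *\<^sub>C x}"

definition resolvent_on :: "'a::complex_vector set \<Rightarrow> ('a \<Rightarrow> 'a) \<Rightarrow> complex \<Rightarrow> 'a \<Rightarrow> 'a"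
  where "resolvent_on V A w = inv_into V (\<lambda>y. w *\<^sub>C y - A y)"

text \<open>The contour \<open>\<Gamma>\<close> consists of one circle around each eigenvalue; the closed disc it bounds
  lies in the holomorphy domain of \<open>H\<close> and contains no other eigenvalue.\<close>

definition contour_radius :: "(complex \<Rightarrow> complex) \<Rightarrow> complex set \<Rightarrow> real"
  where "contour_radius H \<Lambda> =
    (SOME r. r > 0 \<and> (\<forall>\<nu>\<in>\<Lambda>. H analytic_on cball \<nu> r \<and> cball \<nu> r \<inter> \<Lambda> = {\<nu>}))"

text \<open>The function \<open>H(A)\<close> of the restriction of \<open>A\<close> to an invariant finite-dimensional subspace
  \<open>V\<close>; the vector-valued contour integral is taken in the weak sense, against all linear
  functionals.\<close>

definition operator_fun ::
    "'a::complex_vector set \<Rightarrow> (complex \<Rightarrow> complex) \<Rightarrow> ('a \<Rightarrow> 'a) \<Rightarrow> 'a \<Rightarrow> 'a"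
  where "operator_fun V H A x =
    (THE y. y \<in> V \<and> (\<forall>\<phi>. clinear \<phi> \<longrightarrow>
      \<phi> y = 1 / (2 * of_real pi * \<i>) *
        (\<Sum>\<nu>\<in>spectrum_on V A.
          contour_integral (circlepath \<nu> (contour_radius H (spectrum_on V A)))
            (\<lambda>w. H w * \<phi> (resolvent_on V A w x)))))"


section \<open>Lie algebras, invariant forms and automorphisms\<close>

definition finite_dimensional :: "'a::complex_vector set \<Rightarrow> bool"
  where "finite_dimensional V \<longleftrightarrow> (\<exists>S. finite S \<and> cspan S = V)"

locale complex_lie_algebra =
  fixes lie :: "'g::complex_vector \<Rightarrow> 'g \<Rightarrow> 'g"
  assumes bilinear: "cbilinear lie"
    and alternating: "lie x x = 0"
    and jacobi: "lie x (lie y z) + lie y (lie z x) + lie z (lie x y) = 0"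

definition invariant_form :: "('g::complex_vector \<Rightarrow> 'g \<Rightarrow> 'g) \<Rightarrow> ('g \<Rightarrow> 'g \<Rightarrow> complex) \<Rightarrow> bool"
  where "invariant_form lie B \<longleftrightarrow> (\<forall>x y z. B (lie x y) z = B x (lie y z))"

definition nondegenerate_form :: "('g::complex_vector \<Rightarrow> 'g \<Rightarrow> complex) \<Rightarrow> bool"
  where "nondegenerate_form B \<longleftrightarrow> (\<forall>x. (\<forall>y. B x y = 0) \<longrightarrow> x = 0)"

definition lie_automorphism :: "('g::complex_vector \<Rightarrow> 'g \<Rightarrow> 'g) \<Rightarrow> ('g \<Rightarrow> 'g) \<Rightarrow> bool"
  where "lie_automorphism lie \<mu> \<longleftrightarrow>
    clinear \<mu> \<and> bij \<mu> \<and> (\<forall>x y. \<mu> (lie x y) = lie (\<mu> x) (\<mu> y))"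

definition has_finite_order :: "('g \<Rightarrow> 'g) \<Rightarrow> nat \<Rightarrow> bool"
  where "has_finite_order \<mu> N \<longleftrightarrow> N > 0 \<and> \<mu> ^^ N = id \<and> (\<forall>m. 0 < m \<and> m < N \<longrightarrow> \<mu> ^^ m \<noteq> id)"

definition eigenspace :: "('g::complex_vector \<Rightarrow> 'g) \<Rightarrow> nat \<Rightarrow> int \<Rightarrow> 'g set"
  where "eigenspace \<mu> N a = {\<xi>. \<mu> \<xi> = exp (2 * of_real pi * \<i> * of_int a / of_nat N) *\<^sub>C \<xi>}"

definition eigen_indices :: "('g::complex_vector \<Rightarrow> 'g) \<Rightarrow> nat \<Rightarrow> int set"
  where "eigen_indices \<mu> N = {a. 0 \<le> a \<and> a < int N \<and> eigenspace \<mu> N a \<noteq> {0}}"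


section \<open>The twisted loop algebra\<close>

text \<open>The space of Laurent polynomials with coefficients in \<open>'g\<close> is \<open>int \<Rightarrow>\<^sub>0 'g\<close>, the element
  \<open>Poly_Mapping.single n \<xi>\<close> being \<open>\<xi> \<otimes> t^n\<close>.  Operators and the form on the twisted loop
  algebra are given by their formulas on all Laurent polynomials.\<close>

definition loop_algebra :: "('g::complex_vector \<Rightarrow> 'g) \<Rightarrow> nat \<Rightarrow> (int \<Rightarrow>\<^sub>0 'g) set"
  where "loop_algebra \<mu> N = cspan
    {Poly_Mapping.single (a + int N * m) \<xi> | a m \<xi>. a \<in> eigen_indices \<mu> N \<and> \<xi> \<in> eigenspace \<mu> N a}"

definition loop_degrees :: "('g::complex_vector \<Rightarrow> 'g) \<Rightarrow> nat \<Rightarrow> int set"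
  where "loop_degrees \<mu> N = {a + int N * m | a m. a \<in> eigen_indices \<mu> N}"

definition loop_homogeneous :: "('g::complex_vector \<Rightarrow> 'g) \<Rightarrow> nat \<Rightarrow> int \<Rightarrow> (int \<Rightarrow>\<^sub>0 'g) set"
  where "loop_homogeneous \<mu> N n = {p \<in> loop_algebra \<mu> N. Poly_Mapping.keys p \<subseteq> {n}}"

definition loop_form :: "('g::complex_vector \<Rightarrow> 'g \<Rightarrow> complex) \<Rightarrow> (int \<Rightarrow>\<^sub>0 'g) \<Rightarrow> (int \<Rightarrow>\<^sub>0 'g) \<Rightarrow> complex"
  where "loop_form B p q =
    (\<Sum>n\<in>Poly_Mapping.keys p. B (Poly_Mapping.lookup p n) (Poly_Mapping.lookup q (- n)))"

definition evaluation :: "complex \<Rightarrow> (int \<Rightarrow>\<^sub>0 'g) \<Rightarrow> 'g::complex_vector"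
  where "evaluation v p = (\<Sum>n\<in>Poly_Mapping.keys p. (v powi n) *\<^sub>C Poly_Mapping.lookup p n)"


section \<open>The dynamical r-matrix of the twisted loop algebra\<close>

definition coth_half :: "complex \<Rightarrow> complex"
  where "coth_half w = 1/2 * (cosh (w/2) / sinh (w/2))"

definition coth_half_reg :: "complex \<Rightarrow> complex"
  where "coth_half_reg w = (if w = 0 then 0 else coth_half w - 1 / w)"

definition two_pi_i_int :: "complex set"
  where "two_pi_i_int = range (\<lambda>j::int. 2 * of_real pi * \<i> * of_int j)"

definition admissible_k ::
    "('g::complex_vector \<Rightarrow> 'g \<Rightarrow> 'g) \<Rightarrow> ('g \<Rightarrow> 'g) \<Rightarrow> nat \<Rightarrow> complex \<Rightarrow> 'g set"
  where "admissible_k lie \<mu> N k = {\<omega> \<in> eigenspace \<mu> N 0.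
    (\<forall>m::int. \<forall>a\<in>eigen_indices \<mu> N - {0}. \<forall>\<nu>\<in>spectrum_on (eigenspace \<mu> N a) (lie \<omega>).
        \<nu> + k * of_int (a + m * int N) \<notin> two_pi_i_int) \<and>
    (\<forall>\<nu>\<in>spectrum_on (eigenspace \<mu> N 0) (lie \<omega>).
        \<nu> \<notin> two_pi_i_int - {0} \<and>
        (\<forall>m::int. m \<noteq> 0 \<longrightarrow> \<nu> + k * of_int (m * int N) \<notin> two_pi_i_int))}"

definition loop_R ::
    "('g::complex_vector \<Rightarrow> 'g \<Rightarrow> 'g) \<Rightarrow> ('g \<Rightarrow> 'g) \<Rightarrow> nat \<Rightarrow> complex \<Rightarrow> 'g \<Rightarrow> (int \<Rightarrow>\<^sub>0 'g) \<Rightarrow> (int \<Rightarrow>\<^sub>0 'g)"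
  where "loop_R lie \<mu> N k \<omega> p =
    (\<Sum>n\<in>Poly_Mapping.keys p. Poly_Mapping.single n
      (if n = 0
       then operator_fun (eigenspace \<mu> N 0) coth_half_reg (lie \<omega>) (Poly_Mapping.lookup p n)
       else operator_fun (eigenspace \<mu> N (n mod int N)) coth_half
              (\<lambda>\<xi>. (k * of_int n) *\<^sub>C \<xi> + lie \<omega> \<xi>) (Poly_Mapping.lookup p n)))"

definition loop_R_plus ::
    "('g::complex_vector \<Rightarrow> 'g \<Rightarrow> 'g) \<Rightarrow> ('g \<Rightarrow> 'g) \<Rightarrow> nat \<Rightarrow> complex \<Rightarrow> 'g \<Rightarrow> (int \<Rightarrow>\<^sub>0 'g) \<Rightarrow> (int \<Rightarrow>\<^sub>0 'g)"
  where "loop_R_plus lie \<mu> N k \<omega> p = loop_R lie \<mu> N k \<omega> p + (1/2) *\<^sub>C p"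

text \<open>The formal series over \<open>n \<in> loop_degrees \<mu> N\<close> is represented by the family of its terms.
  For each \<open>n\<close>, \<open>T n\<close> and \<open>T' n\<close> are the chosen basis of degree \<open>n\<close> and its dual basis of degree
  \<open>- n\<close>.\<close>

definition r_loop_term ::
    "('g::complex_vector \<Rightarrow> 'g \<Rightarrow> 'g) \<Rightarrow> ('g \<Rightarrow> 'g) \<Rightarrow> nat \<Rightarrow> complex \<Rightarrow> (int \<Rightarrow> nat)
      \<Rightarrow> (int \<Rightarrow> nat \<Rightarrow> (int \<Rightarrow>\<^sub>0 'g)) \<Rightarrow> (int \<Rightarrow> nat \<Rightarrow> (int \<Rightarrow>\<^sub>0 'g)) \<Rightarrow> 'g
      \<Rightarrow> int \<Rightarrow> (int \<Rightarrow>\<^sub>0 'g, int \<Rightarrow>\<^sub>0 'g) tensor"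
  where "r_loop_term lie \<mu> N k d T T' \<omega> n =
    (\<Sum>i<d n. loop_R_plus lie \<mu> N k \<omega> (T n i) \<otimes> T' n i)"


section \<open>The elliptic dynamical r-matrix\<close>

definition theta1 :: "complex \<Rightarrow> complex \<Rightarrow> complex"
  where "theta1 \<tau> z = - (\<Sum>\<^sub>\<infinity>j::int.
    exp (of_real pi * \<i> * (of_int j + 1/2)\<^sup>2 * \<tau> + 2 * of_real pi * \<i> * (of_int j + 1/2) * (z + 1/2)))"

definition chi :: "complex \<Rightarrow> complex \<Rightarrow> complex \<Rightarrow> complex"
  where "chi \<tau> w z = 1 / (2 * of_real pi * \<i>) *
    (theta1 \<tau> (w / (2 * of_real pi * \<i>) + z) * deriv (theta1 \<tau>) 0
      / (theta1 \<tau> z * theta1 \<tau> (w / (2 * of_real pi * \<i>))))"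

text \<open>Only the singularity at \<open>w = 0\<close> for \<open>a = 0\<close> is removable.\<close>

definition chi_a :: "nat \<Rightarrow> complex \<Rightarrow> int \<Rightarrow> complex \<Rightarrow> complex \<Rightarrow> complex"
  where "chi_a N \<tau> a w z = remove_sings
    (\<lambda>w. exp (2 * of_real pi * \<i> * of_int a * z / of_nat N) *
      (chi \<tau> (w + 2 * of_real pi * \<i> * (of_int a / of_nat N) * \<tau>) z - (if a = 0 then 1 / w else 0))) w"

definition period_lattice :: "complex \<Rightarrow> complex set"
  where "period_lattice \<tau> = {of_int m + \<tau> * of_int n | m n. True}"

definition shifted_lattice :: "nat \<Rightarrow> complex \<Rightarrow> int \<Rightarrow> complex set"
  where "shifted_lattice N \<tau> a =
    (\<lambda>x. x - of_int a / of_nat N * \<tau>) ` period_lattice \<tau> - {0}"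

definition admissible_tau ::
    "('g::complex_vector \<Rightarrow> 'g \<Rightarrow> 'g) \<Rightarrow> ('g \<Rightarrow> 'g) \<Rightarrow> nat \<Rightarrow> complex \<Rightarrow> 'g set"
  where "admissible_tau lie \<mu> N \<tau> = {\<omega> \<in> eigenspace \<mu> N 0.
    \<forall>a\<in>eigen_indices \<mu> N.
      spectrum_on (eigenspace \<mu> N a) (lie \<omega>) \<inter> (\<lambda>x. 2 * of_real pi * \<i> * x) ` shifted_lattice N \<tau> a = {}}"

definition elliptic_R ::
    "('g::complex_vector \<Rightarrow> 'g \<Rightarrow> 'g) \<Rightarrow> ('g \<Rightarrow> 'g) \<Rightarrow> nat \<Rightarrow> complex \<Rightarrow> 'g \<Rightarrow> complex \<Rightarrow> 'g \<Rightarrow> 'g"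
  where "elliptic_R lie \<mu> N \<tau> \<omega> z = (THE L. clinear L \<and>
    (\<forall>a\<in>eigen_indices \<mu> N. \<forall>\<xi>\<in>eigenspace \<mu> N a.
      L \<xi> = operator_fun (eigenspace \<mu> N a) (\<lambda>w. chi_a N \<tau> a w z) (lie \<omega>) \<xi>))"

definition r_elliptic ::
    "('g::complex_vector \<Rightarrow> 'g \<Rightarrow> 'g) \<Rightarrow> ('g \<Rightarrow> 'g \<Rightarrow> complex) \<Rightarrow> ('g \<Rightarrow> 'g) \<Rightarrow> nat \<Rightarrow> complex
      \<Rightarrow> nat \<Rightarrow> (nat \<Rightarrow> 'g) \<Rightarrow> (nat \<Rightarrow> 'g) \<Rightarrow> 'g \<Rightarrow> complex \<Rightarrow> ('g, 'g) tensor"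
  where "r_elliptic lie B \<mu> N \<tau> d T T' \<omega> z =
    (\<Sum>\<alpha><d. \<Sum>\<beta><d. B (T \<alpha>) (elliptic_R lie \<mu> N \<tau> \<omega> z (T \<beta>)) *\<^sub>C (T' \<alpha> \<otimes> T' \<beta>))"

end

theory Submission
  imports Defs
begin

text \<open>The series splits along the eigenspaces \<open>E a\<close> and along \<open>n = a + N m\<close>. As
  \<open>coth_half u + 1/2 = 1 / (1 - exp (- u))\<close>, the operator on \<open>E a\<close> is a function of \<open>ad \<omega>\<close> that is a
  Kronecker series \<open>\<Sum>m. X\<^sup>m / (1 - y q\<^sup>m)\<close> with \<open>q = exp (2 \<pi> \<i> \<tau>)\<close>, \<open>X = exp (- 2 \<pi> \<i> z)\<close> and
  \<open>y = exp (- w)\<close>; the hypothesis on \<open>z\<close> says \<open>\<bar>q\<bar> < \<bar>X\<bar> < 1\<close>, so it converges locally uniformly in \<open>w\<close> and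
  may be integrated along the contours of the functional calculus.

  For \<open>\<bar>q\<bar> < \<bar>y\<bar> < 1\<close> a double geometric series shows that the Kronecker series is symmetric in \<open>X\<close> and
  \<open>y\<close>. Multiplying it by the theta series of \<open>y\<close>, the coefficients of the powers of \<open>y\<close> satisfy the recursion
  of the theta coefficients, so the product is a multiple of \<open>theta (X y)\<close>; the factor is found from \<open>y \<rightarrow> 1\<close>.
  Analytic continuation in \<open>y\<close> extends the identity, and the zeros of theta are read off from it.\<close>

section \<open>Sums over the integers and the theta series\<close>

text \<open>Three features of the definitions shape the proof. \<open>contour_radius\<close> is
  chosen anew for each function and each spectrum, so the integrals defining two operator functions
  cannot be compared directly; sums of residues over the spectrum, which do not see the radius,
  mediate between them. The operator \<open>lie \<omega>\<close> need not be diagonalizable, so an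
  identity of values at the eigenvalues is not enough: the series has to converge uniformly on
  circles around them. Finally, for a = 0 the spectrum contains 0, which is a pole of the single
  term of degree 0; the regular part of that term is carried along separately, and the identity with
  \<open>chi_a\<close> is extended to 0 by continuity.

  Vector-valued statements are tested against linear functionals, which matches the weak definition
  of the contour integral and the topology on tensors. Since the series is indexed by integers,
  convergence is \<open>has_sum\<close>, the unordered one, and each interchange of limits rests on
  a summable majorant.\<close>

lemma summable_on_int_abs:
  fixes a :: "nat \<Rightarrow> real"
  assumes "\<And>n. 0 \<le> a n" and "summable a"
  shows "(\<lambda>j::int. a (nat \<bar>j\<bar>)) summable_on UNIV"
proof -
  have a: "a summable_on UNIV"
    using assms by (simp add: summable_on_UNIV_nonneg_real_iff)
  have "(\<lambda>j::int. a (nat \<bar>j\<bar>)) summable_on {0..}"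
    using a by (subst summable_on_reindex_bij_witness[where T = UNIV and i = int and j = nat and h = a]) auto
  moreover have "(\<lambda>j::int. a (nat \<bar>j\<bar>)) summable_on {..<0}"
    using summable_on_subset_banach[OF a, of "{1..}"]
    by (subst summable_on_reindex_bij_witness[where T = "{1..}" and i = "\<lambda>n. - int n"
          and j = "\<lambda>j. nat (- j)" and h = a]) auto
  ultimately have "(\<lambda>j::int. a (nat \<bar>j\<bar>)) summable_on ({0..} \<union> {..<0})"
    by (intro summable_on_Un_disjoint) auto
  also have "{0..} \<union> {..<0} = (UNIV :: int set)"
    by auto
  finally show ?thesis .
qed

lemma abs_summable_on_times:
  fixes f g :: "_ \<Rightarrow> complex"
  assumes "(\<lambda>x. norm (f x)) summable_on A" and "(\<lambda>y. norm (g y)) summable_on B"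
  shows "(\<lambda>(x, y). norm (f x * g y)) summable_on A \<times> B"
proof -
  have "(\<lambda>(x, y). norm (f x) * norm (g y)) summable_on (SIGMA x:A. B)"
  proof (rule summable_on_SigmaI)
    show "((\<lambda>y. case (x, y) of (x, y) \<Rightarrow> norm (f x) * norm (g y)) has_sum norm (f x) * infsum (\<lambda>y. norm (g y)) B) B"
      for x
      using assms(2) by (auto intro!: has_sum_cmult_right)
    show "(\<lambda>x. norm (f x) * infsum (\<lambda>y. norm (g y)) B) summable_on A"
      using assms(1) by (rule summable_on_cmult_left)
  qed auto
  then show ?thesis
    by (simp add: case_prod_unfold norm_mult)
qed

lemma has_sum_powi_nonneg:
  fixes c :: complex
  assumes "norm c < 1" "c \<noteq> 0"
  shows "((\<lambda>n. c powi n) has_sum 1 / (1 - c)) {0..}"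
proof -
  have "((\<lambda>n. c * c powi n) has_sum c * (1 / (1 - c))) {0..}"
    using has_sum_geometric_from_1[OF assms(1)] assms(2)
    by (subst has_sum_reindex_bij_witness[where T = "{1..}" and i = "\<lambda>n. int n - 1"
          and j = "\<lambda>n. nat (n + 1)" and h = "\<lambda>n. c ^ n" and s' = "c / (1 - c)"])
       (auto simp: power_int_def nat_add_distrib)
  then show ?thesis
    using assms(2) by (simp add: has_sum_cmult_right_iff)
qed

text \<open>This is the expansion of 1/(1 - c) at infinity. Its sign, opposite to that of
  \<open>has_sum_powi_nonneg\<close>, is the reason for the two signs in the double series of
  \<open>kronecker_symmetric\<close>.\<close>

lemma has_sum_powi_neg:
  fixes c :: complex
  assumes "norm c > 1"
  shows "((\<lambda>n. c powi n) has_sum - 1 / (1 - c)) {..<0}"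
proof -
  have "norm (inverse c) < 1"
    using assms by (simp add: norm_inverse inverse_less_1_iff)
  moreover from assms have "c \<noteq> 0" "c \<noteq> 1" by auto
  moreover from this have "inverse c / (1 - inverse c) = - 1 / (1 - c)"
    by (simp add: divide_simps)
  ultimately show ?thesis
    using has_sum_geometric_from_1[of "inverse c"]
    by (subst has_sum_reindex_bij_witness[where T = "{1..}" and i = "\<lambda>n. - int n"
          and j = "\<lambda>n. nat (- n)" and h = "\<lambda>n. inverse c ^ n" and s' = "inverse c / (1 - inverse c)"])
       (auto simp: power_int_def simp del: inverse_eq_divide)
qed

text \<open>Coefficients of Jacobi's theta function in multiplicative form. The exponent j(j-1)/2,
  instead of (j + 1/2)^2/2, keeps all powers integral and places a zero at u = 1; the factor lost in
  this normalization is restored in \<open>theta1_eq_theta\<close>.\<close>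

definition theta_coeff :: "complex \<Rightarrow> int \<Rightarrow> complex"
  where "theta_coeff q j = (-1) powi j * q powi (j * (j - 1) div 2)"

definition theta :: "complex \<Rightarrow> complex \<Rightarrow> complex"
  where "theta q u = (\<Sum>\<^sub>\<infinity>j. theta_coeff q j * u powi j)"

lemma theta_coeff_add_1:
  assumes "q \<noteq> 0"
  shows "theta_coeff q (j + 1) = - (q powi j * theta_coeff q j)"
proof -
  have "(j + 1) * j = j * (j - 1) + j * 2"
    by (simp add: algebra_simps)
  then have "(j + 1) * j div 2 = j * (j - 1) div 2 + j"
    by simp
  then show ?thesis
    using assms unfolding theta_coeff_def by (simp add: power_int_add algebra_simps)
qed

text \<open>The involution j -> 1 - j preserves j(j-1) and changes the parity of j. It is the
  symmetry that makes \<open>theta\<close> vanish at 1.\<close>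

lemma theta_coeff_reflect: "theta_coeff q (1 - j) = - theta_coeff q j"
proof -
  have "(1 - j) * (1 - j - 1) = j * (j - 1)"
    by (simp add: algebra_simps)
  moreover have "(-1 :: complex) powi (1 - j) = - ((-1) powi j)"
    by (simp add: power_int_diff power_int_minus_one_minus field_simps)
  ultimately show ?thesis
    unfolding theta_coeff_def by simp
qed

text \<open>Consecutive terms have ratio p^n R, which tends to 0 however large R is; hence the theta
  series converges on the whole punctured plane.\<close>

lemma gaussian_summable:
  fixes p R :: real
  assumes "0 < p" "p < 1" "0 < R"
  shows "summable (\<lambda>n. p ^ (n * (n - 1) div 2) * R ^ n)"
proof -
  have "(\<lambda>n. p ^ n * R) \<longlonglongrightarrow> 0 * R"
    using assms by (intro tendsto_intros LIMSEQ_power_zero) auto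
  then have "eventually (\<lambda>n. p ^ n * R < 1/2) sequentially"
    by (intro order_tendstoD) auto
  then obtain n0 where n0: "p ^ n * R < 1/2" if "n \<ge> n0" for n
    by (auto simp: eventually_sequentially)
  show ?thesis
  proof (rule summable_ratio_test[of "1/2" n0])
    fix n assume "n0 \<le> n"
    have "Suc n * n = n * (n - 1) + n * 2"
      by (cases n) auto
    then have "Suc n * n div 2 = n * (n - 1) div 2 + n"
      by simp
    then have "norm (p ^ (Suc n * (Suc n - 1) div 2) * R ^ Suc n) =
        (p ^ n * R) * norm (p ^ (n * (n - 1) div 2) * R ^ n)"
      using assms by (simp add: power_add algebra_simps abs_mult)
    also have "\<dots> \<le> 1/2 * norm (p ^ (n * (n - 1) div 2) * R ^ n)"
      using n0[OF \<open>n0 \<le> n\<close>] by (intro mult_right_mono) auto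
    finally show "norm (p ^ (Suc n * (Suc n - 1) div 2) * R ^ Suc n)
      \<le> 1/2 * norm (p ^ (n * (n - 1) div 2) * R ^ n)" .
  qed auto
qed

text \<open>Powers with exponents of both signs have to be bounded on K, so R dominates u and 1/u at
  once.\<close>

lemma compact_norm_bounds:
  fixes K :: "complex set"
  assumes "compact K" "0 \<notin> K"
  obtains R where "1 \<le> R" "\<And>u. u \<in> K \<Longrightarrow> norm u \<le> R" "\<And>u. u \<in> K \<Longrightarrow> inverse (norm u) \<le> R"
proof -
  define f where "f u = max (norm u) (inverse (norm u))" for u :: complex
  have "continuous_on K f"
    unfolding f_def using assms by (intro continuous_intros) auto
  then have "bounded (f ` K)"
    using assms by (intro compact_imp_bounded compact_continuous_image)
  then obtain R where "\<And>u. u \<in> K \<Longrightarrow> \<bar>f u\<bar> \<le> R"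
    by (auto simp: bounded_iff)
  then show thesis
    by (intro that[of "max R 1"]) (force simp: f_def)+
qed

lemma theta_terms_bound:
  assumes "q \<noteq> 0" "norm q < 1" "compact K" "0 \<notin> K"
  obtains M where "M summable_on UNIV"
    "\<And>j u. u \<in> K \<Longrightarrow> norm (theta_coeff q j * u powi j) \<le> M j"
proof -
  obtain R where R: "1 \<le> R" "\<And>u. u \<in> K \<Longrightarrow> norm u \<le> R" "\<And>u. u \<in> K \<Longrightarrow> inverse (norm u) \<le> R"
    using compact_norm_bounds[OF assms(3,4)] by blast
  let ?M = "\<lambda>j::int. norm q ^ (nat \<bar>j\<bar> * (nat \<bar>j\<bar> - 1) div 2) * R ^ nat \<bar>j\<bar>"
  have "?M summable_on UNIV"
    using assms by (intro summable_on_int_abs gaussian_summable) (use R(1) in auto)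
  moreover have "norm (theta_coeff q j * u powi j) \<le> ?M j" if u: "u \<in> K" for u j
  proof -
    have 1: "norm (u powi j) \<le> R ^ nat \<bar>j\<bar>"
    proof (cases "j \<ge> 0")
      case True
      then show ?thesis
        using R(2)[OF u] by (simp add: power_int_def norm_power power_mono)
    next
      case False
      then have "norm (u powi j) = inverse (norm u) ^ nat \<bar>j\<bar>"
        by (simp add: power_int_def norm_power norm_inverse)
      also have "\<dots> \<le> R ^ nat \<bar>j\<bar>"
        using R(3)[OF u] by (intro power_mono) auto
      finally show ?thesis .
    qed
    have nn: "0 \<le> j * (j - 1) div 2"
      by (cases "j \<le> 0") (auto simp: mult_nonpos_nonpos pos_imp_zdiv_nonneg_iff)
    \<comment> \<open>For negative j the exponent j(j-1)/2 is larger than the one formed with |j|,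
      and |q| < 1, so a majorant depending on |j| alone serves both signs.\<close>
    have le: "nat \<bar>j\<bar> * (nat \<bar>j\<bar> - 1) div 2 \<le> nat (j * (j - 1) div 2)"
    proof -
      have "int (nat \<bar>j\<bar> * (nat \<bar>j\<bar> - 1)) \<le> j * (j - 1)"
      proof (cases "j = 0")
        case False
        then have "int (nat \<bar>j\<bar> * (nat \<bar>j\<bar> - 1)) = \<bar>j\<bar> * (\<bar>j\<bar> - 1)"
          by (simp add: of_nat_diff)
        also have "\<dots> \<le> j * (j - 1)"
          by (cases "j \<ge> 0") (auto simp: algebra_simps)
        finally show ?thesis .
      qed auto
      then have "int (nat \<bar>j\<bar> * (nat \<bar>j\<bar> - 1)) div 2 \<le> j * (j - 1) div 2"
        by (rule zdiv_mono1) simp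
      then have "int (nat \<bar>j\<bar> * (nat \<bar>j\<bar> - 1) div 2) \<le> j * (j - 1) div 2"
        by (simp add: zdiv_int)
      then show ?thesis
        by linarith
    qed
    have "norm (theta_coeff q j) = norm q ^ nat (j * (j - 1) div 2)"
      using nn unfolding theta_coeff_def
      by (simp add: norm_mult power_int_def norm_power)
    also have "\<dots> \<le> norm q ^ (nat \<bar>j\<bar> * (nat \<bar>j\<bar> - 1) div 2)"
      using assms le by (intro power_decreasing) auto
    finally show ?thesis
      unfolding norm_mult using 1 by (intro mult_mono) auto
  qed
  ultimately show thesis
    using that by blast
qed

lemma has_sum_theta:
  assumes "q \<noteq> 0" "norm q < 1" "u \<noteq> 0"
  shows "((\<lambda>j. theta_coeff q j * u powi j) has_sum theta q u) UNIV"
    and "(\<lambda>j. norm (theta_coeff q j * u powi j)) summable_on UNIV"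
proof -
  obtain M where M: "M summable_on UNIV" "\<And>j v. v \<in> {u} \<Longrightarrow> norm (theta_coeff q j * v powi j) \<le> M j"
    using theta_terms_bound[of q "{u}"] assms by auto
  then show *: "(\<lambda>j. norm (theta_coeff q j * u powi j)) summable_on UNIV"
    by (intro Infinite_Sum.abs_summable_on_comparison_test'[OF M(1)]) auto
  show "((\<lambda>j. theta_coeff q j * u powi j) has_sum theta q u) UNIV"
    unfolding theta_def using abs_summable_summable[OF *] by (rule has_sum_infsum)
qed

text \<open>Weierstrass' theorem on locally uniform limits, with the filter of finite subsets in
  place of sequences of partial sums. The majorants are requested for every compact set because the
  same hypothesis later serves circles around eigenvalues.\<close>

lemma holomorphic_has_sum_M_test:
  fixes f :: "'i \<Rightarrow> complex \<Rightarrow> complex"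
  assumes "open D" and "\<And>m. m \<in> I \<Longrightarrow> f m holomorphic_on D"
    and "\<And>w. w \<in> D \<Longrightarrow> ((\<lambda>m. f m w) has_sum g w) I"
    and "\<And>K. compact K \<Longrightarrow> K \<subseteq> D \<Longrightarrow> \<exists>M. M summable_on I \<and> (\<forall>m\<in>I. \<forall>w\<in>K. norm (f m w) \<le> M m)"
  shows "g holomorphic_on D"
proof -
  have "\<exists>r>0. g holomorphic_on ball w r" if w: "w \<in> D" for w
  proof -
    obtain r where r: "r > 0" "cball w r \<subseteq> D"
      using open_contains_cball_eq[OF \<open>open D\<close>] w by auto
    obtain M where "M summable_on I" and "\<forall>m\<in>I. \<forall>v\<in>cball w r. norm (f m v) \<le> M m"
      using assms(4)[OF compact_cball r(2)] by blast
    then have u: "uniform_limit (cball w r) (\<lambda>X v. \<Sum>m\<in>X. f m v) g (finite_subsets_at_top I)"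
      using r assms(3) by (intro Weierstrass_m_test_general'[where M = M]) auto
    have h: "(\<lambda>v. \<Sum>m\<in>X. f m v) holomorphic_on D" if "X \<subseteq> I" for X
      using assms(2) that by (intro holomorphic_intros) auto
    have "continuous_on (cball w r) (\<lambda>v. \<Sum>m\<in>X. f m v) \<and> (\<lambda>v. \<Sum>m\<in>X. f m v) holomorphic_on ball w r"
      if "X \<subseteq> I" for X
    proof
      show "continuous_on (cball w r) (\<lambda>v. \<Sum>m\<in>X. f m v)"
        using holomorphic_on_imp_continuous_on[OF h[OF that]] r(2) by (rule continuous_on_subset)
      have "ball w r \<subseteq> D"
        using r(2) ball_subset_cball by blast
      with h[OF that] show "(\<lambda>v. \<Sum>m\<in>X. f m v) holomorphic_on ball w r"
        by (rule holomorphic_on_subset)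
    qed
    then have ev: "\<forall>\<^sub>F X in finite_subsets_at_top I.
        continuous_on (cball w r) (\<lambda>v. \<Sum>m\<in>X. f m v) \<and> (\<lambda>v. \<Sum>m\<in>X. f m v) holomorphic_on ball w r"
      by (rule eventually_finite_subsets_at_top_weakI)
    show ?thesis
      using holomorphic_uniform_limit[OF ev u] r(1) by auto
  qed
  then show ?thesis
    by (intro analytic_imp_holomorphic) (auto simp: analytic_on_def)
qed

text \<open>Convergence and majorant are required on the circle only: in the applications the
  integrand is singular inside it, at 0 for Laurent series and at an eigenvalue for
  resolvents.\<close>

lemma has_sum_contour_integral_circlepath:
  fixes f :: "'i \<Rightarrow> complex \<Rightarrow> complex"
  assumes "0 < r"
    and "\<And>m. m \<in> I \<Longrightarrow> f m contour_integrable_on circlepath c r"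
    and "\<And>w. w \<in> sphere c r \<Longrightarrow> ((\<lambda>m. f m w) has_sum g w) I"
    and "M summable_on I" and "\<And>m w. m \<in> I \<Longrightarrow> w \<in> sphere c r \<Longrightarrow> norm (f m w) \<le> M m"
  shows "((\<lambda>m. contour_integral (circlepath c r) (f m)) has_sum contour_integral (circlepath c r) g) I"
proof -
  have u: "uniform_limit (sphere c r) (\<lambda>X v. \<Sum>m\<in>X. f m v) g (finite_subsets_at_top I)"
    using assms by (intro Weierstrass_m_test_general'[where M = M]) auto
  have ev: "\<forall>\<^sub>F X in finite_subsets_at_top I. (\<lambda>v. \<Sum>m\<in>X. f m v) contour_integrable_on circlepath c r"
    using assms(2) by (intro eventually_finite_subsets_at_top_weakI contour_integrable_sum) auto
  have "((\<lambda>X. contour_integral (circlepath c r) (\<lambda>v. \<Sum>m\<in>X. f m v)) \<longlongrightarrow>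
      contour_integral (circlepath c r) g) (finite_subsets_at_top I)"
    using contour_integral_uniform_limit_circlepath(2)[OF ev u] assms(1) by simp
  moreover have "\<forall>\<^sub>F X in finite_subsets_at_top I.
      contour_integral (circlepath c r) (\<lambda>v. \<Sum>m\<in>X. f m v)
      = (\<Sum>m\<in>X. contour_integral (circlepath c r) (f m))"
    using assms(2) by (intro eventually_finite_subsets_at_top_weakI contour_integral_sum) auto
  ultimately show ?thesis
    unfolding has_sum_def by (rule Lim_transform_eventually)
qed

lemma theta_holomorphic:
  assumes "q \<noteq> 0" "norm q < 1"
  shows "theta q holomorphic_on - {0}"
proof (rule holomorphic_has_sum_M_test)
  show "((\<lambda>j. theta_coeff q j * u powi j) has_sum theta q u) UNIV" if "u \<in> - {0}" for u
    using assms that by (intro has_sum_theta) auto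
  fix K :: "complex set" assume K: "compact K" "K \<subseteq> - {0}"
  then have "0 \<notin> K" by auto
  then show "\<exists>M. M summable_on UNIV \<and> (\<forall>j\<in>UNIV. \<forall>u\<in>K. norm (theta_coeff q j * u powi j) \<le> M j)"
    using theta_terms_bound[OF assms K(1)] by metis
next
  fix j :: int
  show "(\<lambda>w. theta_coeff q j * w powi j) holomorphic_on - {0}"
    by (intro holomorphic_intros) auto
qed (auto simp: open_Compl)

text \<open>Replacing u by q u amounts to an index shift, by the recursion of the coefficients. At u
  = 1 this gives the zero at q which \<open>kronecker_theta_product\<close> uses.\<close>

lemma theta_mult_q:
  assumes "q \<noteq> 0" "norm q < 1" "u \<noteq> 0"
  shows "theta q (q * u) = - theta q u / u"
proof -
  have "((\<lambda>j. theta_coeff q j * (q * u) powi j) has_sum theta q (q * u)) UNIV"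
    using assms by (intro has_sum_theta) auto
  also have "(\<lambda>j. theta_coeff q j * (q * u) powi j) =
      (\<lambda>j. - (theta_coeff q (j + 1) * u powi (j + 1)) / u)"
    using assms by (simp add: theta_coeff_add_1 power_int_mult_distrib power_int_add fun_eq_iff)
  finally have 1: "((\<lambda>j. - (theta_coeff q (j + 1) * u powi (j + 1)) / u) has_sum theta q (q * u)) UNIV" .
  have "((\<lambda>j. - (theta_coeff q j * u powi j) / u) has_sum - theta q u / u) UNIV"
    using has_sum_theta(1)[OF assms] by (intro has_sum_divide_const has_sum_uminusI)
  then have "((\<lambda>j. - (theta_coeff q (j + 1) * u powi (j + 1)) / u) has_sum - theta q u / u) UNIV"
    by (subst has_sum_reindex_bij_witness[where T = UNIV and i = "\<lambda>j. j - 1" and j = "\<lambda>j. j + 1"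
          and h = "\<lambda>j. - (theta_coeff q j * u powi j) / u" and s' = "- theta q u / u"]) auto
  with 1 show ?thesis
    by (rule has_sum_unique)
qed

lemma theta_1:
  assumes "q \<noteq> 0" "norm q < 1"
  shows "theta q 1 = 0"
proof -
  have 1: "(theta_coeff q has_sum theta q 1) UNIV"
    using has_sum_theta(1)[of q 1] assms by simp
  then have "((\<lambda>j. theta_coeff q (1 - j)) has_sum theta q 1) UNIV"
    by (subst has_sum_reindex_bij_witness[where T = UNIV and i = "\<lambda>j. 1 - j" and j = "\<lambda>j. 1 - j"
          and h = "theta_coeff q" and s' = "theta q 1"]) auto
  then have "((\<lambda>j. - theta_coeff q j) has_sum theta q 1) UNIV"
    by (simp only: theta_coeff_reflect)
  moreover have "((\<lambda>j. - theta_coeff q j) has_sum - theta q 1) UNIV"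
    using 1 by (rule has_sum_uminusI)
  ultimately have "theta q 1 = - theta q 1"
    by (rule has_sum_unique)
  then show ?thesis by simp
qed

text \<open>The exponent j - 1 makes integration of a Laurent series divided by u select the
  coefficient of index 0.\<close>

lemma contour_integral_powi_circlepath:
  "((\<lambda>u. u powi (j - 1)) has_contour_integral (if j = 0 then 2 * of_real pi * \<i> else 0)) (circlepath 0 1)"
proof (cases "j = 0")
  case True
  have "((\<lambda>u. 1 / (u - 0)) has_contour_integral 2 * of_real pi * \<i> * 1) (circlepath 0 1)"
    using Cauchy_integral_circlepath[of 0 1 "\<lambda>_. 1" 0] by (simp add: has_contour_integral_def)
  then show ?thesis
    using True by (simp add: power_int_minus divide_inverse)
next
  case False
  have "((\<lambda>u. u powi (j - 1)) has_contour_integral 0) (circlepath 0 1)"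
  proof (rule Cauchy_theorem_primitive[where f = "\<lambda>u. u powi j / of_int j" and S = "- {0}"])
    show "((\<lambda>u. u powi j / of_int j) has_field_derivative u powi (j - 1)) (at u within - {0})"
      if "u \<in> - {0}" for u :: complex
      using that False by (auto intro!: derivative_eq_intros)
  qed auto
  then show ?thesis using False by simp
qed

text \<open>Vanishing on an open set would spread over the connected punctured plane, while the
  Laurent coefficient of index 0 is 1.\<close>

lemma theta_not_identically_0:
  assumes q: "q \<noteq> 0" "norm q < 1" and "open U" "U \<noteq> {}"
  obtains u where "u \<in> U" "u \<noteq> 0" "theta q u \<noteq> 0"
proof (rule ccontr)
  assume "\<not> thesis"
  with that have *: "theta q u = 0" if "u \<in> U" "u \<noteq> 0" for u
    using that by blast
  have "open (U - {0})"
    using \<open>open U\<close> by auto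
  moreover have "U - {0} \<noteq> {}"
    using assms not_open_singleton[of "0 :: complex"] by (metis Diff_eq_empty_iff subset_singletonD)
  moreover have "connected (- {0 :: complex})"
    by (rule connected_punctured_universe) auto
  ultimately have zero: "theta q u = 0" if "u \<noteq> 0" for u
    using analytic_continuation_open[of "U - {0}" "- {0}" "theta q" "\<lambda>_. 0" u] theta_holomorphic[OF q] * that
    by (auto simp: open_Compl)
  have sph: "0 \<notin> sphere (0 :: complex) 1" by auto
  obtain M where M: "M summable_on UNIV"
      "\<And>j u. u \<in> sphere 0 1 \<Longrightarrow> norm (theta_coeff q j * u powi j) \<le> M j"
    using theta_terms_bound[OF q compact_sphere sph] by blast
  \<comment> \<open>Termwise integration of theta(u)/u over the unit circle, under the assumption
    that theta vanishes there; the term j = 0 alone contributes, with value 2 pi i, which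
    contradicts the sum 0.\<close>
  have sum: "((\<lambda>j. contour_integral (circlepath 0 1) (\<lambda>u. theta_coeff q j * u powi (j - 1)))
      has_sum contour_integral (circlepath 0 1) (\<lambda>u. 0)) UNIV"
  proof (rule has_sum_contour_integral_circlepath[where M = M])
    show "(\<lambda>u. theta_coeff q j * u powi (j - 1)) contour_integrable_on circlepath 0 1" for j
      using contour_integral_powi_circlepath[of j] contour_integrable_lmul
      by (metis contour_integrable_on_def)
    show "((\<lambda>m. theta_coeff q m * w powi (m - 1)) has_sum 0) UNIV" if "w \<in> sphere 0 1" for w
    proof -
      from that have w: "w \<noteq> 0" by auto
      have "((\<lambda>m. theta_coeff q m * w powi m / w) has_sum theta q w / w) UNIV"
        using has_sum_theta(1)[OF q w] by (rule has_sum_divide_const)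
      then show ?thesis
        using zero[OF w] w by (simp add: power_int_diff)
    qed
    show "norm (theta_coeff q m * w powi (m - 1)) \<le> M m" if "w \<in> sphere 0 1" for m w
    proof -
      from that have "norm w = 1" "w \<noteq> 0" by auto
      then show ?thesis
        using M(2)[OF that, of m] by (simp add: norm_mult norm_power_int)
    qed
  qed (use M in auto)
  have integral: "contour_integral (circlepath 0 1) (\<lambda>u. theta_coeff q j * u powi (j - 1)) =
      (if j = 0 then 2 * of_real pi * \<i> else 0)" for j
  proof -
    have "theta_coeff q j * (if j = 0 then 2 * of_real pi * \<i> else 0) = (if j = 0 then 2 * of_real pi * \<i> else 0)"
      by (simp add: theta_coeff_def)
    then show ?thesis
      using has_contour_integral_lmul[OF contour_integral_powi_circlepath[of j], of "theta_coeff q j"]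
      by (metis contour_integral_unique)
  qed
  have "((\<lambda>j :: int. if j = 0 then 2 * of_real pi * \<i> else (0 :: complex)) has_sum 0) UNIV"
    using sum unfolding integral contour_integral_0 .
  moreover have "((\<lambda>j :: int. if j = 0 then 2 * of_real pi * \<i> else (0 :: complex)) has_sum (2 * of_real pi * \<i>)) UNIV"
    by (rule has_sum_finite_neutralI[of "{0}"]) auto
  ultimately have "0 = 2 * of_real pi * \<i>"
    by (rule has_sum_unique)
  then show False
    by simp
qed

section \<open>Kronecker's formula\<close>

text \<open>The set J makes it possible to leave out the index 0. With J = UNIV - {0} the domain
  contains y = 1, where only the term of index 0 of the Kronecker series has a pole.\<close>

definition theta_domain :: "complex \<Rightarrow> int set \<Rightarrow> complex set"
  where "theta_domain q J = {y. y \<noteq> 0 \<and> (\<forall>m\<in>J. y * q powi m \<noteq> 1)}"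

text \<open>Majorants are naturally available for large |m| only. The finitely many remaining terms
  are bounded on K by compactness, and changing finitely many values of M preserves
  summability.\<close>

lemma summable_bound_extend:
  fixes F :: "int \<Rightarrow> complex \<Rightarrow> complex"
  assumes "compact K" "\<And>m. continuous_on K (F m)" "M summable_on UNIV"
    and "\<And>m w. int n0 \<le> \<bar>m\<bar> \<Longrightarrow> w \<in> K \<Longrightarrow> norm (F m w) \<le> M m"
  shows "\<exists>M. M summable_on UNIV \<and> (\<forall>m\<in>UNIV. \<forall>w\<in>K. norm (F m w) \<le> M m)"
proof -
  have "\<exists>b. \<forall>w\<in>K. norm (F m w) \<le> b" for m
    using compact_imp_bounded[OF compact_continuous_image[OF assms(2,1)], of m]
    by (auto simp: bounded_iff)
  then obtain b where b: "\<And>m w. w \<in> K \<Longrightarrow> norm (F m w) \<le> b m"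
    by metis
  define M' where "M' m = (if \<bar>m\<bar> < int n0 then b m else M m)" for m
  have "{m. \<bar>m\<bar> < int n0} \<subseteq> {- int n0..int n0}"
    by auto
  then have fin: "finite {m. \<bar>m\<bar> < int n0}"
    by (rule finite_subset) auto
  have "M' summable_on (UNIV - {m. \<bar>m\<bar> < int n0})"
    using summable_on_subset_banach[OF assms(3), of "UNIV - {m. \<bar>m\<bar> < int n0}"]
    by (rule summable_on_cong[THEN iffD1, rotated]) (auto simp: M'_def)
  then have "M' summable_on ((UNIV - {m. \<bar>m\<bar> < int n0}) \<union> {m. \<bar>m\<bar> < int n0})"
    using summable_on_finite[OF fin] by (rule summable_on_Un_disjoint) blast
  then have "M' summable_on UNIV"
    by simp
  moreover have "norm (F m w) \<le> M' m" if "w \<in> K" for m w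
    using b[OF that] assms(4)[OF _ that] by (auto simp: M'_def)
  ultimately show ?thesis
    by blast
qed

text \<open>As |m| grows, y q^m leaves a neighbourhood of 1 uniformly on K, towards 0 for positive
  and towards infinity for negative m. The bounds 1/2 and 2 keep |1 - y q^m| above 1/2 and above |y
  q^m|/2 respectively.\<close>

lemma powi_escape:
  fixes q :: complex
  assumes "q \<noteq> 0" "norm q < 1" "compact K" "0 \<notin> K"
  obtains R :: real and n0 :: nat where "1 \<le> R" "\<And>y. y \<in> K \<Longrightarrow> 1 \<le> R * norm y"
    "\<And>y n. y \<in> K \<Longrightarrow> n0 \<le> n \<Longrightarrow> norm (y * q ^ n) \<le> 1/2"
    "\<And>y n. y \<in> K \<Longrightarrow> n0 \<le> n \<Longrightarrow> 2 \<le> norm (y / q ^ n)"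
proof -
  obtain R where R1: "1 \<le> R" and R: "\<And>u. u \<in> K \<Longrightarrow> norm u \<le> R" "\<And>u. u \<in> K \<Longrightarrow> inverse (norm u) \<le> R"
    using compact_norm_bounds[OF assms(3,4)] by blast
  have Ry: "1 \<le> R * norm y" if "y \<in> K" for y
  proof -
    have "y \<noteq> 0" using that assms(4) by auto
    then show ?thesis
      using mult_right_mono[OF R(2)[OF that] norm_ge_zero[of y]] by simp
  qed
  have "(\<lambda>n. R * norm q ^ n) \<longlonglongrightarrow> R * 0"
    using assms by (intro tendsto_intros LIMSEQ_power_zero) auto
  then have "eventually (\<lambda>n. R * norm q ^ n < 1/2) sequentially"
    by (intro order_tendstoD) auto
  then obtain n0 where n0: "\<And>n. n \<ge> n0 \<Longrightarrow> R * norm q ^ n < 1/2"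
    by (auto simp: eventually_sequentially)
  show thesis
  proof (rule that[OF R1 Ry])
    fix y n assume y: "y \<in> K" and n: "n0 \<le> n"
    have "norm (y * q ^ n) \<le> R * norm q ^ n"
      using R(1)[OF y] by (simp add: norm_mult norm_power mult_right_mono)
    then show "norm (y * q ^ n) \<le> 1/2"
      using n0[OF n] by simp
    have "2 * norm q ^ n \<le> 2 * norm q ^ n * (R * norm y)"
      using Ry[OF y] by (simp add: mult_le_cancel_left1)
    also have "\<dots> = (2 * (R * norm q ^ n)) * norm y"
      by simp
    also have "\<dots> \<le> 1 * norm y"
      using n0[OF n] by (intro mult_right_mono) auto
    finally show "2 \<le> norm (y / q ^ n)"
      using assms(1) by (simp add: norm_divide norm_power field_simps)
  qed
qed

text \<open>For m >= 0 the denominator is bounded below and the term decays like |X|^m. For m = -n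
  the denominator grows like |y| |q|^(-n), so the term decays like (|q|/|X|)^n. The two inequalities
  |q| < |X| < 1 are exactly what makes both rates geometric. Small |m| must be excluded, since K may
  contain poles of those terms.\<close>

lemma kronecker_terms_bound:
  fixes q X :: complex
  assumes "q \<noteq> 0" "norm q < norm X" "norm X < 1" "compact K" "0 \<notin> K"
  obtains M and n0 :: nat where "M summable_on UNIV"
    "\<And>m y. int n0 \<le> \<bar>m\<bar> \<Longrightarrow> y \<in> K \<Longrightarrow> norm (X powi m / (1 - y * q powi m)) \<le> M m"
proof -
  have q1: "norm q < 1" using assms by linarith
  obtain R n0 where R: "1 \<le> R" "\<And>y. y \<in> K \<Longrightarrow> 1 \<le> R * norm y"
    and small: "\<And>y n. y \<in> K \<Longrightarrow> n0 \<le> n \<Longrightarrow> norm (y * q ^ n) \<le> 1/2"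
    and large: "\<And>y n. y \<in> K \<Longrightarrow> n0 \<le> n \<Longrightarrow> 2 \<le> norm (y / q ^ n)"
    using powi_escape[OF assms(1) q1 assms(4,5)] by blast
  define r where "r = max (norm X) (norm q / norm X)"
  have X0: "norm X > 0" using assms by (meson norm_ge_zero order_le_less_trans)
  have r: "0 \<le> r" "r < 1" "norm X \<le> r" "norm q / norm X \<le> r"
    using assms X0 by (auto simp: r_def field_simps le_max_iff_disj)
  have "(\<lambda>j::int. 2 * R * r ^ nat \<bar>j\<bar>) summable_on UNIV"
    using r by (intro summable_on_cmult_right summable_on_int_abs summable_geometric) auto
  moreover have "norm (X powi m / (1 - y * q powi m)) \<le> 2 * R * r ^ nat \<bar>m\<bar>"
    if m: "int n0 \<le> \<bar>m\<bar>" and y: "y \<in> K" for m y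
  proof (cases "m \<ge> 0")
    case True
    define n where "n = nat m"
    have n: "m = int n" "n0 \<le> n" using True m by (auto simp: n_def)
    have "1/2 \<le> 1 - norm (y * q ^ n)"
      using small[OF y n(2)] by simp
    also have "\<dots> \<le> norm (1 - y * q ^ n)"
      using norm_triangle_ineq2[of 1 "y * q ^ n"] by simp
    finally have "norm (X ^ n) / norm (1 - y * q ^ n) \<le> norm X ^ n / (1/2)"
      unfolding norm_power by (intro divide_left_mono) (auto intro!: mult_pos_pos)
    also have "\<dots> \<le> 1 * (2 * r ^ n)"
      using power_mono[OF r(3), of n] by simp
    also have "\<dots> \<le> R * (2 * r ^ n)"
      using R(1) r(1) by (intro mult_right_mono) auto
    finally show ?thesis
      using n by (simp add: norm_divide mult_ac)
  next
    case False
    define n where "n = nat (- m)"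
    have n: "m = - int n" "n0 \<le> n" using False m by (auto simp: n_def)
    have "norm (y / q ^ n) / 2 \<le> norm (y / q ^ n) - 1"
      using large[OF y n(2)] by simp
    also have "\<dots> \<le> norm (1 - y / q ^ n)"
      using norm_triangle_ineq2[of "y / q ^ n" 1] by (simp add: norm_minus_commute)
    finally have le: "norm (y / q ^ n) / 2 \<le> norm (1 - y / q ^ n)" .
    have pos: "0 < norm (y / q ^ n)" "0 < norm (1 - y / q ^ n)"
      using le large[OF y n(2)] by linarith+
    have "norm (inverse X ^ n) / norm (1 - y / q ^ n) \<le> norm (inverse X ^ n) / (norm (y / q ^ n) / 2)"
      by (intro divide_left_mono mult_pos_pos norm_ge_zero half_gt_zero le pos)
    also have "\<dots> = 2 * (norm q / norm X) ^ n / norm y"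
      by (simp add: norm_power norm_divide norm_inverse field_simps)
    also have "\<dots> \<le> 2 * r ^ n * R"
    proof -
      have y0: "norm y > 0" using y assms(5) by auto
      have "(norm q / norm X) ^ n \<le> r ^ n"
        using r by (intro power_mono) auto
      moreover have "1 / norm y \<le> R"
        using R(2)[OF y] y0 by (simp add: field_simps)
      ultimately have "2 * (norm q / norm X) ^ n * (1 / norm y) \<le> 2 * r ^ n * R"
        using r y0 by (intro mult_mono) auto
      then show ?thesis by simp
    qed
    finally show ?thesis
      using n by (simp add: norm_divide norm_mult norm_inverse power_int_minus power_inverse divide_inverse mult_ac)
  qed
  ultimately show thesis
    using that by blast
qed

text \<open>The excluded points q^(-m) accumulate only at 0 and at infinity, so a small ball around
  y meets the conditions for all but finitely many m automatically.\<close>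

lemma open_theta_domain:
  assumes "q \<noteq> 0" "norm q < 1"
  shows "open (theta_domain q J)"
proof (subst open_subopen, safe)
  fix y assume y: "y \<in> theta_domain q J"
  define K where "K = cball y (norm y / 2)"
  have "compact K" and K0: "0 \<notin> K"
    using y by (auto simp: K_def theta_domain_def dist_norm)
  then obtain R n0 where "(1::real) \<le> R" "\<And>y. y \<in> K \<Longrightarrow> 1 \<le> R * norm y"
    and small: "\<And>y n. y \<in> K \<Longrightarrow> n0 \<le> n \<Longrightarrow> norm (y * q ^ n) \<le> 1/2"
    and large: "\<And>y n. y \<in> K \<Longrightarrow> n0 \<le> n \<Longrightarrow> 2 \<le> norm (y / q ^ n)"
    using powi_escape[OF assms] by blast
  let ?J = "{m\<in>J. \<bar>m\<bar> < int n0}"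
  define T where "T = ball y (norm y / 2) \<inter> (\<Inter>m\<in>?J. {v. v * q powi m \<noteq> 1})"
  have "?J \<subseteq> {- int n0..int n0}"
    by auto
  then have "finite ?J"
    by (rule finite_subset) auto
  moreover have "open {v. v * q powi m \<noteq> 1}" for m
    by (intro open_Collect_neq continuous_intros)
  ultimately have "open T"
    unfolding T_def by (intro open_Int open_INT) auto
  moreover have "y \<in> T"
    using y by (auto simp: T_def theta_domain_def)
  moreover have "T \<subseteq> theta_domain q J"
  proof
    fix v assume v: "v \<in> T"
    then have vK: "v \<in> K"
      by (auto simp: T_def K_def)
    have "v * q powi m \<noteq> 1" if "m \<in> J" for m
    proof (cases "\<bar>m\<bar> < int n0")
      case True
      then show ?thesis using v that by (auto simp: T_def)
    next
      case False
      show ?thesis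
      proof (cases "m \<ge> 0")
        case True
        then have "norm (v * q ^ nat m) \<le> 1 / 2"
          using False by (intro small[OF vK]) linarith
        then show ?thesis
          using True by (auto simp: power_int_def)
      next
        case m: False
        then have "2 \<le> norm (v / q ^ nat (- m))"
          using False by (intro large[OF vK]) linarith
        then show ?thesis
          using m by (auto simp: power_int_def divide_inverse power_inverse)
      qed
    qed
    then show "v \<in> theta_domain q J"
      using vK K0 by (auto simp: theta_domain_def)
  qed
  ultimately show "\<exists>T. open T \<and> y \<in> T \<and> T \<subseteq> theta_domain q J"
    by blast
qed

text \<open>A countable set does not disconnect the plane. Connectedness is what carries the
  identity from the annulus to all of the domain.\<close>

lemma connected_theta_domain: "connected (theta_domain q UNIV)"
proof -
  have "theta_domain q UNIV = UNIV - ({0} \<union> range (\<lambda>m. q powi (- m)))"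
  proof (intro set_eqI iffI)
    fix y assume "y \<in> theta_domain q UNIV"
    then have y: "y \<noteq> 0" "\<And>m. y * q powi m \<noteq> 1"
      by (auto simp: theta_domain_def)
    have "y \<noteq> q powi (- m)" for m
    proof
      assume "y = q powi (- m)"
      with y have "q powi m \<noteq> 0"
        by (metis power_int_minus inverse_zero)
      then show False
        using y(2)[of m] \<open>y = q powi (- m)\<close> by (simp add: power_int_minus)
    qed
    with y show "y \<in> UNIV - ({0} \<union> range (\<lambda>m. q powi (- m)))"
      by auto
  next
    fix y assume "y \<in> UNIV - ({0} \<union> range (\<lambda>m. q powi (- m)))"
    then have y: "y \<noteq> 0" "\<And>m. y \<noteq> q powi (- m)"
      by auto
    have "y * q powi m \<noteq> 1" for m
      using y(2)[of m] by (auto simp: power_int_minus inverse_unique mult.commute)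
    with y show "y \<in> theta_domain q UNIV"
      by (auto simp: theta_domain_def)
  qed
  then show ?thesis
    by (simp only:) (intro connected_open_diff_countable countable_Un, auto)
qed

text \<open>Each 1/(1 - y q^m) is expanded in powers of y q^m: at 0 for m >= 0, and at infinity for
  m < 0, where |y q^m| > 1 because |y| > |q|. The resulting terms X^m y^n q^(m n), with sign + for
  m, n >= 0 and sign - for m, n < 0, are symmetric under exchange of (X, m) and (y, n). Absolute
  convergence lets the double series be summed by rows or by columns.\<close>

lemma kronecker_symmetric:
  fixes q X y :: complex
  assumes q: "q \<noteq> 0" and X: "norm q < norm X" "norm X < 1" and y: "norm q < norm y" "norm y < 1"
  obtains S where "((\<lambda>m. X powi m / (1 - y * q powi m)) has_sum S) UNIV"
    "((\<lambda>m. y powi m / (1 - X * q powi m)) has_sum S) UNIV"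
proof -
  define f :: "complex \<Rightarrow> complex \<Rightarrow> int \<Rightarrow> int \<Rightarrow> complex" where
    "f X y m n = (if 0 \<le> m \<and> 0 \<le> n then X powi m * (y * q powi m) powi n
      else if m < 0 \<and> n < 0 then - (X powi m * (y * q powi m) powi n) else 0)" for X y m n
  have sym: "f X y m n = f y X n m" for m n X y
    by (simp add: f_def power_int_mult_distrib mult_ac flip: power_int_mult)
  have row: "(f X y m has_sum X powi m / (1 - y * q powi m)) UNIV"
    if X: "norm q < norm X" "norm X < 1" and y: "norm q < norm y" "norm y < 1" for X y m
  proof (cases "m \<ge> 0")
    case True
    have y0: "y \<noteq> 0" using y by auto
    have "norm (y * q powi m) = norm y * norm q ^ nat m"
      using True by (simp add: norm_mult power_int_def norm_power)
    also have "\<dots> \<le> norm y * 1"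
      using X y by (intro mult_left_mono power_le_one) auto
    finally have "norm (y * q powi m) < 1"
      using y by simp
    then have "((\<lambda>n. X powi m * (y * q powi m) powi n) has_sum X powi m * (1 / (1 - y * q powi m))) {0..}"
      using q y0 by (intro has_sum_cmult_right has_sum_powi_nonneg) auto
    also have "?this \<longleftrightarrow> (f X y m has_sum X powi m * (1 / (1 - y * q powi m))) UNIV"
      using True by (intro has_sum_cong_neutral) (auto simp: f_def)
    finally show ?thesis by simp
  next
    case False
    have "norm q * norm (q powi m) < norm y * norm (q powi m)"
      using q y by (intro mult_strict_right_mono) auto
    moreover have "1 \<le> norm q * norm (q powi m)"
    proof -
      have "q * q powi m = inverse (q ^ nat (- m - 1))"
        using False q by (simp add: power_int_minus flip: power_int_add_1')
          (simp add: power_int_def nat_diff_distrib power_inverse)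
      moreover have "norm (q ^ nat (- m - 1)) \<le> 1"
        using X q unfolding norm_power by (intro power_le_one) auto
      ultimately show ?thesis
        using q by (simp add: norm_inverse one_le_inverse flip: norm_mult)
    qed
    ultimately have "1 < norm (y * q powi m)"
      by (simp add: norm_mult)
    then have "((\<lambda>n. - (X powi m) * (y * q powi m) powi n) has_sum - (X powi m) * (- 1 / (1 - y * q powi m))) {..<0}"
      by (intro has_sum_cmult_right has_sum_powi_neg)
    also have "?this \<longleftrightarrow> (f X y m has_sum - (X powi m) * (- 1 / (1 - y * q powi m))) UNIV"
      using False by (intro has_sum_cong_neutral) (auto simp: f_def)
    finally show ?thesis by simp
  qed
  \<comment> \<open>The larger of the two decay rates, for positive and for negative exponents, so
    that the double series is dominated by a product of two geometric series in |m| and |n|.\<close>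
  define r where "r = (\<lambda>X :: complex. max (norm X) (norm q / norm X))"
  have r: "0 \<le> r X" "r X < 1" "norm X \<le> r X" "norm q / norm X \<le> r X"
    if "norm q < norm X" "norm X < 1" for X
  proof -
    have "norm X > 0" using that by (meson norm_ge_zero order_le_less_trans)
    then show "0 \<le> r X" "r X < 1" "norm X \<le> r X" "norm q / norm X \<le> r X"
      using that by (auto simp: r_def field_simps le_max_iff_disj)
  qed
  have bound: "norm (f X y m n) \<le> 1 / norm q * (r X ^ nat \<bar>m\<bar> * r y ^ nat \<bar>n\<bar>)" for m n
  proof -
    have q1: "norm q < 1" using X by simp
    consider "0 \<le> m" "0 \<le> n" | "m < 0" "n < 0" | "f X y m n = 0"
      by (fastforce simp: f_def)
    then show ?thesis
    proof cases
      case 1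
      then have "norm (f X y m n) = norm X ^ nat m * norm y ^ nat n * (norm q ^ nat m) ^ nat n"
        by (simp add: f_def norm_mult power_int_def norm_power power_mult_distrib)
      also have "\<dots> \<le> r X ^ nat m * r y ^ nat n * 1"
        using r[OF X] r[OF y] q1 by (intro mult_mono power_mono power_le_one) auto
      also have "\<dots> \<le> 1 / norm q * (r X ^ nat m * r y ^ nat n)"
        using q q1 r[OF X] r[OF y] by (simp add: field_simps mult_left_le_one_le)
      finally show ?thesis using 1 by simp
    next
      case 2
      define a b where "a = nat (- m)" and "b = nat (- n)"
      have ab: "m = - int a" "n = - int b" "0 < a" "0 < b"
        using 2 by (auto simp: a_def b_def)
      \<comment> \<open>This is (a - 1)(b - 1) >= 0. Writing |q|^(a b) as |q|^(a b + 1) / |q| gives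
        enough powers of |q| to attach one to each of the a + b factors 1/X and 1/y; the spare
        division is the source of the constant 1/|q| in the bound.\<close>
      have "a + b \<le> Suc (a * b)"
        using ab(3,4) by (cases a; cases b) auto
      have "norm (f X y m n) = norm q ^ (a * b) / (norm X ^ a * norm y ^ b)"
        using ab by (simp add: f_def norm_mult norm_divide power_int_minus norm_power norm_inverse
            power_mult_distrib power_mult field_simps)
      also have "\<dots> = norm q ^ Suc (a * b) / (norm X ^ a * norm y ^ b) / norm q"
        using q by simp
      also have "\<dots> \<le> norm q ^ (a + b) / (norm X ^ a * norm y ^ b) / norm q"
        using \<open>a + b \<le> Suc (a * b)\<close> q1 by (intro divide_right_mono power_decreasing) auto
      also have "\<dots> = 1 / norm q * ((norm q / norm X) ^ a * (norm q / norm y) ^ b)"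
        by (simp add: power_add power_divide)
      also have "\<dots> \<le> 1 / norm q * (r X ^ a * r y ^ b)"
        using r[OF X] r[OF y] by (intro mult_left_mono mult_mono power_mono) auto
      finally show ?thesis
        using ab by simp
    next
      case 3
      then show ?thesis using r[OF X] r[OF y] by simp
    qed
  qed
  have geo: "(\<lambda>m::int. norm (of_real (c ^ nat \<bar>m\<bar>) :: complex)) summable_on UNIV"
    if "0 \<le> c" "c < 1" for c :: real
    using summable_on_int_abs[of "\<lambda>n. c ^ n"] that by (simp add: summable_geometric norm_power)
  have "(\<lambda>(m, n). norm (of_real (r X ^ nat \<bar>m\<bar>) * of_real (r y ^ nat \<bar>n\<bar>) :: complex)) summable_on
      (UNIV :: int set) \<times> (UNIV :: int set)"
    by (intro abs_summable_on_times geo r X y)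
  then have "(\<lambda>p. 1 / norm q * (\<lambda>(m, n). norm (of_real (r X ^ nat \<bar>m\<bar>) * of_real (r y ^ nat \<bar>n\<bar>) :: complex)) p)
      summable_on (UNIV :: int set) \<times> (UNIV :: int set)"
    by (rule summable_on_cmult_right)
  then have "(\<lambda>p. norm (case_prod (f X y) p)) summable_on UNIV \<times> UNIV"
    using bound r(1)[OF X] r(1)[OF y]
    by (intro Infinite_Sum.abs_summable_on_comparison_test') (auto simp: norm_mult norm_power)
  then have "case_prod (f X y) summable_on UNIV \<times> UNIV"
    by (rule abs_summable_summable)
  then obtain S where S: "(case_prod (f X y) has_sum S) (UNIV \<times> UNIV)"
    by (auto simp: summable_on_def)
  have "((\<lambda>m. X powi m / (1 - y * q powi m)) has_sum S) UNIV"
    using has_sum_SigmaD[OF S] row[OF X y] by simp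
  moreover have S': "((\<lambda>(n, m). f y X n m) has_sum S) (UNIV \<times> UNIV)"
    using S unfolding has_sum_swap[of "case_prod (f X y)"] by (simp add: sym[of X y])
  have "((\<lambda>m. y powi m / (1 - X * q powi m)) has_sum S) UNIV"
    using has_sum_SigmaD[OF S'] row[OF y X] by simp
  ultimately show thesis
    using that by blast
qed

text \<open>The excluded points lie on the circles of radius |q|^j, and the open annulus contains
  none of these circles.\<close>

lemma annulus_theta_domain:
  assumes q: "q \<noteq> 0" and X: "norm q < norm X" "norm X < 1"
  shows "X \<in> theta_domain q UNIV"
proof -
  have "X * q powi i \<noteq> 1" for i
  proof
    assume eq: "X * q powi i = 1"
    then have nrm: "norm X * norm q powi i = 1"
      by (metis norm_mult norm_one norm_power_int)
    show False
    proof (cases "i \<ge> 0")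
      case True
      then have "norm q powi i \<le> 1"
        using X by (simp add: power_int_def power_le_one)
      then have "norm X * norm q powi i \<le> norm X * 1"
        by (intro mult_left_mono) auto
      then show False using nrm X by simp
    next
      case False
      then have "norm q ^ nat (- i) \<le> norm q ^ 1"
        using X by (intro power_decreasing) auto
      moreover have "norm X = norm q ^ nat (- i)"
        using nrm False q by (simp add: power_int_def power_inverse field_simps)
      ultimately show False using X by simp
    qed
  qed
  moreover have "X \<noteq> 0"
    using X by auto
  ultimately show ?thesis
    by (simp add: theta_domain_def)
qed

text \<open>Expanding the product of the symmetric series with \<open>theta q y\<close> in powers of \<open>y\<close>, the
  coefficients inherit the recursion of \<open>theta_coeff\<close>.\<close>

lemma kronecker_theta_product:
  fixes q X :: complex
  assumes q: "q \<noteq> 0" and X: "norm q < norm X" "norm X < 1"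
  obtains A where "\<And>y S. norm q < norm y \<Longrightarrow> norm y < 1 \<Longrightarrow>
    ((\<lambda>m. X powi m / (1 - y * q powi m)) has_sum S) UNIV \<Longrightarrow> S * theta q y = A * theta q (X * y)"
proof -
  have q1: "norm q < 1" and X0: "X \<noteq> 0"
    using X by auto
  have Xq: "X * q powi i \<noteq> 1" for i
    using annulus_theta_domain[OF q X] by (auto simp: theta_domain_def)
  \<comment> \<open>The contribution of the i-th term of the series with X and y exchanged to the
    coefficient of y^j in the product; \<open>A j\<close> is that whole coefficient.\<close>
  define G where "G = (\<lambda>j i. theta_coeff q (j - i) / (1 - X * q powi i))"
  define A where "A = (\<lambda>j. \<Sum>\<^sub>\<infinity>i. G j i)"
  have expand: "((\<lambda>(j, i). y powi j * G j i) has_sum S * theta q y) (UNIV \<times> UNIV)"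
    if y: "norm q < norm y" "norm y < 1"
      and S: "((\<lambda>m. X powi m / (1 - y * q powi m)) has_sum S) UNIV" for y S
  proof -
    have y0: "y \<noteq> 0" using y by auto
    have S': "((\<lambda>i. y powi i / (1 - X * q powi i)) has_sum S) UNIV"
      using kronecker_symmetric[OF q X y] has_sum_unique[OF S] by metis
    have "(\<lambda>i. norm (y powi i / (1 - X * q powi i))) summable_on UNIV"
      using S' by (metis summable_on_iff_abs_summable_on_complex has_sum_imp_summable)
    then have "(\<lambda>(i, l). norm (y powi i / (1 - X * q powi i) * (theta_coeff q l * y powi l))) summable_on UNIV \<times> UNIV"
      using has_sum_theta(2)[OF q q1 y0] by (rule abs_summable_on_times)
    then have "(\<lambda>p. norm ((\<lambda>(i, l). y powi i / (1 - X * q powi i) * (theta_coeff q l * y powi l)) p)) summable_on UNIV \<times> UNIV"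
      by (simp add: case_prod_unfold)
    then have "(\<lambda>(i, l). y powi i / (1 - X * q powi i) * (theta_coeff q l * y powi l)) summable_on UNIV \<times> UNIV"
      by (rule abs_summable_summable)
    then have "((\<lambda>(i, l). y powi i / (1 - X * q powi i) * (theta_coeff q l * y powi l)) has_sum S * theta q y)
        (UNIV \<times> UNIV)"
      by (intro has_sum_SigmaI[where g = "\<lambda>i. y powi i / (1 - X * q powi i) * theta q y"])
         (auto simp del: times_divide_eq_left times_divide_eq_right
           intro!: has_sum_cmult_right has_sum_cmult_left has_sum_theta q q1 y0 S')
    also have "?this \<longleftrightarrow> ?thesis"
      by (rule has_sum_reindex_bij_witness[where i = "\<lambda>(j, i). (i, j - i)" and j = "\<lambda>(i, l). (i + l, i)"])
         (auto simp: G_def power_int_add y0)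
    finally show ?thesis .
  qed
  have summable: "G j summable_on UNIV" for j
  proof -
    \<comment> \<open>Summability of \<open>G j\<close> does not involve y, so it may be read off at
      any single point of the annulus, here on the real axis halfway between the two
      circles.\<close>
    define y where "y = complex_of_real ((norm q + 1) / 2)"
    have "norm y = (norm q + 1) / 2"
      unfolding y_def by (simp only: norm_of_real) simp
    then have y: "norm q < norm y" "norm y < 1"
      using q1 by auto
    obtain S where "((\<lambda>m. X powi m / (1 - y * q powi m)) has_sum S) UNIV"
      using kronecker_symmetric[OF q X y] by metis
    from expand[OF y this] have "(\<lambda>(j, i). y powi j * G j i) summable_on (SIGMA j:UNIV. UNIV)"
      by (rule has_sum_imp_summable)
    then have "(\<lambda>i. y powi j * G j i) summable_on UNIV"
      by (rule summable_on_SigmaD1) simp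
    then show ?thesis
      using y by (subst (asm) summable_on_cmult_right') auto
  qed
  then have A: "(G j has_sum A j) UNIV" for j
    unfolding A_def by (rule has_sum_infsum)
  have step: "A (j + 1) = - (q powi j * X * A j)" for j
  proof -
    \<comment> \<open>In \<open>G (j + 1) i\<close> the recursion of \<open>theta_coeff\<close>
      produces q^(j-i), which is split as q^(j-i) (1 - X q^i) + X q^j. The first part cancels the
      denominator and sums to theta at q, which is 0; the second part reproduces
      \<open>A j\<close>.\<close>
    have "((\<lambda>l. theta_coeff q l * q powi l) has_sum 0) UNIV"
      using has_sum_theta(1)[OF q q1 q] theta_mult_q[OF q q1, of 1] theta_1[OF q q1] by simp
    then have "((\<lambda>i. theta_coeff q (j - i) * q powi (j - i)) has_sum 0) UNIV"
      by (subst has_sum_reindex_bij_witness[where T = UNIV and i = "\<lambda>l. j - l" and j = "\<lambda>i. j - i"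
            and h = "\<lambda>l. theta_coeff q l * q powi l" and s' = 0]) auto
    then have "((\<lambda>i. - (theta_coeff q (j - i) * q powi (j - i)) + - (q powi j * X) * G j i)
        has_sum - 0 + - (q powi j * X) * A j) UNIV"
      by (intro has_sum_add has_sum_uminusI has_sum_cmult_right A)
    also have "(\<lambda>i. - (theta_coeff q (j - i) * q powi (j - i)) + - (q powi j * X) * G j i) = G (j + 1)"
    proof
      fix i
      have "theta_coeff q (j + 1 - i) = - (q powi (j - i) * theta_coeff q (j - i))"
        using theta_coeff_add_1[OF q, of "j - i"] by (simp add: algebra_simps)
      moreover have "q powi j = q powi (j - i) * q powi i"
        using q by (simp flip: power_int_add)
      moreover have "1 - X * q powi i \<noteq> 0"
        using Xq[of i] by simp
      ultimately show "- (theta_coeff q (j - i) * q powi (j - i)) + - (q powi j * X) * G j i = G (j + 1) i"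
        unfolding G_def by (simp add: divide_simps) (simp add: algebra_simps)
    qed
    finally show ?thesis
      using has_sum_unique[OF A] by simp
  qed
  \<comment> \<open>The recursion is the one satisfied by \<open>theta_coeff q j * X powi j\<close>.
    Since the index runs over all integers it has to be followed in both directions from 0, which is
    possible because X and q are nonzero.\<close>
  have closed: "A j = theta_coeff q j * X powi j * A 0" for j
  proof (induction j rule: int_induct[where k = 0])
    case base
    then show ?case by (simp add: theta_coeff_def)
  next
    case (step1 i)
    then show ?case
      using step[of i] theta_coeff_add_1[OF q, of i] X0 by (simp add: power_int_add)
  next
    case (step2 i)
    have "X * A (i - 1) = X * (theta_coeff q (i - 1) * X powi (i - 1) * A 0)"
      using step[of "i - 1"] theta_coeff_add_1[OF q, of "i - 1"] X0 q step2
      by (simp add: power_int_diff mult.assoc)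
    then show ?case
      by (rule mult_left_cancel[OF X0, THEN iffD1])
  qed
  show thesis
  proof (rule that)
    fix y S assume y: "norm q < norm y" "norm y < 1"
      and S: "((\<lambda>m. X powi m / (1 - y * q powi m)) has_sum S) UNIV"
    have y0: "y \<noteq> 0" using y by auto
    have "((\<lambda>j. y powi j * A j) has_sum S * theta q y) UNIV"
      using has_sum_SigmaD[OF expand[OF y S]] has_sum_cmult_right[OF A] by simp
    also have "(\<lambda>j. y powi j * A j) = (\<lambda>j. A 0 * (theta_coeff q j * (X * y) powi j))"
      by (subst closed) (simp add: power_int_mult_distrib mult_ac)
    finally have "((\<lambda>j. A 0 * (theta_coeff q j * (X * y) powi j)) has_sum S * theta q y) UNIV" .
    moreover have "((\<lambda>j. A 0 * (theta_coeff q j * (X * y) powi j)) has_sum A 0 * theta q (X * y)) UNIV"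
      using q q1 X0 y0 by (intro has_sum_cmult_right has_sum_theta) auto
    ultimately show "S * theta q y = A 0 * theta q (X * y)"
      by (rule has_sum_unique)
  qed
qed

section \<open>Analytic continuation of the Kronecker series\<close>

definition kronecker_sum :: "complex \<Rightarrow> complex \<Rightarrow> int set \<Rightarrow> complex \<Rightarrow> complex"
  where "kronecker_sum q X J y = (\<Sum>\<^sub>\<infinity>m\<in>J. X powi m / (1 - y * q powi m))"

lemma kronecker_M_test:
  fixes q X :: complex
  assumes q: "q \<noteq> 0" and X: "norm q < norm X" "norm X < 1"
    and K: "compact K" "K \<subseteq> theta_domain q J"
  shows "\<exists>M. M summable_on J \<and> (\<forall>m\<in>J. \<forall>y\<in>K. norm (X powi m / (1 - y * q powi m)) \<le> M m)"
proof -
  have K0: "0 \<notin> K"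
    using K(2) by (auto simp: theta_domain_def)
  obtain M n0 where M: "M summable_on UNIV"
    "\<And>m y. int n0 \<le> \<bar>m\<bar> \<Longrightarrow> y \<in> K \<Longrightarrow> norm (X powi m / (1 - y * q powi m)) \<le> M m"
    using kronecker_terms_bound[OF q X K(1) K0] by metis
  \<comment> \<open>Terms with index outside J may have poles on K; they are replaced by 0 so that a
    majorant over all integers can be applied.\<close>
  define F where "F m y = (if m \<in> J then X powi m / (1 - y * q powi m) else 0)" for m y
  have "\<exists>M. M summable_on UNIV \<and> (\<forall>m\<in>UNIV. \<forall>y\<in>K. norm (F m y) \<le> M m)"
  proof (rule summable_bound_extend[OF K(1) _ M(1)])
    show "continuous_on K (F m)" for m
    proof (cases "m \<in> J")
      case True
      then have "1 - y * q powi m \<noteq> 0" if "y \<in> K" for y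
        using that K(2) by (auto simp: theta_domain_def)
      then show ?thesis
        unfolding F_def using True by (auto intro!: continuous_intros)
    qed (simp add: F_def)
    show "norm (F m y) \<le> M m" if "int n0 \<le> \<bar>m\<bar>" "y \<in> K" for m y
      using M(2)[OF that] order_trans[OF norm_ge_zero M(2)[OF that]] by (simp add: F_def)
  qed
  then obtain M' where M': "M' summable_on UNIV" "\<And>m y. y \<in> K \<Longrightarrow> norm (F m y) \<le> M' m"
    by blast
  have "M' summable_on J"
    using M'(1) by (rule summable_on_subset_banach) auto
  moreover have "norm (X powi m / (1 - y * q powi m)) \<le> M' m" if "m \<in> J" "y \<in> K" for m y
    using M'(2)[OF that(2), of m] that(1) by (simp add: F_def)
  ultimately show ?thesis
    by blast
qed

lemma has_sum_kronecker_sum: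
  fixes q X :: complex
  assumes q: "q \<noteq> 0" and X: "norm q < norm X" "norm X < 1" and y: "y \<in> theta_domain q J"
  shows "((\<lambda>m. X powi m / (1 - y * q powi m)) has_sum kronecker_sum q X J y) J"
proof -
  obtain M where "M summable_on J" "\<And>m. m \<in> J \<Longrightarrow> norm (X powi m / (1 - y * q powi m)) \<le> M m"
    using kronecker_M_test[OF q X, of "{y}" J] y by auto
  then have "(\<lambda>m. norm (X powi m / (1 - y * q powi m))) summable_on J"
    by (rule Infinite_Sum.abs_summable_on_comparison_test')
  then have "(\<lambda>m. X powi m / (1 - y * q powi m)) summable_on J"
    by (rule abs_summable_summable)
  then show ?thesis
    unfolding kronecker_sum_def by (rule has_sum_infsum)
qed

lemma kronecker_sum_holomorphic:
  assumes q: "q \<noteq> 0" and X: "norm q < norm X" "norm X < 1"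
  shows "kronecker_sum q X J holomorphic_on theta_domain q J"
proof (rule holomorphic_has_sum_M_test)
  show "open (theta_domain q J)"
    using q X by (intro open_theta_domain) auto
  show "(\<lambda>y. X powi m / (1 - y * q powi m)) holomorphic_on theta_domain q J" if "m \<in> J" for m
    using that by (intro holomorphic_intros) (auto simp: theta_domain_def)
  show "((\<lambda>m. X powi m / (1 - y * q powi m)) has_sum kronecker_sum q X J y) J"
    if "y \<in> theta_domain q J" for y
    using has_sum_kronecker_sum[OF q X that] .
  show "\<exists>M. M summable_on J \<and> (\<forall>m\<in>J. \<forall>w\<in>K. norm (X powi m / (1 - w * q powi m)) \<le> M m)"
    if "compact K" "K \<subseteq> theta_domain q J" for K
    using kronecker_M_test[OF q X that] .
qed

text \<open>Isolates the pole at y = 1; the remaining sum is holomorphic there.\<close>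

lemma kronecker_sum_split:
  assumes q: "q \<noteq> 0" and X: "norm q < norm X" "norm X < 1" and y: "y \<in> theta_domain q UNIV"
  shows "kronecker_sum q X UNIV y = 1 / (1 - y) + kronecker_sum q X (UNIV - {0}) y"
proof -
  have y': "y \<in> theta_domain q (UNIV - {0})"
    using y by (auto simp: theta_domain_def)
  have "((\<lambda>m. X powi m / (1 - y * q powi m)) has_sum
      X powi 0 / (1 - y * q powi 0) + kronecker_sum q X (UNIV - {0}) y) ({0} \<union> (UNIV - {0}))"
    using has_sum_kronecker_sum[OF q X y']
    by (intro has_sum_Un_disjoint) (auto intro: has_sum_finiteI)
  then show ?thesis
    using has_sum_unique[OF has_sum_kronecker_sum[OF q X y]] by simp
qed

text \<open>As y tends to 1 inside the annulus, the simple pole of the series meets the zero of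
  theta and the product tends to -theta'(1), which determines A times theta at X. The factor is left
  in this product form because theta at X is not yet known to be nonzero: that is a consequence of
  the lemma, for which A must be shown nonzero independently.\<close>

lemma kronecker_theta_identity:
  assumes q: "q \<noteq> 0" and X: "norm q < norm X" "norm X < 1"
  obtains A where "A \<noteq> 0" "A * theta q X = - deriv (theta q) 1"
    "\<And>y. y \<in> theta_domain q UNIV \<Longrightarrow> kronecker_sum q X UNIV y * theta q y = A * theta q (X * y)"
proof -
  define D where "D = theta_domain q UNIV"
  define D1 where "D1 = theta_domain q (UNIV - {0})"
  define S where "S = kronecker_sum q X UNIV"
  define S1 where "S1 = kronecker_sum q X (UNIV - {0})"
  define Ann where "Ann = {u :: complex. norm q < norm u \<and> norm u < 1}"
  have q1: "norm q < 1" and X0: "X \<noteq> 0"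
    using X by auto
  have AnnD: "Ann \<subseteq> D"
    using annulus_theta_domain[OF q] by (auto simp: Ann_def D_def)
  have "open Ann"
    unfolding Ann_def by (intro open_Collect_conj open_Collect_less continuous_intros)
  from kronecker_theta_product[OF q X] obtain A where A: "\<And>y S. norm q < norm y \<Longrightarrow> norm y < 1 \<Longrightarrow>
    ((\<lambda>m. X powi m / (1 - y * q powi m)) has_sum S) UNIV \<Longrightarrow> S * theta q y = A * theta q (X * y)"
    by blast
  have SA: "S y * theta q y = A * theta q (X * y)" if "y \<in> Ann" for y
    using A[OF _ _ has_sum_kronecker_sum[OF q X]] that AnnD by (auto simp: S_def D_def Ann_def)
  have Ssplit: "S y = 1 / (1 - y) + S1 y" if "y \<in> D" for y
    using kronecker_sum_split[OF q X] that by (simp add: S_def S1_def D_def)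
  have "open D1"
    unfolding D1_def using q q1 by (intro open_theta_domain) auto
  moreover have "1 \<in> D1"
  proof -
    have "q powi m \<noteq> 1" if "m \<noteq> 0" for m
    proof
      assume "q powi m = 1"
      then have "norm q powi m = 1"
        by (metis norm_one norm_power_int)
      then have "norm q ^ nat \<bar>m\<bar> = 1"
        using q by (auto simp: power_int_def power_inverse split: if_splits)
      moreover have "norm q ^ nat \<bar>m\<bar> \<le> norm q ^ 1"
        using q1 that by (intro power_decreasing) auto
      ultimately show False using q1 by simp
    qed
    then show ?thesis
      by (auto simp: D1_def theta_domain_def)
  qed
  moreover have "S1 holomorphic_on D1"
    unfolding S1_def D1_def by (rule kronecker_sum_holomorphic[OF q X])
  ultimately have contS1: "isCont S1 1"
    using holomorphic_on_imp_continuous_on continuous_on_eq_continuous_at by blast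
  have filt: "filterlim complex_of_real (at 1) (at_left 1)"
  proof (rule filterlim_atI)
    have "isCont complex_of_real 1"
      by (intro continuous_intros)
    then have "(complex_of_real \<longlongrightarrow> complex_of_real 1) (at 1)"
      by (rule isContD)
    then show "(complex_of_real \<longlongrightarrow> 1) (at_left 1)"
      by (metis of_real_1 filterlim_at_split)
    show "\<forall>\<^sub>F x in at_left 1. complex_of_real x \<noteq> 1"
      by (auto simp: eventually_at_filter)
  qed
  have evAnn: "\<forall>\<^sub>F t in at_left 1. complex_of_real t \<in> Ann"
    using eventually_at_left_real[OF q1]
  proof (rule eventually_mono)
    fix t assume t: "t \<in> {norm q<..<1}"
    then have "0 \<le> t"
      using norm_ge_zero[of q] by (meson greaterThanLessThan_iff less_imp_le order_trans)
    then show "complex_of_real t \<in> Ann"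
      using t by (simp add: Ann_def)
  qed
  have hol: "theta q holomorphic_on - {0}"
    by (rule theta_holomorphic[OF q q1])
  have op: "open (- {0 :: complex})"
    by (simp add: open_Compl)
  have cont: "isCont (theta q) u" if "u \<noteq> 0" for u
    using holomorphic_on_imp_continuous_on[OF hol] that
    by (simp add: continuous_on_eq_continuous_at[OF op])
  have "theta q field_differentiable at 1"
    using holomorphic_on_imp_differentiable_at[OF hol op] by simp
  then have "(theta q has_field_derivative deriv (theta q) 1) (at 1)"
    by (simp add: field_differentiable_derivI)
  then have "(\<lambda>y. (theta q y - theta q 1) / (y - 1)) \<midarrow>1\<rightarrow> deriv (theta q) 1"
    by (simp add: has_field_derivative_iff)
  \<comment> \<open>For y in the annulus the expression is S(y) theta(y), with the pole 1/(1 - y) of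
    S absorbed into the difference quotient of theta at its zero 1.\<close>
  then have quot: "(\<lambda>y. - ((theta q y - theta q 1) / (y - 1)) + S1 y * theta q y) \<midarrow>1\<rightarrow> - deriv (theta q) 1 + S1 1 * theta q 1"
    using contS1 cont[of 1] by (intro tendsto_intros) (auto dest: isContD)
  have "((\<lambda>t. - ((theta q (of_real t) - theta q 1) / (of_real t - 1)) + S1 (of_real t) * theta q (of_real t))
      \<longlongrightarrow> - deriv (theta q) 1 + S1 1 * theta q 1) (at_left 1)"
    by (rule filterlim_compose[OF quot filt])
  moreover have "\<forall>\<^sub>F t in at_left 1. - ((theta q (of_real t) - theta q 1) / (of_real t - 1))
      + S1 (of_real t) * theta q (of_real t) = A * theta q (X * of_real t)"
    using evAnn
  proof eventually_elim
    case (elim t)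
    then have "of_real t \<noteq> (1 :: complex)"
      by (auto simp: Ann_def)
    then have "- (theta q (of_real t) / (of_real t - 1)) = 1 / (1 - of_real t) * theta q (of_real t)"
      by (simp add: divide_simps) (simp add: algebra_simps)
    then show ?case
      using SA[OF elim] Ssplit[of "of_real t"] elim AnnD theta_1[OF q q1]
      by (auto simp: distrib_right)
  qed
  ultimately have "((\<lambda>t. A * theta q (X * of_real t)) \<longlongrightarrow> - deriv (theta q) 1) (at_left 1)"
    using theta_1[OF q q1] by (simp add: tendsto_cong)
  moreover have "((\<lambda>t. A * theta q (X * of_real t)) \<longlongrightarrow> A * theta q X) (at_left 1)"
  proof -
    have "isCont (\<lambda>y. A * theta q (X * y)) 1"
      using X0 by (intro continuous_intros isCont_o2[of 1 "\<lambda>y. X * y" "theta q"] cont) auto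
    from filterlim_compose[OF isContD[OF this] filt] show ?thesis
      by simp
  qed
  ultimately have AX: "A * theta q X = - deriv (theta q) 1"
    using tendsto_unique[of "at_left (1::real)"] by (metis trivial_limit_at_left_real)
  \<comment> \<open>If A were 0, S would vanish wherever theta does not, in particular at some point
    of the annulus close to 1. But (1 - y) S(y) = 1 + (1 - y) S1(y) is nonzero near 1.\<close>
  have "A \<noteq> 0"
  proof
    assume "A = 0"
    have "isCont (\<lambda>y. 1 + (1 - y) * S1 y) 1"
      using contS1 by (intro continuous_intros) auto
    then have "\<forall>\<^sub>F y in nhds 1. 1 + (1 - y) * S1 y \<noteq> 0"
      by (intro tendsto_imp_eventually_ne) (auto simp: isCont_def tendsto_nhds_iff)
    then obtain U where U: "open U" "1 \<in> U" "\<And>y. y \<in> U \<Longrightarrow> 1 + (1 - y) * S1 y \<noteq> 0"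
      by (auto simp: eventually_nhds)
    have "\<forall>\<^sub>F y in at 1. y \<in> U"
      using U by (meson eventually_at_topological)
    then have "\<forall>\<^sub>F t in at_left 1. complex_of_real t \<in> U"
      using filt by (rule eventually_compose_filterlim)
    then have "\<forall>\<^sub>F t in at_left 1. complex_of_real t \<in> U \<inter> Ann"
      using evAnn by eventually_elim auto
    then have "U \<inter> Ann \<noteq> {}"
      using eventually_happens[of _ "at_left (1::real)"] by (metis trivial_limit_at_left_real empty_iff)
    then obtain u where u: "u \<in> U \<inter> Ann" "theta q u \<noteq> 0"
      using theta_not_identically_0[OF q q1, of "U \<inter> Ann"] U(1) \<open>open Ann\<close> by blast
    then have "S u = 0"
      using SA[of u] \<open>A = 0\<close> by simp
    moreover have "u \<noteq> 1"
      using u by (auto simp: Ann_def)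
    moreover have "S u = 1 / (1 - u) + S1 u"
      using Ssplit u AnnD by blast
    ultimately have "1 + (1 - u) * S1 u = 0"
      by (simp add: divide_simps mult.commute)
    then show False
      using U(3) u by auto
  qed
  moreover have "S y * theta q y = A * theta q (X * y)" if "y \<in> D" for y
  proof (rule analytic_continuation_open[of Ann D "\<lambda>y. S y * theta q y" "\<lambda>y. A * theta q (X * y)"])
    have "D \<subseteq> - {0}"
      by (auto simp: D_def theta_domain_def)
    then show "(\<lambda>y. S y * theta q y) holomorphic_on D"
      unfolding S_def D_def
      by (intro holomorphic_intros kronecker_sum_holomorphic q X holomorphic_on_subset[OF hol]) 
    have "(theta q \<circ> (\<lambda>y. X * y)) holomorphic_on D"
      using \<open>D \<subseteq> - {0}\<close> X0 by (intro holomorphic_on_compose_gen[OF _ hol] holomorphic_intros) auto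
    then show "(\<lambda>y. A * theta q (X * y)) holomorphic_on D"
      by (intro holomorphic_intros) (simp add: o_def)
    show "Ann \<noteq> {}"
      using X by (auto simp: Ann_def)
    show "connected D"
      unfolding D_def by (rule connected_theta_domain)
    show "open D"
      unfolding D_def using q q1 by (rule open_theta_domain)
  qed (use SA AnnD \<open>open Ann\<close> that in auto)
  ultimately show thesis
    using AX that unfolding S_def D_def by blast
qed

text \<open>A zero at y would force, through the identity with varying X = u/y, a zero at every u of
  the annulus |q| < |u/y| < 1, because A is nonzero for each X. Theta does not vanish on an open
  set.\<close>

lemma theta_nonzero:
  assumes q: "q \<noteq> 0" "norm q < 1" and y: "y \<in> theta_domain q UNIV"
  shows "theta q y \<noteq> 0"
proof
  assume "theta q y = 0"
  have y0: "y \<noteq> 0"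
    using y by (simp add: theta_domain_def)
  define U where "U = {u :: complex. norm q < norm (u / y) \<and> norm (u / y) < 1}"
  have zero: "theta q u = 0" if "u \<in> U" for u
  proof -
    have "norm q < norm (u / y)" "norm (u / y) < 1"
      using that by (auto simp: U_def)
    from kronecker_theta_identity[OF q(1) this] obtain A where "A \<noteq> 0"
      "\<And>y'. y' \<in> theta_domain q UNIV \<Longrightarrow> kronecker_sum q (u / y) UNIV y' * theta q y' = A * theta q (u / y * y')"
      by metis
    from this(1) this(2)[OF y] show ?thesis
      using \<open>theta q y = 0\<close> y0 by simp
  qed
  have "open U"
    unfolding U_def by (intro open_Collect_conj open_Collect_less continuous_intros) (use y0 in auto)
  moreover have "of_real ((norm q + 1) / 2) * y \<in> U"
    using y0 q(2) by (simp add: U_def norm_mult norm_divide abs_of_nonneg del: of_real_divide of_real_add)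
  ultimately show False
    using theta_not_identically_0[OF q] zero by blast
qed

theorem kronecker_formula:
  assumes q: "q \<noteq> 0" and X: "norm q < norm X" "norm X < 1" and y: "y \<in> theta_domain q UNIV"
  shows "kronecker_sum q X UNIV y = - deriv (theta q) 1 * theta q (X * y) / (theta q X * theta q y)"
proof -
  obtain A where A: "A * theta q X = - deriv (theta q) 1"
    "kronecker_sum q X UNIV y * theta q y = A * theta q (X * y)"
    using kronecker_theta_identity[OF q X] y by metis
  have nz: "theta q X \<noteq> 0" "theta q y \<noteq> 0"
    using theta_nonzero annulus_theta_domain[OF q X] q X y by auto
  have "kronecker_sum q X UNIV y * (theta q X * theta q y) = (kronecker_sum q X UNIV y * theta q y) * theta q X"
    by (simp only: mult_ac)
  also have "\<dots> = (A * theta q X) * theta q (X * y)"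
    unfolding A(2) by (simp only: mult_ac)
  finally show ?thesis
    unfolding A(1) using nz by (subst eq_divide_eq) auto
qed

section \<open>The elliptic kernel as a sum of hyperbolic kernels\<close>

abbreviation nome :: "complex \<Rightarrow> complex"
  where "nome \<tau> \<equiv> exp (2 * of_real pi * \<i> * \<tau>)"

text \<open>The sign in the exponent gives |X| < 1 for Im z < 0, and sends s = w/(2 pi i) to exp (-
  w), the variable in which \<open>coth_half\<close> becomes a geometric kernel.\<close>

abbreviation torus :: "complex \<Rightarrow> complex"
  where "torus s \<equiv> exp (- (2 * of_real pi * \<i> * s))"

lemma norm_nome: "norm (nome \<tau>) = exp (- (2 * pi * Im \<tau>))"
  by (simp add: norm_exp_eq_Re)

lemma norm_torus: "norm (torus s) = exp (2 * pi * Im s)"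
  by (simp add: norm_exp_eq_Re)

text \<open>After the reflection j -> -j the quadratic exponent is (1/2 - j)^2 = j(j-1) + 1/4, which
  explains the factor exp (pi i tau / 4). The linear exponent (1/2 - j)(s + 1/2) contributes i exp
  (pi i s) and, term by term, the sign (-1)^j and the power of \<open>torus s\<close>.\<close>

lemma theta1_eq_theta:
  "theta1 \<tau> s = - \<i> * exp (of_real pi * \<i> * \<tau> / 4) * exp (of_real pi * \<i> * s) * theta (nome \<tau>) (torus s)"
proof -
  let ?t = "\<lambda>j::int. exp (of_real pi * \<i> * (of_int j + 1/2)\<^sup>2 * \<tau> + 2 * of_real pi * \<i> * (of_int j + 1/2) * (s + 1/2))"
  let ?c = "\<i> * exp (of_real pi * \<i> * \<tau> / 4) * exp (of_real pi * \<i> * s)"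
  have summand: "?t (- j) = ?c * (theta_coeff (nome \<tau>) j * torus s powi j)" for j
  proof -
    have "even (j * (j - 1))"
      by (cases "even j") auto
    then have "j * (j - 1) = 2 * (j * (j - 1) div 2)"
      by simp
    then have div2: "2 * of_int (j * (j - 1) div 2) = (of_int (j * (j - 1)) :: complex)"
      by (metis of_int_mult of_int_numeral)
    have i: "\<i> = exp (of_real pi * \<i> / 2)"
      using exp_pi_i' exp_Euler by (simp add: exp_eq_polar cis_pi_half)
    have "?c * (theta_coeff (nome \<tau>) j * torus s powi j) =
      exp (of_real pi * \<i> / 2) * exp (of_real pi * \<i> * \<tau> / 4) * exp (of_real pi * \<i> * s) *
      (exp (of_int j * (- (of_real pi * \<i>))) * exp (of_int (j * (j - 1) div 2) * (2 * of_real pi * \<i> * \<tau>)) *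
        exp (of_int j * (- (2 * of_real pi * \<i> * s))))"
      unfolding theta_coeff_def exp_power_int[symmetric] i[symmetric]
      by (simp add: exp_power_int[symmetric] exp_minus)
    also have "\<dots> = exp (of_real pi * \<i> / 2 + of_real pi * \<i> * \<tau> / 4 + of_real pi * \<i> * s +
      (of_int j * (- (of_real pi * \<i>)) + (2 * of_int (j * (j - 1) div 2)) * (of_real pi * \<i> * \<tau>) +
        of_int j * (- (2 * of_real pi * \<i> * s))))"
      by (simp only: exp_add mult_ac)
    also have "\<dots> = ?t (- j)"
      unfolding div2 by (rule arg_cong[where f = exp]) (simp add: power2_eq_square field_simps)
    finally show ?thesis ..
  qed
  have "bij (uminus :: int \<Rightarrow> int)"
    by (rule bij_betwI[where g = uminus]) auto
  then have "(\<Sum>\<^sub>\<infinity>j. ?t (- j)) = (\<Sum>\<^sub>\<infinity>j. ?t j)"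
    by (rule infsum_reindex_bij_betw)
  then have "theta1 \<tau> s = - (\<Sum>\<^sub>\<infinity>j. ?t (- j))"
    by (simp add: theta1_def)
  also have "\<dots> = - (?c * theta (nome \<tau>) (torus s))"
    unfolding summand theta_def by (simp add: infsum_cmult_right')
  finally show ?thesis
    by simp
qed

text \<open>\<open>theta\<close> vanishes at \<open>torus 0 = 1\<close>, so in the product rule only
  the summand with its derivative survives.\<close>

lemma deriv_theta1_0:
  assumes "Im \<tau> > 0"
  shows "deriv (theta1 \<tau>) 0 = - \<i> * exp (of_real pi * \<i> * \<tau> / 4) * (- (2 * of_real pi * \<i>) * deriv (theta (nome \<tau>)) 1)"
proof -
  have q: "nome \<tau> \<noteq> 0" "norm (nome \<tau>) < 1"
    using assms by (simp_all add: norm_nome del: norm_exp_eq_Re)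
  have "open (- {0 :: complex})"
    by (simp add: open_Compl)
  then have "theta (nome \<tau>) field_differentiable at 1"
    using theta_holomorphic[OF q] by (auto intro: holomorphic_on_imp_differentiable_at)
  then have "(theta (nome \<tau>) has_field_derivative deriv (theta (nome \<tau>)) 1) (at (torus 0))"
    by (simp add: field_differentiable_derivI)
  moreover have "(torus has_field_derivative - (2 * of_real pi * \<i>)) (at 0)"
    by (auto intro!: derivative_eq_intros)
  ultimately have d1: "((\<lambda>s. theta (nome \<tau>) (torus s)) has_field_derivative
      deriv (theta (nome \<tau>)) 1 * - (2 * of_real pi * \<i>)) (at 0)"
    by (rule DERIV_chain2)
  have "((\<lambda>s. exp (of_real pi * \<i> * s)) has_field_derivative of_real pi * \<i>) (at 0)"
    by (auto intro!: derivative_eq_intros)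
  then have d2: "((\<lambda>s. - \<i> * exp (of_real pi * \<i> * \<tau> / 4) * exp (of_real pi * \<i> * s)) has_field_derivative
      - \<i> * exp (of_real pi * \<i> * \<tau> / 4) * (of_real pi * \<i>)) (at 0)"
    by (rule DERIV_cmult)
  have "((\<lambda>s. - \<i> * exp (of_real pi * \<i> * \<tau> / 4) * exp (of_real pi * \<i> * s) * theta (nome \<tau>) (torus s))
      has_field_derivative
      - \<i> * exp (of_real pi * \<i> * \<tau> / 4) * (of_real pi * \<i>) * theta (nome \<tau>) (torus 0) +
      deriv (theta (nome \<tau>)) 1 * - (2 * of_real pi * \<i>) *
        (- \<i> * exp (of_real pi * \<i> * \<tau> / 4) * exp (of_real pi * \<i> * 0))) (at 0)"
    by (rule DERIV_mult[OF d2 d1])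
  moreover have "(\<lambda>s. - \<i> * exp (of_real pi * \<i> * \<tau> / 4) * exp (of_real pi * \<i> * s) * theta (nome \<tau>) (torus s)) = theta1 \<tau>"
    by (simp add: theta1_eq_theta fun_eq_iff)
  ultimately show ?thesis
    using theta_1[OF q] by (intro DERIV_imp_deriv) (simp add: mult_ac)
qed

text \<open>In the quotient of theta functions the constants and the exponentials exp (pi i s)
  cancel, and the prefactor 1/(2 pi i) of \<open>chi\<close> cancels the derivative of
  \<open>torus\<close> at 0; what remains is the right-hand side of Kronecker's formula.\<close>

lemma chi_eq_kronecker_sum:
  assumes z: "- Im \<tau> < Im z" "Im z < 0" and w: "exp (- w) \<in> theta_domain (nome \<tau>) UNIV"
  shows "chi \<tau> w z = kronecker_sum (nome \<tau>) (torus z) UNIV (exp (- w))"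
proof -
  have X: "norm (nome \<tau>) < norm (torus z)" "norm (torus z) < 1"
    using mult_strict_left_mono[OF z(1) pi_gt_zero] mult_strict_left_mono[OF z(2) pi_gt_zero]
    by (simp_all add: norm_nome norm_torus del: norm_exp_eq_Re)
  have tau: "Im \<tau> > 0"
    using z by linarith
  have y: "torus (w / (2 * of_real pi * \<i>)) = exp (- w)"
    by simp
  have "- (2 * of_real pi * \<i> * (w / (2 * of_real pi * \<i>) + z)) = - (2 * of_real pi * \<i> * z) + - w"
    by (simp add: distrib_left)
  then have Xy: "torus (w / (2 * of_real pi * \<i>) + z) = torus z * exp (- w)"
    by (simp only: exp_add)
  have e: "exp (of_real pi * \<i> * (w / (2 * of_real pi * \<i>) + z)) =
      exp (of_real pi * \<i> * (w / (2 * of_real pi * \<i>))) * exp (of_real pi * \<i> * z)"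
    by (simp only: distrib_left exp_add)
  have nz: "theta (nome \<tau>) (torus z) \<noteq> 0" "theta (nome \<tau>) (exp (- w)) \<noteq> 0"
    using theta_nonzero[of "nome \<tau>"] annulus_theta_domain[OF _ X] X w by auto
  show ?thesis
    unfolding kronecker_formula[OF exp_not_eq_zero X w] chi_def theta1_eq_theta deriv_theta1_0[OF tau] y Xy e
    using nz by (simp add: divide_simps) (simp add: mult_ac)
qed

section \<open>The hyperbolic kernels and their poles\<close>

lemma coth_half_eq:
  assumes "exp (- u) \<noteq> 1"
  shows "coth_half u = 1 / (1 - exp (- u)) - 1/2"
proof -
  define e where "e = exp (u / 2)"
  have e: "e \<noteq> 0" "exp (- u) = inverse (e * e)" "exp (- (u / 2)) = inverse e"
    by (simp_all add: e_def exp_minus flip: exp_add)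
  have "e * e \<noteq> 1"
  proof
    assume "e * e = 1"
    then have "exp (- u) = 1"
      unfolding e(2) by simp
    with assms show False ..
  qed
  then show ?thesis
    unfolding coth_half_def cosh_field_def sinh_field_def e(2,3) e_def[symmetric]
    using e(1) by (simp add: divide_simps)
qed

lemma sinh_half_eq_0_iff: "sinh (w / 2) = 0 \<longleftrightarrow> exp (- w) = (1 :: complex)"
proof -
  define e where "e = exp (w / 2)"
  have e: "e \<noteq> 0" "exp (- w) = inverse (e * e)" "exp (- (w / 2)) = inverse e"
    by (simp_all add: e_def exp_minus flip: exp_add)
  show ?thesis
    unfolding sinh_field_def e(2,3) e_def[symmetric] using e(1) by (auto simp: field_simps)
qed

text \<open>The auxiliary p is w times \<open>coth_half w\<close>, made regular at 0 through the
  entire function sinh(w/2)/w. Then \<open>coth_half_reg\<close> is the difference quotient of p at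
  0, hence holomorphic. Since p is even, its derivative at 0 vanishes, in agreement with the value 0
  prescribed in the definition.\<close>

lemma coth_half_reg_holomorphic:
  assumes "open S" "\<And>w. w \<in> S \<Longrightarrow> w \<noteq> 0 \<Longrightarrow> exp (- w) \<noteq> 1"
  shows "coth_half_reg holomorphic_on S"
proof -
  define T where "T = {w :: complex. w = 0 \<or> exp (- w) \<noteq> 1}"
  define \<sigma> where "\<sigma> w = (if w = 0 then 1/2 else sinh (w / 2) / w)" for w :: complex
  define p where "p w = cosh (w / 2) / (2 * \<sigma> w)" for w :: complex
  have sinh': "((\<lambda>w. sinh (w / 2)) has_field_derivative 1/2) (at (0 :: complex))"
    by (rule derivative_eq_intros refl | simp)+
  have sinh_hol: "(\<lambda>w. sinh (w / 2)) holomorphic_on (UNIV :: complex set)"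
    and cosh_hol: "(\<lambda>w. cosh (w / 2)) holomorphic_on (UNIV :: complex set)"
    unfolding sinh_field_def cosh_field_def by (intro holomorphic_intros; simp)+
  have "(\<lambda>w. if w = 0 then deriv (\<lambda>w. sinh (w / 2)) 0 else (sinh (w / 2) - sinh (0 / 2)) / (w - 0)) holomorphic_on (UNIV :: complex set)"
    using sinh_hol by (rule pole_lemma_open) simp
  moreover have "(\<lambda>w. if w = 0 then deriv (\<lambda>w. sinh (w / 2)) 0 else (sinh (w / 2) - sinh (0 / 2)) / (w - 0)) = \<sigma>"
    using DERIV_imp_deriv[OF sinh'] by (auto simp: \<sigma>_def fun_eq_iff)
  ultimately have \<sigma>: "\<sigma> holomorphic_on UNIV"
    by simp
  have \<sigma>0: "\<sigma> w = 0 \<longleftrightarrow> w \<notin> T" for w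
    by (auto simp: \<sigma>_def T_def sinh_half_eq_0_iff)
  then have "T = {w. \<sigma> w \<noteq> 0}"
    by auto
  moreover have "open {w. \<sigma> w \<noteq> 0}"
    using holomorphic_on_imp_continuous_on[OF \<sigma>] by (intro open_Collect_neq) auto
  ultimately have "open T"
    by simp
  have p: "p holomorphic_on T"
    unfolding p_def using \<sigma>0
    by (intro holomorphic_intros holomorphic_on_subset[OF \<sigma>] holomorphic_on_subset[OF cosh_hol]) auto
  have "p field_differentiable at 0"
    using p \<open>open T\<close> by (auto intro!: holomorphic_on_imp_differentiable_at simp: T_def)
  then have p': "(p has_field_derivative deriv p 0) (at 0)"
    by (simp add: field_differentiable_derivI)
  have "(p has_field_derivative deriv p 0) (at (- 0))"
    using p' by simp
  moreover have "(uminus has_field_derivative - 1) (at (0 :: complex))"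
    by (auto intro!: derivative_eq_intros)
  ultimately have "((\<lambda>w. p (- w)) has_field_derivative deriv p 0 * - 1) (at 0)"
    by (rule DERIV_chain2)
  moreover have "(\<lambda>w. p (- w)) = p"
    by (auto simp: p_def \<sigma>_def fun_eq_iff)
  ultimately have "deriv p 0 * - 1 = deriv p 0"
    using p' DERIV_unique by metis
  then have p'0: "deriv p 0 = 0"
    by simp
  have "(\<lambda>w. if w = 0 then deriv p 0 else (p w - p 0) / (w - 0)) holomorphic_on T"
    using p \<open>open T\<close> by (rule pole_lemma_open)
  moreover have "(if w = 0 then deriv p 0 else (p w - p 0) / (w - 0)) = coth_half_reg w" if "w \<in> T" for w
    using that \<sigma>0[of w] p'0
    by (auto simp: coth_half_reg_def coth_half_def p_def \<sigma>_def diff_divide_distrib)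
  ultimately have "coth_half_reg holomorphic_on T"
    by (rule holomorphic_transform)
  moreover have "S \<subseteq> T"
    using assms(2) by (auto simp: T_def)
  ultimately show ?thesis
    by (rule holomorphic_on_subset)
qed

text \<open>The complement of the poles of \<open>chi_a\<close> in w. It contains 0 in every case,
  because \<open>shifted_lattice\<close> omits that point.\<close>

definition elliptic_domain :: "nat \<Rightarrow> complex \<Rightarrow> int \<Rightarrow> complex set"
  where "elliptic_domain N \<tau> a = - (\<lambda>x. 2 * of_real pi * \<i> * x) ` shifted_lattice N \<tau> a"

text \<open>The index of the single summand that is replaced by its regular part when \<open>a = 0\<close>.\<close>

definition singular_indices :: "int \<Rightarrow> int set"
  where "singular_indices a = (if a = 0 then {0} else {})"

lemma exp_minus_mult_nome_eq_1_iff: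
  "exp (- w) * nome \<tau> powi m = 1 \<longleftrightarrow> (\<exists>j::int. w = 2 * of_real pi * \<i> * (of_int j + of_int m * \<tau>))"
proof -
  have "exp (- w) * nome \<tau> powi m = exp (- w + of_int m * (2 * of_real pi * \<i> * \<tau>))"
    by (simp only: exp_add exp_power_int)
  also have "\<dots> = 1 \<longleftrightarrow> (\<exists>j::int. - w + of_int m * (2 * of_real pi * \<i> * \<tau>) = of_int (2 * j) * of_real pi * \<i>)"
    using exp_eq[of _ 0] by simp
  also have "\<dots> \<longleftrightarrow> (\<exists>j::int. w = 2 * of_real pi * \<i> * (of_int j + of_int m * \<tau>))"
  proof safe
    fix j :: int
    assume "- w + of_int m * (2 * of_real pi * \<i> * \<tau>) = of_int (2 * j) * of_real pi * \<i>"
    then have "w = 2 * of_real pi * \<i> * (of_int (- j) + of_int m * \<tau>)"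
      by (simp add: algebra_simps)
    then show "\<exists>j::int. w = 2 * of_real pi * \<i> * (of_int j + of_int m * \<tau>)" ..
  next
    fix j :: int
    show "\<exists>i::int. - (2 * of_real pi * \<i> * (of_int j + of_int m * \<tau>)) + of_int m * (2 * of_real pi * \<i> * \<tau>)
       = of_int (2 * i) * of_real pi * \<i>"
      by (rule exI[of _ "- j"]) (simp add: algebra_simps)
  qed
  finally show ?thesis .
qed

text \<open>Comparison of imaginary parts gives m = a/N, since Im tau > 0.\<close>

lemma lattice_point_eq_0:
  assumes N: "N > 0" and \<tau>: "Im \<tau> > 0"
    and eq: "of_int j + \<tau> * of_int m - of_int a / of_nat N * \<tau> = 0"
  shows "m * int N = a"
proof -
  have r: "complex_of_int a / of_nat N = of_real (real_of_int a / real N)"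
    by simp
  have "Im (of_int j + \<tau> * of_int m - of_int a / of_nat N * \<tau>) = Im \<tau> * (real_of_int m - real_of_int a / real N)"
    unfolding r by (simp only: minus_complex.sel plus_complex.sel times_complex.sel Re_complex_of_real
        Im_complex_of_real complex_Re_of_int complex_Im_of_int) (simp add: right_diff_distrib)
  with eq \<tau> have "real_of_int m = real_of_int a / real N"
    by simp
  then have "real_of_int (m * int N) = real_of_int a"
    using N by (simp add: field_simps)
  then show ?thesis
    by (simp only: of_int_eq_iff)
qed

lemma open_elliptic_domain:
  assumes "Im \<tau> > 0"
  shows "open (elliptic_domain N \<tau> a)"
proof -
  \<comment> \<open>A lower bound for the distance of two distinct points: a difference in m is
    visible in the imaginary part before multiplication by 2 pi i and costs at least Im tau; with
    equal m a difference in j costs at least 1.\<close>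
  define e where "e = 2 * pi * min 1 (Im \<tau>)"
  have "closed ((\<lambda>x. 2 * of_real pi * \<i> * x) ` shifted_lattice N \<tau> a)"
  proof (rule discrete_imp_closed[of e])
    show "0 < e"
      using assms by (simp add: e_def)
    show "\<forall>x\<in>(\<lambda>x. 2 * of_real pi * \<i> * x) ` shifted_lattice N \<tau> a.
        \<forall>y\<in>(\<lambda>x. 2 * of_real pi * \<i> * x) ` shifted_lattice N \<tau> a. dist y x < e \<longrightarrow> y = x"
    proof (intro ballI impI)
      fix x y
      assume "x \<in> (\<lambda>x. 2 * of_real pi * \<i> * x) ` shifted_lattice N \<tau> a"
        and "y \<in> (\<lambda>x. 2 * of_real pi * \<i> * x) ` shifted_lattice N \<tau> a" and d: "dist y x < e"
      then obtain j m j' m' :: int where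
        xy: "x = 2 * of_real pi * \<i> * (of_int j + \<tau> * of_int m - of_int a / of_nat N * \<tau>)"
        "y = 2 * of_real pi * \<i> * (of_int j' + \<tau> * of_int m' - of_int a / of_nat N * \<tau>)"
        by (auto simp: shifted_lattice_def period_lattice_def)
      have yx: "y - x = 2 * of_real pi * \<i> * (of_int (j' - j) + \<tau> * of_int (m' - m))"
        unfolding xy by (simp add: algebra_simps)
      define l where "l = of_int (j' - j) + \<tau> * of_int (m' - m)"
      have "norm (y - x) = 2 * pi * norm l"
        unfolding yx l_def by (simp add: norm_mult)
      with d have l: "norm l < min 1 (Im \<tau>)"
        by (simp add: e_def dist_norm)
      have "m' = m"
      proof (rule ccontr)
        assume "m' \<noteq> m"
        then have "1 \<le> \<bar>m' - m\<bar>"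
          by simp
        then have "1 \<le> \<bar>real_of_int (m' - m)\<bar>"
          by (metis of_int_1_le_iff of_int_abs)
        then have "Im \<tau> * 1 \<le> Im \<tau> * \<bar>real_of_int (m' - m)\<bar>"
          using assms by (intro mult_left_mono) auto
        also have "\<dots> = \<bar>Im l\<bar>"
          using assms by (simp add: l_def abs_mult)
        also have "\<dots> \<le> norm l"
          by (rule abs_Im_le_cmod)
        finally show False
          using l by simp
      qed
      moreover have "j' = j"
      proof (rule ccontr)
        assume "j' \<noteq> j"
        then have "1 \<le> \<bar>j' - j\<bar>"
          by simp
        then have "1 \<le> \<bar>real_of_int (j' - j)\<bar>"
          by (metis of_int_1_le_iff of_int_abs)
        also have "\<dots> = norm l"
          using \<open>m' = m\<close> by (simp add: l_def flip: of_int_diff)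
        finally show False
          using l by simp
      qed
      ultimately show "y = x"
        using yx by simp
    qed
  qed
  then show ?thesis
    by (simp add: elliptic_domain_def open_Compl)
qed

text \<open>The function of \<open>lie \<omega>\<close> that represents the operator
  \<open>loop_R_plus\<close> in degree n, with the shift by k n moved from the operator to the
  variable.\<close>

definition degree_factor :: "complex \<Rightarrow> int \<Rightarrow> complex \<Rightarrow> complex"
  where "degree_factor k n w = (if n = 0 then coth_half_reg w else coth_half (w + k * of_int n)) + 1/2"

locale elliptic_strip =
  fixes N :: nat and \<tau> k z :: complex and a :: int
  assumes N: "N > 0" and k: "k * of_nat N = 2 * of_real pi * \<i> * \<tau>"
    and z: "- Im \<tau> < Im z" "Im z < 0" and a: "0 \<le> a" "a < int N"
begin

text \<open>This number is k a, the displacement produced by the degree a, and at the same time the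
  displacement built into \<open>chi_a\<close>.\<close>

definition shift :: complex
  where "shift = 2 * of_real pi * \<i> * (of_int a / of_nat N) * \<tau>"

text \<open>For n = a + N m the exponential is (v1/v2)^n, the scalar created by the two evaluations
  in the degrees n and -n.\<close>

definition loop_term :: "int \<Rightarrow> complex \<Rightarrow> complex"
  where "loop_term m w = exp (2 * of_real pi * \<i> * of_int (a + int N * m) * z / of_nat N)
    * degree_factor k (a + int N * m) w"

text \<open>For a = 0 the Kronecker sum omits the index 0, and the regularized term of degree 0 is
  added in its place, so that the function makes sense at w = 0.\<close>

definition loop_sum :: "complex \<Rightarrow> complex"
  where "loop_sum w = exp (2 * of_real pi * \<i> * of_int a * z / of_nat N) *
    (kronecker_sum (nome \<tau>) (torus z) (- singular_indices a) (exp (- (w + shift)))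
      + (if a = 0 then coth_half_reg w + 1/2 else 0))"

lemma Im_tau: "Im \<tau> > 0"
  using z by linarith

lemma nome_torus_bounds: "norm (nome \<tau>) < norm (torus z)" "norm (torus z) < 1"
  using mult_strict_left_mono[OF z(1) pi_gt_zero] mult_strict_left_mono[OF z(2) pi_gt_zero]
  by (simp_all add: norm_nome norm_torus del: norm_exp_eq_Re)

lemma degree_eq_0_iff: "a + int N * m = 0 \<longleftrightarrow> m \<in> singular_indices a"
proof -
  have ne: "a + int N * m \<noteq> 0" if "m \<noteq> 0"
  proof
    assume "a + int N * m = 0"
    then have "int N dvd a"
      by (metis add_eq_0_iff dvd_minus_iff dvd_triv_left)
    then have "a = 0"
      using a by (meson linorder_not_le zdvd_imp_le le_less)
    with \<open>a + int N * m = 0\<close> N that show False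
      by simp
  qed
  show ?thesis
    using ne by (cases "m = 0") (auto simp: singular_indices_def)
qed

lemma k_degree: "k * of_int (a + int N * m) = shift + of_int m * (2 * of_real pi * \<i> * \<tau>)"
proof -
  have k': "k = 2 * of_real pi * \<i> * \<tau> / of_nat N"
    using k N by (simp add: field_simps)
  show ?thesis
    unfolding k' shift_def using N by (simp add: field_simps)
qed

text \<open>The exponent is reversed: degree a + N m corresponds to the index -m of the Kronecker
  series. This is the reason for the reflections of the summation index below.\<close>

lemma exp_degree: "exp (- (w + k * of_int (a + int N * m))) = exp (- (w + shift)) * nome \<tau> powi (- m)"
proof -
  have "- (w + k * of_int (a + int N * m)) = - (w + shift) + of_int (- m) * (2 * of_real pi * \<i> * \<tau>)"
    unfolding k_degree by simp
  then show ?thesis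
    by (simp only: exp_add exp_power_int)
qed

text \<open>A vanishing denominator puts w on 2 pi i times the shifted lattice, zero included. The
  only such point left in the domain is w = 0, which forces a = 0 and m = 0; hence the distinction
  in the index set.\<close>

lemma theta_domain_if_elliptic_domain:
  assumes "w \<in> elliptic_domain N \<tau> a"
  shows "exp (- (w + shift)) \<in> theta_domain (nome \<tau>) (if w = 0 then - singular_indices a else UNIV)"
proof -
  have "exp (- (w + shift)) * nome \<tau> powi m \<noteq> 1" if "w = 0 \<Longrightarrow> m \<notin> singular_indices a" for m
  proof
    assume "exp (- (w + shift)) * nome \<tau> powi m = 1"
    then obtain j :: int where "w + shift = 2 * of_real pi * \<i> * (of_int j + of_int m * \<tau>)"
      unfolding exp_minus_mult_nome_eq_1_iff by blast
    then have w: "w = 2 * of_real pi * \<i> * (of_int j + \<tau> * of_int m - of_int a / of_nat N * \<tau>)"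
      unfolding shift_def by (simp add: algebra_simps)
    then have "of_int j + \<tau> * of_int m - of_int a / of_nat N * \<tau> = 0"
      using assms unfolding elliptic_domain_def shifted_lattice_def period_lattice_def by blast
    with w have "w = 0"
      by simp
    have "m * int N = a"
      by (rule lattice_point_eq_0[OF N Im_tau]) fact
    then have "a + int N * - m = 0"
      by (simp add: mult.commute)
    then have "- m \<in> singular_indices a"
      by (simp only: degree_eq_0_iff)
    then have "m \<in> singular_indices a"
      by (auto simp: singular_indices_def split: if_splits)
    with that \<open>w = 0\<close> show False by simp
  qed
  then show ?thesis
    by (auto simp: theta_domain_def)
qed

lemma theta_domain_regular:
  assumes "w \<in> elliptic_domain N \<tau> a"
  shows "exp (- (w + shift)) \<in> theta_domain (nome \<tau>) (- singular_indices a)"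
  using theta_domain_if_elliptic_domain[OF assms] by (auto simp: theta_domain_def split: if_splits)

lemma loop_term_regular:
  assumes "w \<in> elliptic_domain N \<tau> a" "m \<notin> singular_indices a"
  shows "loop_term m w = exp (2 * of_real pi * \<i> * of_int a * z / of_nat N) *
    (torus z powi (- m) / (1 - exp (- (w + shift)) * nome \<tau> powi (- m)))"
proof -
  have "- m \<in> - singular_indices a"
    using assms(2) by (auto simp: singular_indices_def split: if_splits)
  then have ne: "exp (- (w + k * of_int (a + int N * m))) \<noteq> 1"
    using theta_domain_regular[OF assms(1)] unfolding exp_degree theta_domain_def by blast
  have "degree_factor k (a + int N * m) w = coth_half (w + k * of_int (a + int N * m)) + 1/2"
    using assms(2) by (simp only: degree_factor_def degree_eq_0_iff if_False)
  also have "\<dots> = 1 / (1 - exp (- (w + shift)) * nome \<tau> powi (- m))"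
    unfolding coth_half_eq[OF ne] exp_degree by simp
  finally have "degree_factor k (a + int N * m) w = 1 / (1 - exp (- (w + shift)) * nome \<tau> powi (- m))" .
  moreover have "2 * of_real pi * \<i> * of_int (a + int N * m) * z / of_nat N =
      2 * of_real pi * \<i> * of_int a * z / of_nat N + of_int (- m) * (- (2 * of_real pi * \<i> * z))"
    using N by (simp add: field_simps)
  ultimately show ?thesis
    unfolding loop_term_def by (simp only: exp_add exp_power_int) simp
qed

lemma loop_term_singular:
  assumes "m \<in> singular_indices a"
  shows "loop_term m w = coth_half_reg w + 1/2"
proof -
  have "a + int N * m = 0"
    using assms by (simp only: degree_eq_0_iff)
  then show ?thesis
    unfolding loop_term_def degree_factor_def by simp
qed

lemma coth_half_reg_holomorphic_elliptic_domain:
  assumes "a = 0"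
  shows "coth_half_reg holomorphic_on elliptic_domain N \<tau> a"
proof (rule coth_half_reg_holomorphic)
  show "exp (- w) \<noteq> 1" if "w \<in> elliptic_domain N \<tau> a" "w \<noteq> 0" for w
  proof -
    have "exp (- (w + shift)) \<in> theta_domain (nome \<tau>) UNIV"
      using theta_domain_if_elliptic_domain[OF that(1)] that(2) by simp
    then have "exp (- (w + shift)) * nome \<tau> powi 0 \<noteq> 1"
      unfolding theta_domain_def by blast
    moreover have "shift = 0"
      unfolding shift_def using assms by simp
    ultimately show ?thesis
      by simp
  qed
qed (rule open_elliptic_domain[OF Im_tau])

lemma loop_term_holomorphic: "loop_term m holomorphic_on elliptic_domain N \<tau> a"
proof (cases "m \<in> singular_indices a")
  case True
  then have "a = 0"
    by (auto simp: singular_indices_def split: if_splits)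
  then have "(\<lambda>w. coth_half_reg w + 1/2) holomorphic_on elliptic_domain N \<tau> a"
    by (intro holomorphic_intros coth_half_reg_holomorphic_elliptic_domain)
  then show ?thesis
    by (rule holomorphic_transform) (simp only: loop_term_singular[OF True])
next
  case False
  then have "- m \<in> - singular_indices a"
    by (auto simp: singular_indices_def split: if_splits)
  then have "1 - exp (- (w + shift)) * nome \<tau> powi (- m) \<noteq> 0" if "w \<in> elliptic_domain N \<tau> a" for w
    using theta_domain_regular[OF that] by (auto simp: theta_domain_def)
  then have "(\<lambda>w. exp (2 * of_real pi * \<i> * of_int a * z / of_nat N) *
    (torus z powi (- m) / (1 - exp (- (w + shift)) * nome \<tau> powi (- m)))) holomorphic_on elliptic_domain N \<tau> a"
    by (intro holomorphic_intros) auto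
  then show ?thesis
    by (rule holomorphic_transform) (erule loop_term_regular[OF _ False, symmetric])
qed

lemma has_sum_loop_sum:
  assumes w: "w \<in> elliptic_domain N \<tau> a"
  shows "((\<lambda>m. loop_term m w) has_sum loop_sum w) UNIV"
proof -
  let ?c = "exp (2 * of_real pi * \<i> * of_int a * z / of_nat N)"
  let ?S = "kronecker_sum (nome \<tau>) (torus z) (- singular_indices a) (exp (- (w + shift)))"
  have "((\<lambda>m. ?c * (torus z powi m / (1 - exp (- (w + shift)) * nome \<tau> powi m))) has_sum ?c * ?S) (- singular_indices a)"
    by (intro has_sum_cmult_right has_sum_kronecker_sum exp_not_eq_zero nome_torus_bounds theta_domain_regular[OF w])
  then have "((\<lambda>m. loop_term m w) has_sum ?c * ?S) (- singular_indices a)"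
    using loop_term_regular[OF w]
    by (subst has_sum_reindex_bij_witness[where T = "- singular_indices a" and i = uminus and j = uminus
          and h = "\<lambda>m. ?c * (torus z powi m / (1 - exp (- (w + shift)) * nome \<tau> powi m))" and s' = "?c * ?S"])
       (auto simp: singular_indices_def split: if_splits)
  moreover have "((\<lambda>m. loop_term m w) has_sum (if a = 0 then coth_half_reg w + 1/2 else 0)) (singular_indices a)"
    using loop_term_singular by (intro has_sum_finiteI) (auto simp: singular_indices_def)
  ultimately have "((\<lambda>m. loop_term m w) has_sum ?c * ?S + (if a = 0 then coth_half_reg w + 1/2 else 0))
      (- singular_indices a \<union> singular_indices a)"
    by (rule has_sum_Un_disjoint) auto
  moreover have "?c * ?S + (if a = 0 then coth_half_reg w + 1/2 else 0) = loop_sum w"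
    by (auto simp: loop_sum_def)
  ultimately show ?thesis
    by simp
qed

lemma loop_term_M_test:
  assumes K: "compact K" "K \<subseteq> elliptic_domain N \<tau> a"
  shows "\<exists>M. M summable_on UNIV \<and> (\<forall>m\<in>UNIV. \<forall>w\<in>K. norm (loop_term m w) \<le> M m)"
proof -
  let ?c = "exp (2 * of_real pi * \<i> * of_int a * z / of_nat N)"
  let ?K = "(\<lambda>w. exp (- (w + shift))) ` K"
  have "compact ?K"
    using K by (intro compact_continuous_image continuous_intros)
  moreover have "0 \<notin> ?K"
    by auto
  ultimately obtain M n0 where M: "M summable_on UNIV"
    "\<And>m y. int n0 \<le> \<bar>m\<bar> \<Longrightarrow> y \<in> ?K \<Longrightarrow> norm (torus z powi m / (1 - y * nome \<tau> powi m)) \<le> M m"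
    using kronecker_terms_bound[OF exp_not_eq_zero nome_torus_bounds] by metis
  have "(\<lambda>m. M (- m)) summable_on UNIV"
    using M(1) by (subst summable_on_reindex_bij_witness[where T = UNIV and i = uminus and j = uminus and h = M]) auto
  then have summable: "(\<lambda>m. norm ?c * M (- m)) summable_on UNIV"
    by (rule summable_on_cmult_right)
  have cont: "continuous_on K (loop_term m)" for m
    using holomorphic_on_imp_continuous_on[OF loop_term_holomorphic] K(2) by (rule continuous_on_subset)
  \<comment> \<open>The maximum with 1 excludes m = 0, the only index that can be singular; all
    other terms are literally terms of the Kronecker series with reflected index.\<close>
  have bound: "norm (loop_term m w) \<le> norm ?c * M (- m)" if m: "int (max n0 1) \<le> \<bar>m\<bar>" and w: "w \<in> K" for m w
  proof -
    have "m \<notin> singular_indices a"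
      using m by (auto simp: singular_indices_def)
    then have "norm (loop_term m w) = norm ?c * norm (torus z powi (- m) / (1 - exp (- (w + shift)) * nome \<tau> powi (- m)))"
      using loop_term_regular[of w m] w K(2) by (simp only: norm_mult subsetD not_False_eq_True)
    also have "\<dots> \<le> norm ?c * M (- m)"
      using m w by (intro mult_left_mono M(2)) auto
    finally show ?thesis .
  qed
  show ?thesis
    by (rule summable_bound_extend[OF K(1) cont summable bound])
qed

lemma loop_sum_holomorphic: "loop_sum holomorphic_on elliptic_domain N \<tau> a"
  by (rule holomorphic_has_sum_M_test[OF open_elliptic_domain[OF Im_tau] loop_term_holomorphic
        has_sum_loop_sum loop_term_M_test])

text \<open>For w different from 0 this is Kronecker's formula, with 1/w moved into
  \<open>coth_half_reg\<close> when a = 0. \<open>remove_sings\<close> takes the limit of the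
  punctured values, and that limit is the value of the continuous function \<open>loop_sum\<close>,
  so w = 0 needs no separate treatment.\<close>

lemma chi_a_eq_loop_sum:
  assumes w: "w \<in> elliptic_domain N \<tau> a"
  shows "chi_a N \<tau> a w z = loop_sum w"
proof -
  let ?c = "exp (2 * of_real pi * \<i> * of_int a * z / of_nat N)"
  let ?f = "\<lambda>v. ?c * (chi \<tau> (v + shift) z - (if a = 0 then 1 / v else 0))"
  have eq: "?f v = loop_sum v" if v: "v \<in> elliptic_domain N \<tau> a" "v \<noteq> 0" for v
  proof -
    have dom: "exp (- (v + shift)) \<in> theta_domain (nome \<tau>) UNIV"
      using theta_domain_if_elliptic_domain[OF v(1)] v(2) by simp
    have chi: "chi \<tau> (v + shift) z = kronecker_sum (nome \<tau>) (torus z) UNIV (exp (- (v + shift)))"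
      by (rule chi_eq_kronecker_sum[OF z dom])
    show ?thesis
    proof (cases "a = 0")
      case True
      then have s: "shift = 0"
        unfolding shift_def by simp
      have "exp (- (v + shift)) * nome \<tau> powi 0 \<noteq> 1"
        using dom unfolding theta_domain_def by blast
      then have "exp (- v) \<noteq> 1"
        by (simp add: s)
      then have "coth_half_reg v + 1/2 = 1 / (1 - exp (- v)) - 1 / v"
        using v(2) by (simp add: coth_half_reg_def coth_half_eq)
      then show ?thesis
        using kronecker_sum_split[OF exp_not_eq_zero nome_torus_bounds dom] chi True
        unfolding loop_sum_def singular_indices_def s Compl_eq_Diff_UNIV by simp
    next
      case False
      then show ?thesis
        unfolding chi loop_sum_def singular_indices_def by simp
    qed
  qed
  have op: "open (elliptic_domain N \<tau> a)"
    by (rule open_elliptic_domain[OF Im_tau])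
  have "isCont loop_sum w"
    using holomorphic_on_imp_continuous_on[OF loop_sum_holomorphic] w
    by (simp add: continuous_on_eq_continuous_at[OF op])
  then have "loop_sum \<midarrow>w\<rightarrow> loop_sum w"
    by (rule isContD)
  moreover have "\<forall>\<^sub>F v in at w. loop_sum v = ?f v"
  proof -
    have "\<forall>\<^sub>F v in at w. v \<in> elliptic_domain N \<tau> a"
      using op w by (rule eventually_at_in_open')
    moreover have "\<forall>\<^sub>F v in at w. v \<noteq> 0"
      by (rule eventually_neq_at_within)
    ultimately show ?thesis
      by eventually_elim (simp add: eq)
  qed
  ultimately have "?f \<midarrow>w\<rightarrow> loop_sum w"
    by (rule Lim_transform_eventually)
  then show ?thesis
    unfolding chi_a_def shift_def[symmetric] by (rule remove_sings_eqI)
qed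

end

section \<open>The functional calculus\<close>

global_interpretation complex_vector_pair: vector_space_pair
  "scaleC :: complex \<Rightarrow> 'a \<Rightarrow> 'a::complex_vector" "scaleC :: complex \<Rightarrow> 'b \<Rightarrow> 'b::complex_vector" ..

lemma clinear_iff:
  "clinear f \<longleftrightarrow> (\<forall>x y. f (x + y) = f x + f y) \<and> (\<forall>c x. f (c *\<^sub>C x) = c *\<^sub>C f x)"
  by (simp add: Vector_Spaces.linear_iff complex_vector.vector_space_axioms)

lemma clinear_add: "clinear f \<Longrightarrow> f (x + y) = f x + f y"
  and clinear_scaleC: "clinear f \<Longrightarrow> f (c *\<^sub>C x) = c *\<^sub>C f x"
  by (simp_all add: clinear_iff)

lemma clinear_0: "clinear f \<Longrightarrow> f 0 = 0"
  by (rule complex_vector_pair.linear_0)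

lemma clinear_diff: "clinear f \<Longrightarrow> f (x - y) = f x - f y"
  by (rule complex_vector_pair.linear_diff)

lemma clinear_sum: "clinear f \<Longrightarrow> f (\<Sum>i\<in>I. g i) = (\<Sum>i\<in>I. f (g i))"
  by (rule complex_vector_pair.linear_sum)

lemma clinear_functional_scaleC: "clinear \<phi> \<Longrightarrow> \<phi> (c *\<^sub>C x) = c * \<phi> x" for \<phi> :: "'a::complex_vector \<Rightarrow> complex"
  by (simp add: clinear_scaleC scaleC_complex_def)

text \<open>A nonzero vector is an independent set, so a functional with value 1 on it exists in any
  dimension. This yields the uniqueness behind the description of
  \<open>operator_fun\<close>.\<close>

lemma clinear_functionals_separate:
  fixes x y :: "'a::complex_vector"
  assumes "\<And>\<phi> :: 'a \<Rightarrow> complex. clinear \<phi> \<Longrightarrow> \<phi> x = \<phi> y"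
  shows "x = y"
proof (rule ccontr)
  assume "x \<noteq> y"
  then have "\<not> cdependent {x - y}"
    by (simp add: complex_vector.dependent_single)
  then obtain \<phi> :: "'a \<Rightarrow> complex" where "clinear \<phi>" "\<phi> (x - y) = 1"
    using complex_vector_pair.linear_independent_extend[of "{x - y}" "\<lambda>_. 1"] by auto
  with assms[of \<phi>] show False
    by (simp add: clinear_diff)
qed

lemma sum_scaleC: "(\<Sum>i\<in>I. c i) *\<^sub>C x = (\<Sum>i\<in>I. c i *\<^sub>C x)"
  by (rule complex_vector.scale_sum_left)

lemma in_cspan_image_lessThan:
  "y \<in> cspan (f ` {..<n}) \<Longrightarrow> \<exists>u. y = (\<Sum>i<n. u i *\<^sub>C f i)" for f :: "nat \<Rightarrow> 'a::complex_vector"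
proof (induction n arbitrary: y)
  case 0
  then show ?case by simp
next
  case (Suc n)
  then have "y \<in> cspan (insert (f n) (f ` {..<n}))"
    by (simp add: lessThan_Suc)
  then obtain k where "y - k *\<^sub>C f n \<in> cspan (f ` {..<n})"
    unfolding complex_vector.span_breakdown_eq by blast
  then obtain u where "y - k *\<^sub>C f n = (\<Sum>i<n. u i *\<^sub>C f i)"
    using Suc.IH by blast
  then have "y = (\<Sum>i<n. u i *\<^sub>C f i) + k *\<^sub>C f n"
    by (simp add: algebra_simps)
  also have "\<dots> = (\<Sum>i<Suc n. (u(n := k)) i *\<^sub>C f i)"
    by simp
  finally show ?case by blast
qed

lemma finite_dimensional_subspace:
  fixes V :: "'a::complex_vector set"
  assumes "finite_dimensional (UNIV :: 'a set)" and "module.subspace scaleC V"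
  shows "finite_dimensional V"
proof -
  obtain S :: "'a set" where S: "finite S" "cspan S = UNIV"
    using assms(1) by (auto simp: finite_dimensional_def)
  obtain B where B: "B \<subseteq> V" "\<not> cdependent B" "V \<subseteq> cspan B"
    using complex_vector.maximal_independent_subset by blast
  have "finite B"
    using complex_vector.independent_span_bound[OF S(1) B(2)] S(2) by simp
  moreover have "cspan B = V"
    using B complex_vector.span_minimal[OF B(1) assms(2)] by auto
  ultimately show ?thesis
    by (auto simp: finite_dimensional_def)
qed

section \<open>Annihilating polynomials and the resolvent\<close>

definition poly_action :: "('a \<Rightarrow> 'a) \<Rightarrow> complex poly \<Rightarrow> 'a \<Rightarrow> 'a::complex_vector"
  where "poly_action A p x = (\<Sum>i\<le>degree p. coeff p i *\<^sub>C (A ^^ i) x)"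

lemma poly_action_eq:
  assumes "degree p \<le> n"
  shows "poly_action A p x = (\<Sum>i\<le>n. coeff p i *\<^sub>C (A ^^ i) x)"
  unfolding poly_action_def
  by (rule sum.mono_neutral_left) (use assms in \<open>auto simp: coeff_eq_0\<close>)

lemma poly_action_0 [simp]: "poly_action A 0 x = 0"
  by (simp add: poly_action_def)

lemma poly_action_add: "poly_action A (p + q) x = poly_action A p x + poly_action A q x"
proof -
  let ?n = "max (degree p) (degree q)"
  have "poly_action A (p + q) x = (\<Sum>i\<le>?n. coeff (p + q) i *\<^sub>C (A ^^ i) x)"
    by (rule poly_action_eq) (rule degree_add_le_max)
  also have "\<dots> = (\<Sum>i\<le>?n. coeff p i *\<^sub>C (A ^^ i) x) + (\<Sum>i\<le>?n. coeff q i *\<^sub>C (A ^^ i) x)"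
    by (simp add: scaleC_add_left sum.distrib)
  also have "\<dots> = poly_action A p x + poly_action A q x"
    by (simp add: poly_action_eq[of p ?n] poly_action_eq[of q ?n])
  finally show ?thesis .
qed

lemma poly_action_smult: "poly_action A (smult c p) x = c *\<^sub>C poly_action A p x"
  by (subst poly_action_eq[of _ "degree p"])
     (auto simp: poly_action_def complex_vector.scale_sum_right degree_smult_le)

lemma poly_action_pCons:
  assumes "clinear A"
  shows "poly_action A (pCons c p) x = c *\<^sub>C x + A (poly_action A p x)"
proof -
  have "poly_action A (pCons c p) x = (\<Sum>i\<le>Suc (degree p). coeff (pCons c p) i *\<^sub>C (A ^^ i) x)"
    by (rule poly_action_eq) (rule degree_pCons_le)
  also have "\<dots> = c *\<^sub>C x + (\<Sum>i\<le>degree p. coeff p i *\<^sub>C (A ^^ Suc i) x)"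
    by (subst sum.atMost_Suc_shift) simp
  also have "(\<Sum>i\<le>degree p. coeff p i *\<^sub>C (A ^^ Suc i) x) = A (poly_action A p x)"
    by (simp add: poly_action_def clinear_sum[OF assms] clinear_scaleC[OF assms])
  finally show ?thesis .
qed

lemma poly_action_mult:
  assumes "clinear A"
  shows "poly_action A (p * q) x = poly_action A p (poly_action A q x)"
proof (induction p)
  case (pCons c p)
  then show ?case
    using assms by (simp add: poly_action_add poly_action_smult poly_action_pCons)
qed simp

lemma clinear_poly_action:
  assumes "clinear A"
  shows "clinear (poly_action A p)"
proof (induction p)
  case 0
  then show ?case by (simp add: clinear_iff)
next
  case (pCons c p)
  then show ?case
    using assms unfolding clinear_iff
    by (simp add: poly_action_pCons assms scaleC_add_right scaleC_scaleC mult.commute algebra_simps)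
qed

lemma poly_action_eigenvector:
  assumes "clinear A" "A x = \<nu> *\<^sub>C x"
  shows "poly_action A p x = poly p \<nu> *\<^sub>C x"
proof (induction p)
  case (pCons c p)
  then show ?case
    using assms by (simp add: poly_action_pCons clinear_scaleC scaleC_add_left scaleC_scaleC mult.commute)
qed simp

text \<open>Each coefficient of (p(t) - p(w))/(t - w) in t is a polynomial in w of lower degree than
  p. After division by p(w) it tends to 0 at infinity, which is how the resolvent is controlled for
  large w.\<close>

lemma coeff_synthetic_div:
  "\<exists>r. (r = 0 \<or> degree r < degree p) \<and> (\<forall>w. coeff (synthetic_div p w) i = poly r w)"
  for p :: "complex poly"
proof (induction p arbitrary: i)
  case 0
  then show ?case by (auto intro!: exI[of _ 0])
next
  case (pCons c p)
  show ?case
  proof (cases i)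
    case 0
    then show ?thesis
      using pCons.hyps by (intro exI[of _ p]) (cases "p = 0"; simp)
  next
    case (Suc j)
    obtain r where "r = 0 \<or> degree r < degree p" "\<forall>w. coeff (synthetic_div p w) j = poly r w"
      using pCons.IH by blast
    then show ?thesis
      using Suc by (intro exI[of _ r]) (auto split: if_splits)
  qed
qed

locale finite_operator =
  fixes V :: "'a::complex_vector set" and A :: "'a \<Rightarrow> 'a"
  assumes fin: "finite_dimensional V" and A: "clinear A" and inv: "x \<in> V \<Longrightarrow> A x \<in> V"
begin

lemma subspace: "module.subspace scaleC V"
  using fin by (metis finite_dimensional_def complex_vector.subspace_span)

lemma poly_action_in_V: "x \<in> V \<Longrightarrow> poly_action A p x \<in> V"
proof (induction p)
  case 0
  then show ?case
    by (simp add: complex_vector.subspace_0[OF subspace])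
next
  case (pCons c p)
  then show ?case
    by (auto simp: poly_action_pCons[OF A] intro!: complex_vector.subspace_add[OF subspace]
        complex_vector.subspace_scale[OF subspace] inv)
qed

lemma funpow_in_V: "x \<in> V \<Longrightarrow> (A ^^ i) x \<in> V"
  by (induction i) (auto intro: inv)

text \<open>Some power of A applied to x is a combination of the lower ones, since otherwise the
  first \<open>card S + 1\<close> of them would be independent in the span of S. The resulting
  polynomial is monic, hence nonzero.\<close>

lemma ex_annihilator:
  assumes x: "x \<in> V"
  shows "\<exists>p. p \<noteq> 0 \<and> poly_action A p x = 0"
proof -
  define f where "f i = (A ^^ i) x" for i
  obtain S where S: "finite S" "cspan S = V"
    using fin by (auto simp: finite_dimensional_def)
  have "\<exists>n. f n \<in> cspan (f ` {..<n})"
  proof (rule ccontr)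
    assume *: "\<nexists>n. f n \<in> cspan (f ` {..<n})"
    have "\<not> cdependent (f ` {..<n}) \<and> card (f ` {..<n}) = n" for n
    proof (induction n)
      case 0
      then show ?case by (simp add: complex_vector.independent_empty)
    next
      case (Suc n)
      have n: "f n \<notin> cspan (f ` {..<n})"
        using * by blast
      then have "f n \<notin> f ` {..<n}"
        using complex_vector.span_base[of "f n" "f ` {..<n}"] by blast
      then show ?case
        using Suc n by (simp add: lessThan_Suc complex_vector.independent_insert)
    qed
    note indep = this[of "Suc (card S)"]
    have "f ` {..<Suc (card S)} \<subseteq> cspan S"
      unfolding S(2) f_def using funpow_in_V[OF x] by auto
    then have "card (f ` {..<Suc (card S)}) \<le> card S"
      using complex_vector.independent_span_bound[OF S(1)] indep by blast
    then show False
      using indep by simp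
  qed
  then obtain n u where u: "f n = (\<Sum>i<n. u i *\<^sub>C f i)"
    using in_cspan_image_lessThan by blast
  define p where "p = monom 1 n - (\<Sum>i<n. monom (u i) i)"
  have coeff: "coeff p i = (if i = n then 1 else if i < n then - u i else 0)" for i
    by (auto simp: p_def coeff_sum)
  have "p \<noteq> 0"
    using coeff[of n] by auto
  have "degree p \<le> n"
    by (rule degree_le) (simp add: coeff)
  then have "poly_action A p x = (\<Sum>i\<le>n. coeff p i *\<^sub>C f i)"
    unfolding f_def by (rule poly_action_eq)
  then have "poly_action A p x = f n + (\<Sum>i<n. coeff p i *\<^sub>C f i)"
    by (simp add: coeff scaleC_one add.commute flip: lessThan_Suc_atMost)
  also have "(\<Sum>i<n. coeff p i *\<^sub>C f i) = - (\<Sum>i<n. u i *\<^sub>C f i)"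
    unfolding sum_negf[symmetric] by (intro sum.cong) (auto simp: coeff)
  finally show ?thesis
    using u \<open>p \<noteq> 0\<close> by auto
qed

text \<open>If a root c is not an eigenvalue, then A - c is injective on V and the factor t - c can
  be cancelled. The descent on the degree stops when only eigenvalues are left as roots.\<close>

lemma ex_annihilator_spectrum:
  assumes x: "x \<in> V"
  shows "\<exists>p. p \<noteq> 0 \<and> poly_action A p x = 0 \<and> (\<forall>c. poly p c = 0 \<longrightarrow> c \<in> spectrum_on V A)"
proof -
  obtain p where "p \<noteq> 0" "poly_action A p x = 0"
    using ex_annihilator[OF x] by blast
  then show ?thesis
  proof (induction "degree p" arbitrary: p rule: less_induct)
    case less
    show ?case
    proof (cases "\<forall>c. poly p c = 0 \<longrightarrow> c \<in> spectrum_on V A")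
      case False
      then obtain c where c: "poly p c = 0" "c \<notin> spectrum_on V A"
        by blast
      then obtain q where q: "p = [:- c, 1:] * q"
        by (auto simp: poly_eq_0_iff_dvd)
      with less have "q \<noteq> 0" by auto
      then have "degree q < degree p"
        unfolding q by (subst degree_mult_eq) auto
      have "poly_action A q x = 0"
      proof (rule ccontr)
        assume "poly_action A q x \<noteq> 0"
        moreover have "A (poly_action A q x) = c *\<^sub>C poly_action A q x"
          using less(3) unfolding q poly_action_mult[OF A]
          by (simp add: poly_action_pCons[OF A] clinear_0[OF A] scaleC_one)
        ultimately show False
          using c(2) poly_action_in_V[OF x] by (auto simp: spectrum_on_def)
      qed
      then show ?thesis
        using less(1)[OF \<open>degree q < degree p\<close> \<open>q \<noteq> 0\<close>] by blast
    qed (use less in blast)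
  qed
qed

text \<open>A substitute for the minimal polynomial: a product of annihilators of the vectors of a
  finite spanning set. It has exactly the eigenvalues as roots, which gives both finiteness of the
  spectrum and an explicit resolvent.\<close>

lemma ex_annihilating_poly:
  "\<exists>P. P \<noteq> 0 \<and> (\<forall>x\<in>V. poly_action A P x = 0) \<and> (\<forall>c. poly P c = 0 \<longleftrightarrow> c \<in> spectrum_on V A)"
proof -
  obtain S where S: "finite S" "cspan S = V"
    using fin by (auto simp: finite_dimensional_def)
  have "finite S \<Longrightarrow> S \<subseteq> V \<Longrightarrow>
    \<exists>P. P \<noteq> 0 \<and> (\<forall>x\<in>S. poly_action A P x = 0) \<and> (\<forall>c. poly P c = 0 \<longrightarrow> c \<in> spectrum_on V A)"
  proof (induction S rule: finite_induct)
    case empty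
    show ?case by (rule exI[of _ 1]) simp
  next
    case (insert x S)
    then obtain P where P: "P \<noteq> 0" "\<forall>x\<in>S. poly_action A P x = 0" "\<forall>c. poly P c = 0 \<longrightarrow> c \<in> spectrum_on V A"
      by auto
    obtain p where p: "p \<noteq> 0" "poly_action A p x = 0" "\<forall>c. poly p c = 0 \<longrightarrow> c \<in> spectrum_on V A"
      using ex_annihilator_spectrum insert.prems by blast
    have zero: "poly_action A r 0 = 0" for r
      using clinear_0[OF clinear_poly_action[OF A]] .
    have "poly_action A (P * p) y = 0" if "y \<in> insert x S" for y
    proof (cases "y = x")
      case True
      then show ?thesis
        using p(2) by (simp add: poly_action_mult[OF A] zero)
    next
      case False
      then have "poly_action A (p * P) y = 0"
        using P(2) that by (simp add: poly_action_mult[OF A] zero)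
      then show ?thesis
        by (simp add: mult.commute)
    qed
    then show ?case
      using P p by (intro exI[of _ "P * p"]) auto
  qed
  then obtain P where P: "P \<noteq> 0" "\<forall>x\<in>S. poly_action A P x = 0" "\<forall>c. poly P c = 0 \<longrightarrow> c \<in> spectrum_on V A"
    using S complex_vector.span_superset by metis
  have kernel: "poly_action A P x = 0" if "x \<in> V" for x
    using that P(2) complex_vector_pair.linear_eq_0_on_span[OF clinear_poly_action[OF A], of S] S(2) by auto
  moreover have "poly P c = 0" if "c \<in> spectrum_on V A" for c
  proof -
    from that obtain x where x: "x \<in> V" "x \<noteq> 0" "A x = c *\<^sub>C x"
      by (auto simp: spectrum_on_def)
    then show ?thesis
      using poly_action_eigenvector[OF A x(3), of P] kernel by simp
  qed
  ultimately show ?thesis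
    using P by blast
qed

lemma finite_spectrum: "finite (spectrum_on V A)"
proof -
  obtain P where "P \<noteq> 0" "\<forall>c. poly P c = 0 \<longleftrightarrow> c \<in> spectrum_on V A"
    using ex_annihilating_poly by blast
  then show ?thesis
    using poly_roots_finite[of P] by simp
qed

lemma resolvent_on_unique:
  assumes w: "w \<notin> spectrum_on V A" and y: "y \<in> V" "w *\<^sub>C y - A y = x"
  shows "resolvent_on V A w x = y"
proof -
  have "inj_on (\<lambda>y. w *\<^sub>C y - A y) V"
  proof (rule inj_onI)
    fix y y' assume yy: "y \<in> V" "y' \<in> V" "w *\<^sub>C y - A y = w *\<^sub>C y' - A y'"
    then have "A (y - y') = w *\<^sub>C (y - y')"
      by (simp add: clinear_diff[OF A] complex_vector.scale_right_diff_distrib algebra_simps)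
    moreover have "y - y' \<in> V"
      using yy complex_vector.subspace_diff[OF subspace] by blast
    ultimately have "y - y' = 0"
      using w unfolding spectrum_on_def by blast
    then show "y = y'" by simp
  qed
  from inv_into_f_f[OF this y(1)] show ?thesis
    unfolding resolvent_on_def y(2) .
qed

text \<open>Inserting A into P(t) = (t - w) s(t) + P(w), with s the synthetic quotient, gives (w -
  A) s(A) x = P(w) x, and P(w) is nonzero off the spectrum.\<close>

lemma resolvent_on_eq:
  assumes P: "\<forall>x\<in>V. poly_action A P x = 0" "\<forall>c. poly P c = 0 \<longleftrightarrow> c \<in> spectrum_on V A"
    and w: "w \<notin> spectrum_on V A" and x: "x \<in> V"
  shows "resolvent_on V A w x = (1 / poly P w) *\<^sub>C poly_action A (synthetic_div P w) x"
    and "resolvent_on V A w x \<in> V" "w *\<^sub>C resolvent_on V A w x - A (resolvent_on V A w x) = x"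
proof -
  let ?y = "poly_action A (synthetic_div P w) x"
  have nz: "poly P w \<noteq> 0"
    using P w by blast
  have 1: "(1 / poly P w) *\<^sub>C ?y \<in> V"
    using poly_action_in_V[OF x] complex_vector.subspace_scale[OF subspace] by blast
  have "poly_action A ([:- w, 1:] * synthetic_div P w + [:poly P w:]) x = 0"
    using P(1) x by (simp only: synthetic_div_correct')
  then have "- (w *\<^sub>C ?y) + A ?y + poly P w *\<^sub>C x = 0"
    by (simp only: poly_action_add poly_action_mult[OF A])
       (simp add: poly_action_pCons[OF A] clinear_0[OF A] scaleC_one)
  then have "w *\<^sub>C ?y - A ?y = poly P w *\<^sub>C x"
    by (simp add: algebra_simps add_eq_0_iff)
  then have "(1 / poly P w) *\<^sub>C (w *\<^sub>C ?y - A ?y) = (1 / poly P w) *\<^sub>C poly P w *\<^sub>C x"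
    by simp
  then have 2: "w *\<^sub>C (1 / poly P w) *\<^sub>C ?y - A ((1 / poly P w) *\<^sub>C ?y) = x"
    using nz by (simp add: clinear_scaleC[OF A] scaleC_scaleC scaleC_one complex_vector.scale_right_diff_distrib mult.commute)
  show 3: "resolvent_on V A w x = (1 / poly P w) *\<^sub>C poly_action A (synthetic_div P w) x"
    by (rule resolvent_on_unique[OF w 1 2])
  show "resolvent_on V A w x \<in> V" "w *\<^sub>C resolvent_on V A w x - A (resolvent_on V A w x) = x"
    unfolding 3 by (fact 1 2)+
qed

lemma resolvent_on:
  assumes "w \<notin> spectrum_on V A" and "x \<in> V"
  shows "resolvent_on V A w x \<in> V" "w *\<^sub>C resolvent_on V A w x - A (resolvent_on V A w x) = x"
  using ex_annihilating_poly resolvent_on_eq(2,3) assms by metis+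

lemma resolvent_on_lincomb:
  assumes w: "w \<notin> spectrum_on V A" and x: "x \<in> V" "y \<in> V"
  shows "resolvent_on V A w (c *\<^sub>C x + y) = c *\<^sub>C resolvent_on V A w x + resolvent_on V A w y"
proof (rule resolvent_on_unique[OF w])
  show "c *\<^sub>C resolvent_on V A w x + resolvent_on V A w y \<in> V"
    by (intro complex_vector.subspace_add complex_vector.subspace_scale subspace resolvent_on w x)
  have "w *\<^sub>C (c *\<^sub>C resolvent_on V A w x + resolvent_on V A w y) - A (c *\<^sub>C resolvent_on V A w x + resolvent_on V A w y)
    = c *\<^sub>C (w *\<^sub>C resolvent_on V A w x - A (resolvent_on V A w x)) + (w *\<^sub>C resolvent_on V A w y - A (resolvent_on V A w y))"
    by (simp add: clinear_add[OF A] clinear_scaleC[OF A] scaleC_add_right scaleC_scaleC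
        complex_vector.scale_right_diff_distrib mult.commute)
  then show "w *\<^sub>C (c *\<^sub>C resolvent_on V A w x + resolvent_on V A w y) - A (c *\<^sub>C resolvent_on V A w x + resolvent_on V A w y)
    = c *\<^sub>C x + y"
    using resolvent_on(2)[OF w x(1)] resolvent_on(2)[OF w x(2)] by simp
qed

lemma resolvent_on_commute:
  assumes w: "w \<notin> spectrum_on V A" and x: "x \<in> V"
  shows "resolvent_on V A w (A x) = A (resolvent_on V A w x)"
proof (rule resolvent_on_unique[OF w])
  show "A (resolvent_on V A w x) \<in> V"
    by (intro inv resolvent_on w x)
  have "w *\<^sub>C A (resolvent_on V A w x) - A (A (resolvent_on V A w x)) = A (w *\<^sub>C resolvent_on V A w x - A (resolvent_on V A w x))"
    by (simp add: clinear_diff[OF A] clinear_scaleC[OF A])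
  then show "w *\<^sub>C A (resolvent_on V A w x) - A (A (resolvent_on V A w x)) = A x"
    using resolvent_on(2)[OF w x] by simp
qed

end

section \<open>Circles around the spectrum and sums of residues\<close>

definition valid_radius :: "(complex \<Rightarrow> complex) \<Rightarrow> complex set \<Rightarrow> real \<Rightarrow> bool"
  where "valid_radius H \<Lambda> r \<longleftrightarrow> r > 0 \<and> (\<forall>\<nu>\<in>\<Lambda>. H analytic_on cball \<nu> r \<and> cball \<nu> r \<inter> \<Lambda> = {\<nu>})"

lemma ex_valid_radius:
  assumes "finite \<Lambda>" "open D" "\<Lambda> \<subseteq> D"
  shows "\<exists>r>0. \<forall>\<nu>\<in>\<Lambda>. cball \<nu> r \<subseteq> D \<and> cball \<nu> r \<inter> \<Lambda> = {\<nu>}"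
proof -
  have "\<exists>r>0. cball \<nu> r \<subseteq> D - (\<Lambda> - {\<nu>})" if "\<nu> \<in> \<Lambda>" for \<nu>
  proof -
    have "open (D - (\<Lambda> - {\<nu>}))"
      using assms by (intro open_Diff finite_imp_closed) auto
    from open_contains_cball_eq[OF this] show ?thesis
      using that assms(3) by blast
  qed
  then obtain \<rho> where \<rho>: "\<And>\<nu>. \<nu> \<in> \<Lambda> \<Longrightarrow> \<rho> \<nu> > 0 \<and> cball \<nu> (\<rho> \<nu>) \<subseteq> D - (\<Lambda> - {\<nu>})"
    by metis
  \<comment> \<open>The element 1 keeps the set nonempty when the spectrum is empty, as happens for
    the zero space.\<close>
  define r where "r = Min (insert 1 (\<rho> ` \<Lambda>))"
  have "r > 0"
    unfolding r_def using assms(1) \<rho> by (subst Min_gr_iff) auto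
  moreover have "cball \<nu> r \<subseteq> D \<and> cball \<nu> r \<inter> \<Lambda> = {\<nu>}" if "\<nu> \<in> \<Lambda>" for \<nu>
  proof -
    have "r \<le> \<rho> \<nu>"
      unfolding r_def using assms(1) that by (intro Min_le) auto
    then have "cball \<nu> r \<subseteq> D - (\<Lambda> - {\<nu>})"
      using \<rho>[OF that] subset_cball by blast
    moreover have "\<nu> \<in> cball \<nu> r"
      using \<open>r > 0\<close> by simp
    ultimately show ?thesis
      using that by blast
  qed
  ultimately show ?thesis
    by blast
qed

lemma contour_radius_valid:
  assumes "finite \<Lambda>" "H analytic_on \<Lambda>"
  shows "valid_radius H \<Lambda> (contour_radius H \<Lambda>)"
proof -
  obtain D where D: "open D" "\<Lambda> \<subseteq> D" "H holomorphic_on D"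
    using assms(2) by (auto simp: analytic_on_holomorphic)
  obtain r where "r > 0" "\<forall>\<nu>\<in>\<Lambda>. cball \<nu> r \<subseteq> D \<and> cball \<nu> r \<inter> \<Lambda> = {\<nu>}"
    using ex_valid_radius[OF assms(1) D(1,2)] by blast
  then have "\<exists>r. valid_radius H \<Lambda> r"
    unfolding valid_radius_def analytic_on_holomorphic using D by blast
  then show ?thesis
    unfolding contour_radius_def valid_radius_def by (rule someI_ex)
qed

context finite_operator
begin

abbreviation spectrum :: "complex set"
  where "spectrum \<equiv> spectrum_on V A"

definition resolvent_functional :: "('a \<Rightarrow> complex) \<Rightarrow> 'a \<Rightarrow> complex \<Rightarrow> complex"
  where "resolvent_functional \<phi> x w = \<phi> (resolvent_on V A w x)"

definition cauchy_sum :: "real \<Rightarrow> (complex \<Rightarrow> complex) \<Rightarrow> (complex \<Rightarrow> complex) \<Rightarrow> complex"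
  where "cauchy_sum r H g = 1 / (2 * of_real pi * \<i>) *
    (\<Sum>\<nu>\<in>spectrum. contour_integral (circlepath \<nu> r) (\<lambda>w. H w * g w))"

text \<open>The rational functions \<open>\<rho> i\<close> are fixed before \<open>\<phi>\<close>.
  This uniformity turns the scalar integrals, one for each functional, into the coordinates of an
  actual vector.\<close>

lemma resolvent_functional_expansion:
  assumes x: "x \<in> V"
  obtains n \<rho> where "\<And>i. \<rho> i holomorphic_on - spectrum" "\<And>i. (\<rho> i \<longlongrightarrow> 0) at_infinity"
    "\<And>\<phi> w. clinear \<phi> \<Longrightarrow> w \<notin> spectrum \<Longrightarrow> resolvent_functional \<phi> x w = (\<Sum>i\<le>n. \<rho> i w * \<phi> ((A ^^ i) x))"
proof -
  obtain P where P: "P \<noteq> 0" "\<forall>x\<in>V. poly_action A P x = 0" "\<forall>c. poly P c = 0 \<longleftrightarrow> c \<in> spectrum"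
    using ex_annihilating_poly by blast
  have "\<forall>i. \<exists>r. (r = 0 \<or> degree r < degree P) \<and> (\<forall>w. coeff (synthetic_div P w) i = poly r w)"
    using coeff_synthetic_div by blast
  then obtain r where r: "\<And>i. r i = 0 \<or> degree (r i) < degree P"
    "\<And>i w. coeff (synthetic_div P w) i = poly (r i) w"
    by metis
  define \<rho> where "\<rho> i w = poly (r i) w / poly P w" for i w
  show thesis
  proof (rule that)
    show "\<rho> i holomorphic_on - spectrum" for i
      unfolding \<rho>_def using P(3) by (intro holomorphic_intros) auto
    show "(\<rho> i \<longlongrightarrow> 0) at_infinity" for i
      using r(1)[of i] unfolding \<rho>_def by (auto intro: poly_divide_tendsto_0_at_infinity)
    fix \<phi> :: "'a \<Rightarrow> complex" and w assume \<phi>: "clinear \<phi>" and w: "w \<notin> spectrum"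
    have "poly_action A (synthetic_div P w) x = (\<Sum>i\<le>degree P. coeff (synthetic_div P w) i *\<^sub>C (A ^^ i) x)"
      by (rule poly_action_eq) (simp add: degree_synthetic_div)
    then show "resolvent_functional \<phi> x w = (\<Sum>i\<le>degree P. \<rho> i w * \<phi> ((A ^^ i) x))"
      unfolding resolvent_functional_def resolvent_on_eq(1)[OF P(2,3) w x] \<rho>_def
      by (simp add: clinear_functional_scaleC[OF \<phi>] clinear_sum[OF \<phi>] r(2) sum_distrib_left mult_ac)
  qed
qed

lemma resolvent_functional_holomorphic:
  assumes "x \<in> V" "clinear \<phi>"
  shows "resolvent_functional \<phi> x holomorphic_on - spectrum"
proof -
  obtain n \<rho> where \<rho>: "\<And>i. \<rho> i holomorphic_on - spectrum"
    "\<And>\<phi> w. clinear \<phi> \<Longrightarrow> w \<notin> spectrum \<Longrightarrow> resolvent_functional \<phi> x w = (\<Sum>i\<le>n. \<rho> i w * \<phi> ((A ^^ i) x))"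
    using resolvent_functional_expansion[OF assms(1)] by metis
  have "(\<lambda>w. \<Sum>i\<le>n. \<rho> i w * \<phi> ((A ^^ i) x)) holomorphic_on - spectrum"
    by (intro holomorphic_intros \<rho>(1))
  then show ?thesis
    by (rule holomorphic_transform) (simp add: \<rho>(2)[OF assms(2)])
qed

lemma sphere_avoids_spectrum:
  assumes "valid_radius H spectrum r" "\<nu> \<in> spectrum"
  shows "sphere \<nu> r \<subseteq> - spectrum"
proof
  fix w assume w: "w \<in> sphere \<nu> r"
  have "cball \<nu> r \<inter> spectrum = {\<nu>}" "r > 0"
    using assms by (auto simp: valid_radius_def)
  moreover have "w \<in> cball \<nu> r" "w \<noteq> \<nu>"
    using w \<open>r > 0\<close> by auto
  ultimately show "w \<in> - spectrum"
    by blast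
qed

lemma contour_integrable_on_circle:
  assumes r: "valid_radius H spectrum r" and \<nu>: "\<nu> \<in> spectrum" and g: "g holomorphic_on - spectrum"
  shows "(\<lambda>w. H w * g w) contour_integrable_on circlepath \<nu> r"
proof -
  have "r > 0"
    using r by (simp add: valid_radius_def)
  have "H holomorphic_on cball \<nu> r"
    using r \<nu> by (auto simp: valid_radius_def analytic_imp_holomorphic)
  then have "continuous_on (sphere \<nu> r) H"
    using holomorphic_on_imp_continuous_on continuous_on_subset sphere_cball by blast
  moreover have "continuous_on (sphere \<nu> r) g"
    using holomorphic_on_imp_continuous_on[OF g] sphere_avoids_spectrum[OF r \<nu>] by (rule continuous_on_subset)
  ultimately have "continuous_on (path_image (circlepath \<nu> r)) (\<lambda>w. H w * g w)"
    using \<open>r > 0\<close> by (auto intro!: continuous_intros)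
  then show ?thesis
    by (rule contour_integrable_continuous_circlepath)
qed

text \<open>Each circle encloses a single eigenvalue, so its integral is a residue. The right-hand
  side no longer contains r, which makes integrals over circles of different radii
  comparable.\<close>

lemma cauchy_sum_eq_residues:
  assumes r: "valid_radius H spectrum r" and g: "g holomorphic_on - spectrum"
  shows "cauchy_sum r H g = (\<Sum>\<nu>\<in>spectrum. residue (\<lambda>w. H w * g w) \<nu>)"
proof -
  have "contour_integral (circlepath \<nu> r) (\<lambda>w. H w * g w) = 2 * of_real pi * \<i> * residue (\<lambda>w. H w * g w) \<nu>"
    if \<nu>: "\<nu> \<in> spectrum" for \<nu>
  proof -
    have r': "r > 0" "H analytic_on cball \<nu> r" "cball \<nu> r \<inter> spectrum = {\<nu>}"
      using r \<nu> by (auto simp: valid_radius_def)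
    obtain T where T: "open T" "cball \<nu> r \<subseteq> T" "H holomorphic_on T"
      using r'(2) by (auto simp: analytic_on_holomorphic)
    let ?T = "T - (spectrum - {\<nu>})"
    have "open ?T"
      using T(1) finite_spectrum by (intro open_Diff finite_imp_closed) auto
    moreover have "cball \<nu> r \<subseteq> ?T"
      using T(2) r'(3) by blast
    moreover have "(\<lambda>w. H w * g w) holomorphic_on ?T - {\<nu>}"
      by (intro holomorphic_intros holomorphic_on_subset[OF T(3)] holomorphic_on_subset[OF g]) auto
    moreover have "\<nu> \<in> ?T"
      using \<open>cball \<nu> r \<subseteq> ?T\<close> centre_in_cball[of \<nu> r] \<open>r > 0\<close> by (meson less_imp_le subsetD)
    ultimately have "((\<lambda>w. H w * g w) has_contour_integral of_real (2 * pi) * \<i> * residue (\<lambda>w. H w * g w) \<nu>) (circlepath \<nu> r)"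
      using \<open>r > 0\<close> base_residue by blast
    from contour_integral_unique[OF this] show ?thesis
      by simp
  qed
  then show ?thesis
    unfolding cauchy_sum_def by (simp add: sum_distrib_left)
qed

text \<open>Shows that the definite description denotes something and removes the chosen radius from
  it. Uniqueness holds because functionals separate points; existence comes from the explicit vector
  y.\<close>

lemma operator_fun_spec:
  assumes H: "H analytic_on spectrum" and x: "x \<in> V"
  shows "operator_fun V H A x \<in> V"
    and "clinear \<phi> \<Longrightarrow> \<phi> (operator_fun V H A x)
      = (\<Sum>\<nu>\<in>spectrum. residue (\<lambda>w. H w * resolvent_functional \<phi> x w) \<nu>)"
proof -
  define r where "r = contour_radius H spectrum"
  have r: "valid_radius H spectrum r"
    unfolding r_def by (rule contour_radius_valid[OF finite_spectrum H])
  obtain n \<rho> where \<rho>: "\<And>i. \<rho> i holomorphic_on - spectrum"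
    "\<And>\<phi> w. clinear \<phi> \<Longrightarrow> w \<notin> spectrum \<Longrightarrow> resolvent_functional \<phi> x w = (\<Sum>i\<le>n. \<rho> i w * \<phi> ((A ^^ i) x))"
    using resolvent_functional_expansion[OF x] by metis
  \<comment> \<open>The contour integral of H times the resolvent, computed coefficientwise in the
    powers of A; it lies in V because V is invariant.\<close>
  define y where "y = (\<Sum>i\<le>n. cauchy_sum r H (\<rho> i) *\<^sub>C (A ^^ i) x)"
  have y: "\<phi> y = cauchy_sum r H (resolvent_functional \<phi> x)" if \<phi>: "clinear \<phi>" for \<phi>
  proof -
    have "contour_integral (circlepath \<nu> r) (\<lambda>w. H w * resolvent_functional \<phi> x w) =
      (\<Sum>i\<le>n. contour_integral (circlepath \<nu> r) (\<lambda>w. H w * \<rho> i w) * \<phi> ((A ^^ i) x))" if \<nu>: "\<nu> \<in> spectrum" for \<nu>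
    proof -
      have "contour_integral (circlepath \<nu> r) (\<lambda>w. H w * resolvent_functional \<phi> x w) =
        contour_integral (circlepath \<nu> r) (\<lambda>w. \<Sum>i\<le>n. (H w * \<rho> i w) * \<phi> ((A ^^ i) x))"
      proof (rule contour_integral_eq)
        fix w assume "w \<in> path_image (circlepath \<nu> r)"
        then have "w \<notin> spectrum"
          using sphere_avoids_spectrum[OF r \<nu>] r by (auto simp: valid_radius_def)
        then show "H w * resolvent_functional \<phi> x w = (\<Sum>i\<le>n. (H w * \<rho> i w) * \<phi> ((A ^^ i) x))"
          by (simp add: \<rho>(2)[OF \<phi>] sum_distrib_left mult_ac)
      qed
      also have "\<dots> = (\<Sum>i\<le>n. contour_integral (circlepath \<nu> r) (\<lambda>w. (H w * \<rho> i w) * \<phi> ((A ^^ i) x)))"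
        by (intro contour_integral_sum contour_integrable_rmul contour_integrable_on_circle[OF r \<nu>] \<rho>(1)) auto
      also have "\<dots> = (\<Sum>i\<le>n. contour_integral (circlepath \<nu> r) (\<lambda>w. H w * \<rho> i w) * \<phi> ((A ^^ i) x))"
        by (intro sum.cong refl contour_integral_rmul contour_integrable_on_circle[OF r \<nu>] \<rho>(1))
      finally show ?thesis .
    qed
    then have "cauchy_sum r H (resolvent_functional \<phi> x) = (\<Sum>i\<le>n. cauchy_sum r H (\<rho> i) * \<phi> ((A ^^ i) x))"
      unfolding cauchy_sum_def by (simp add: sum_distrib_right sum_distrib_left mult.assoc sum.swap[of _ "{..n}"])
    then show ?thesis
      by (simp add: y_def clinear_sum[OF \<phi>] clinear_functional_scaleC[OF \<phi>])
  qed
  have "y \<in> V"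
    unfolding y_def by (intro complex_vector.subspace_sum[OF subspace] complex_vector.subspace_scale[OF subspace] funpow_in_V x)
  have op: "operator_fun V H A x = y"
    unfolding operator_fun_def
  proof (intro the_equality conjI allI impI)
    show "y \<in> V" by fact
    fix \<phi> :: "'a \<Rightarrow> complex" assume "clinear \<phi>"
    from y[OF this] show "\<phi> y = 1 / (2 * of_real pi * \<i>) * (\<Sum>\<nu>\<in>spectrum.
        contour_integral (circlepath \<nu> (contour_radius H spectrum)) (\<lambda>w. H w * \<phi> (resolvent_on V A w x)))"
      unfolding cauchy_sum_def resolvent_functional_def r_def .
  next
    fix y' assume y': "y' \<in> V \<and> (\<forall>\<phi>. clinear \<phi> \<longrightarrow> \<phi> y' = 1 / (2 * of_real pi * \<i>) * (\<Sum>\<nu>\<in>spectrum.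
        contour_integral (circlepath \<nu> (contour_radius H spectrum)) (\<lambda>w. H w * \<phi> (resolvent_on V A w x))))"
    show "y' = y"
    proof (rule clinear_functionals_separate)
      fix \<phi> :: "'a \<Rightarrow> complex" assume \<phi>: "clinear \<phi>"
      with y' have "\<phi> y' = cauchy_sum r H (resolvent_functional \<phi> x)"
        unfolding cauchy_sum_def resolvent_functional_def r_def by blast
      then show "\<phi> y' = \<phi> y"
        unfolding y[OF \<phi>] .
    qed
  qed
  show "operator_fun V H A x \<in> V"
    unfolding op by (rule \<open>y \<in> V\<close>)
  show "\<phi> (operator_fun V H A x) = (\<Sum>\<nu>\<in>spectrum. residue (\<lambda>w. H w * resolvent_functional \<phi> x w) \<nu>)"
    if "clinear \<phi>"
    unfolding op y[OF that] by (rule cauchy_sum_eq_residues[OF r resolvent_functional_holomorphic[OF x that]])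
qed

text \<open>Any valid radius may replace the chosen one, so several functions can be integrated over
  the same circles.\<close>

lemma operator_fun_cauchy_sum:
  assumes H: "H analytic_on spectrum" and x: "x \<in> V" and \<phi>: "clinear \<phi>" and r: "valid_radius H spectrum r"
  shows "\<phi> (operator_fun V H A x) = cauchy_sum r H (resolvent_functional \<phi> x)"
  unfolding operator_fun_spec(2)[OF H x \<phi>] cauchy_sum_eq_residues[OF r resolvent_functional_holomorphic[OF x \<phi>]] ..

end

lemma has_sum_finite_sum:
  fixes f :: "'b \<Rightarrow> 'i \<Rightarrow> complex"
  assumes "finite S" "\<And>s. s \<in> S \<Longrightarrow> (f s has_sum g s) I"
  shows "((\<lambda>m. \<Sum>s\<in>S. f s m) has_sum (\<Sum>s\<in>S. g s)) I"
  using assms by (induction S rule: finite_induct) (auto intro: has_sum_add)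

context finite_operator
begin

lemma valid_radius_subset:
  assumes "r > 0" "\<forall>\<nu>\<in>spectrum. cball \<nu> r \<subseteq> D \<and> cball \<nu> r \<inter> spectrum = {\<nu>}" "open D" "H holomorphic_on D"
  shows "valid_radius H spectrum r"
  unfolding valid_radius_def analytic_on_holomorphic using assms by blast

lemma resolvent_functional_tendsto_0:
  assumes "x \<in> V" "clinear \<phi>"
  shows "(resolvent_functional \<phi> x \<longlongrightarrow> 0) at_infinity"
proof -
  obtain n \<rho> where \<rho>: "\<And>i. (\<rho> i \<longlongrightarrow> 0) at_infinity"
    "\<And>\<phi> w. clinear \<phi> \<Longrightarrow> w \<notin> spectrum \<Longrightarrow> resolvent_functional \<phi> x w = (\<Sum>i\<le>n. \<rho> i w * \<phi> ((A ^^ i) x))"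
    using resolvent_functional_expansion[OF assms(1)] by metis
  have "((\<lambda>w. \<Sum>i\<le>n. \<rho> i w * \<phi> ((A ^^ i) x)) \<longlongrightarrow> (\<Sum>i\<le>n. 0 * \<phi> ((A ^^ i) x))) at_infinity"
    by (intro tendsto_intros \<rho>(1))
  moreover have "\<forall>\<^sub>F w in at_infinity. (\<Sum>i\<le>n. \<rho> i w * \<phi> ((A ^^ i) x)) = resolvent_functional \<phi> x w"
  proof -
    obtain R where R: "\<And>\<nu>. \<nu> \<in> spectrum \<Longrightarrow> norm \<nu> \<le> R"
      using finite_imp_bounded[OF finite_spectrum] by (auto simp: bounded_iff)
    have "\<forall>\<^sub>F w in at_infinity. w \<notin> spectrum"
      unfolding eventually_at_infinity using R by (intro exI[of _ "R + 1"]) fastforce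
    then show ?thesis
      by eventually_elim (simp add: \<rho>(2)[OF assms(2)])
  qed
  ultimately show ?thesis
    by (auto intro: Lim_transform_eventually)
qed

text \<open>Moving the contour to a large circle, where the resolvent is \<open>1 / w\<close> up to lower order.\<close>

lemma residue_sum_resolvent:
  assumes x: "x \<in> V" and \<phi>: "clinear \<phi>"
  shows "(\<Sum>\<nu>\<in>spectrum. residue (resolvent_functional \<phi> x) \<nu>) = \<phi> x"
proof -
  let ?g = "resolvent_functional \<phi> x" and ?h = "resolvent_functional \<phi> (A x)"
  let ?S = "\<Sum>\<nu>\<in>spectrum. residue ?g \<nu>"
  obtain R0 where R0: "\<And>\<nu>. \<nu> \<in> spectrum \<Longrightarrow> norm \<nu> \<le> R0"
    using finite_imp_bounded[OF finite_spectrum] by (auto simp: bounded_iff)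
  have "norm (?S - \<phi> x) \<le> e" if e: "e > 0" for e
  proof -
    have "\<forall>\<^sub>F w in at_infinity. dist (?h w) 0 < e"
      using resolvent_functional_tendsto_0[OF inv[OF x] \<phi>] e by (rule tendstoD)
    then obtain R1 where R1: "\<And>w. norm w \<ge> R1 \<Longrightarrow> norm (?h w) < e"
      by (auto simp: eventually_at_infinity)
    \<comment> \<open>The circle must enclose the whole spectrum, lie in the region where the
      resolvent functional of A x is below e, and have positive radius.\<close>
    define R where "R = max 1 (max (R0 + 1) R1)"
    have R: "R > 0" "R > R0" "R \<ge> R1"
      by (auto simp: R_def)
    have w: "w \<notin> spectrum" "w \<noteq> 0" "norm w = R" if "w \<in> sphere 0 R" for w
      using that R R0[of w] by auto
    have "contour_integral (circlepath 0 R) ?g =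
      of_real (2 * pi) * \<i> * (\<Sum>\<nu>\<in>spectrum. winding_number (circlepath 0 R) \<nu> * residue ?g \<nu>)"
      using finite_spectrum resolvent_functional_holomorphic[OF x \<phi>] R w
      by (intro Residue_theorem[of UNIV]) (auto simp: Compl_eq_Diff_UNIV)
    also have "(\<Sum>\<nu>\<in>spectrum. winding_number (circlepath 0 R) \<nu> * residue ?g \<nu>) = ?S"
    proof (rule sum.cong[OF refl])
      fix \<nu> assume "\<nu> \<in> spectrum"
      then have "norm (\<nu> - 0) < R"
        using R R0 by force
      then show "winding_number (circlepath 0 R) \<nu> * residue ?g \<nu> = residue ?g \<nu>"
        by (simp only: winding_number_circlepath mult_1)
    qed
    finally have 1: "contour_integral (circlepath 0 R) ?g = 2 * of_real pi * \<i> * ?S"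
      by simp
    \<comment> \<open>From (w - A) R(w) x = x and the commutation of R(w) with A one gets R(w) x =
      x/w + R(w) A x / w. The first term gives the main part; the second is of size at most e/R on a
      circle of length 2 pi R.\<close>
    have 2: "?g w = \<phi> x / w + ?h w / w" if "w \<in> sphere 0 R" for w
    proof -
      have "\<phi> (w *\<^sub>C resolvent_on V A w x - A (resolvent_on V A w x)) = \<phi> x"
        using resolvent_on(2)[OF w(1)[OF that] x] by simp
      then have "w * ?g w - ?h w = \<phi> x"
        by (simp add: resolvent_functional_def resolvent_on_commute[OF w(1)[OF that] x] clinear_diff[OF \<phi>]
            clinear_functional_scaleC[OF \<phi>])
      then show ?thesis
        using w(2)[OF that] by (simp add: field_simps)
    qed
    have i1: "((\<lambda>w. \<phi> x / w) has_contour_integral 2 * of_real pi * \<i> * \<phi> x) (circlepath 0 R)"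
      using Cauchy_integral_circlepath_simple[of "\<lambda>_. \<phi> x" 0 R 0] R by auto
    have cont: "continuous_on (path_image (circlepath 0 R)) (\<lambda>w. ?h w / w)"
      using R w holomorphic_on_imp_continuous_on[OF resolvent_functional_holomorphic[OF inv[OF x] \<phi>]]
      by (auto intro!: continuous_intros elim: continuous_on_subset)
    define I where "I = contour_integral (circlepath 0 R) (\<lambda>w. ?h w / w)"
    have i2: "((\<lambda>w. ?h w / w) has_contour_integral I) (circlepath 0 R)"
      unfolding I_def by (intro has_contour_integral_integral contour_integrable_continuous_circlepath cont)
    have "norm I \<le> (e / R) * (2 * pi * R)"
    proof (rule has_contour_integral_bound_circlepath[OF i2])
      fix w :: complex assume "norm (w - 0) = R"
      then have "w \<in> sphere 0 R" by simp
      then show "norm (?h w / w) \<le> e / R"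
        using R1[of w] R w(3) by (auto simp: norm_divide intro!: divide_right_mono)
    qed (use e R in auto)
    then have I: "norm I \<le> 2 * pi * e"
      using R by (simp add: mult_ac)
    have "contour_integral (circlepath 0 R) ?g = contour_integral (circlepath 0 R) (\<lambda>w. \<phi> x / w + ?h w / w)"
      using 2 R by (intro contour_integral_eq) auto
    also have "\<dots> = 2 * of_real pi * \<i> * \<phi> x + I"
      using has_contour_integral_add[OF i1 i2] by (rule contour_integral_unique)
    finally have "2 * of_real pi * \<i> * (?S - \<phi> x) = I"
      using 1 by (simp add: algebra_simps)
    then have "2 * pi * norm (?S - \<phi> x) = norm I"
      by (metis (no_types, opaque_lifting) norm_mult norm_of_real norm_ii mult.right_neutral abs_of_pos pi_gt_zero
          norm_numeral)
    with I have "2 * pi * norm (?S - \<phi> x) \<le> 2 * pi * e"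
      by simp
    then show ?thesis
      by simp
  qed
  then have "norm (?S - \<phi> x) \<le> 0"
    by (rule field_le_epsilon) simp
  then show ?thesis
    by simp
qed

text \<open>The constant d contributes d times the identity by \<open>residue_sum_resolvent\<close>.
  With d = 1/2 and c the evaluation scalar this passes from R_k to the evaluated R_k^+.\<close>

lemma operator_fun_affine:
  assumes H: "H analytic_on spectrum" and x: "x \<in> V"
  shows "operator_fun V (\<lambda>w. c * (H w + d)) A x = c *\<^sub>C (operator_fun V H A x + d *\<^sub>C x)"
proof (rule clinear_functionals_separate)
  fix \<phi> :: "'a \<Rightarrow> complex" assume \<phi>: "clinear \<phi>"
  let ?g = "resolvent_functional \<phi> x"
  have g: "?g holomorphic_on - spectrum"
    by (rule resolvent_functional_holomorphic[OF x \<phi>])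
  have H': "(\<lambda>w. c * (H w + d)) analytic_on spectrum"
    by (intro analytic_intros H)
  obtain D where D: "open D" "spectrum \<subseteq> D" "H holomorphic_on D"
    using H by (auto simp: analytic_on_holomorphic)
  obtain r where r: "r > 0" "\<forall>\<nu>\<in>spectrum. cball \<nu> r \<subseteq> D \<and> cball \<nu> r \<inter> spectrum = {\<nu>}"
    using ex_valid_radius[OF finite_spectrum D(1,2)] by blast
  have v: "valid_radius H spectrum r" "valid_radius (\<lambda>w. c * (H w + d)) spectrum r" "valid_radius (\<lambda>_. 1) spectrum r"
    by (rule valid_radius_subset[OF r D(1)]; auto intro!: holomorphic_intros D(3))+
  have one: "cauchy_sum r (\<lambda>_. 1) ?g = \<phi> x"
    using residue_sum_resolvent[OF x \<phi>] by (simp add: cauchy_sum_eq_residues[OF v(3) g])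
  have "contour_integral (circlepath \<nu> r) (\<lambda>w. (c * (H w + d)) * ?g w) =
    c * contour_integral (circlepath \<nu> r) (\<lambda>w. H w * ?g w) + c * d * contour_integral (circlepath \<nu> r) (\<lambda>w. 1 * ?g w)"
    if \<nu>: "\<nu> \<in> spectrum" for \<nu>
  proof (rule contour_integral_unique)
    have "((\<lambda>w. c * (H w * ?g w) + c * d * (1 * ?g w)) has_contour_integral
      c * contour_integral (circlepath \<nu> r) (\<lambda>w. H w * ?g w) + c * d * contour_integral (circlepath \<nu> r) (\<lambda>w. 1 * ?g w))
      (circlepath \<nu> r)"
      by (intro has_contour_integral_add has_contour_integral_lmul has_contour_integral_integral
          contour_integrable_on_circle[OF v(1) \<nu> g] contour_integrable_on_circle[OF v(3) \<nu> g])
    then show "((\<lambda>w. (c * (H w + d)) * ?g w) has_contour_integral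
      c * contour_integral (circlepath \<nu> r) (\<lambda>w. H w * ?g w) + c * d * contour_integral (circlepath \<nu> r) (\<lambda>w. 1 * ?g w))
      (circlepath \<nu> r)"
      by (simp add: algebra_simps)
  qed
  then have "cauchy_sum r (\<lambda>w. c * (H w + d)) ?g = c * cauchy_sum r H ?g + c * d * cauchy_sum r (\<lambda>_. 1) ?g"
    unfolding cauchy_sum_def by (simp add: sum.distrib sum_distrib_left mult_ac distrib_left)
  then show "\<phi> (operator_fun V (\<lambda>w. c * (H w + d)) A x) = \<phi> (c *\<^sub>C (operator_fun V H A x + d *\<^sub>C x))"
    unfolding operator_fun_cauchy_sum[OF H' x \<phi> v(2)] clinear_functional_scaleC[OF \<phi>] clinear_add[OF \<phi>]
      operator_fun_cauchy_sum[OF H x \<phi> v(1)] one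
    by (simp add: algebra_simps)
qed

lemma operator_fun_lincomb:
  assumes H: "H analytic_on spectrum" and x: "x \<in> V" "y \<in> V"
  shows "operator_fun V H A (c *\<^sub>C x + y) = c *\<^sub>C operator_fun V H A x + operator_fun V H A y"
proof (rule clinear_functionals_separate)
  fix \<phi> :: "'a \<Rightarrow> complex" assume \<phi>: "clinear \<phi>"
  have xy: "c *\<^sub>C x + y \<in> V"
    by (intro complex_vector.subspace_add complex_vector.subspace_scale subspace x)
  define r where "r = contour_radius H spectrum"
  have r: "valid_radius H spectrum r"
    unfolding r_def by (rule contour_radius_valid[OF finite_spectrum H])
  note g = resolvent_functional_holomorphic[OF _ \<phi>]
  have "contour_integral (circlepath \<nu> r) (\<lambda>w. H w * resolvent_functional \<phi> (c *\<^sub>C x + y) w) =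
    c * contour_integral (circlepath \<nu> r) (\<lambda>w. H w * resolvent_functional \<phi> x w) +
    contour_integral (circlepath \<nu> r) (\<lambda>w. H w * resolvent_functional \<phi> y w)"
    if \<nu>: "\<nu> \<in> spectrum" for \<nu>
  proof -
    have "contour_integral (circlepath \<nu> r) (\<lambda>w. H w * resolvent_functional \<phi> (c *\<^sub>C x + y) w) =
      contour_integral (circlepath \<nu> r) (\<lambda>w. c * (H w * resolvent_functional \<phi> x w) + H w * resolvent_functional \<phi> y w)"
    proof (rule contour_integral_eq)
      fix w assume "w \<in> path_image (circlepath \<nu> r)"
      then have "w \<notin> spectrum"
        using sphere_avoids_spectrum[OF r \<nu>] r by (auto simp: valid_radius_def)
      then show "H w * resolvent_functional \<phi> (c *\<^sub>C x + y) w
        = c * (H w * resolvent_functional \<phi> x w) + H w * resolvent_functional \<phi> y w"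
        by (simp add: resolvent_functional_def resolvent_on_lincomb[OF _ x] clinear_add[OF \<phi>]
            clinear_functional_scaleC[OF \<phi>] distrib_left mult.left_commute)
    qed
    also have "\<dots> = c * contour_integral (circlepath \<nu> r) (\<lambda>w. H w * resolvent_functional \<phi> x w) +
      contour_integral (circlepath \<nu> r) (\<lambda>w. H w * resolvent_functional \<phi> y w)"
      by (intro contour_integral_unique has_contour_integral_add has_contour_integral_lmul has_contour_integral_integral
          contour_integrable_on_circle[OF r \<nu>] g x)
    finally show ?thesis .
  qed
  then have "cauchy_sum r H (resolvent_functional \<phi> (c *\<^sub>C x + y)) =
    c * cauchy_sum r H (resolvent_functional \<phi> x) + cauchy_sum r H (resolvent_functional \<phi> y)"
    unfolding cauchy_sum_def by (simp add: sum.distrib sum_distrib_left mult_ac distrib_left)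
  then show "\<phi> (operator_fun V H A (c *\<^sub>C x + y)) = \<phi> (c *\<^sub>C operator_fun V H A x + operator_fun V H A y)"
    unfolding clinear_add[OF \<phi>] clinear_functional_scaleC[OF \<phi>] operator_fun_cauchy_sum[OF H xy \<phi> r]
      operator_fun_cauchy_sum[OF H x(1) \<phi> r] operator_fun_cauchy_sum[OF H x(2) \<phi> r] .
qed

text \<open>All terms and the limit are holomorphic on the common set D, so a single radius serves
  every m. On the finitely many circles the resolvent is bounded, and the majorant of the series
  times this bound justifies termwise integration.\<close>

lemma has_sum_operator_fun:
  fixes \<phi> :: "'a \<Rightarrow> complex"
  assumes D: "open D" "spectrum \<subseteq> D" and x: "x \<in> V" and \<phi>: "clinear \<phi>"
    and hol: "\<And>m. m \<in> I \<Longrightarrow> F m holomorphic_on D"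
    and sum: "\<And>w. w \<in> D \<Longrightarrow> ((\<lambda>m. F m w) has_sum H w) I"
    and M: "\<And>K. compact K \<Longrightarrow> K \<subseteq> D \<Longrightarrow> \<exists>M. M summable_on I \<and> (\<forall>m\<in>I. \<forall>w\<in>K. norm (F m w) \<le> M m)"
  shows "((\<lambda>m. \<phi> (operator_fun V (F m) A x)) has_sum \<phi> (operator_fun V H A x)) I"
proof -
  let ?g = "resolvent_functional \<phi> x"
  have g: "?g holomorphic_on - spectrum"
    by (rule resolvent_functional_holomorphic[OF x \<phi>])
  have H: "H holomorphic_on D"
    by (rule holomorphic_has_sum_M_test[OF D(1) hol sum M])
  obtain r where r: "r > 0" "\<forall>\<nu>\<in>spectrum. cball \<nu> r \<subseteq> D \<and> cball \<nu> r \<inter> spectrum = {\<nu>}"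
    using ex_valid_radius[OF finite_spectrum D] by blast
  have analytic: "f analytic_on spectrum" if "f holomorphic_on D" for f
    using that D analytic_on_holomorphic by blast
  have S: "((\<lambda>m. cauchy_sum r (F m) ?g) has_sum cauchy_sum r H ?g) I"
    unfolding cauchy_sum_def
  proof (intro has_sum_cmult_right has_sum_finite_sum finite_spectrum)
    fix \<nu> assume \<nu>: "\<nu> \<in> spectrum"
    have sph: "sphere \<nu> r \<subseteq> D" "sphere \<nu> r \<subseteq> - spectrum"
      using r \<nu> sphere_cball sphere_avoids_spectrum[OF valid_radius_subset[OF r D(1) H] \<nu>] by blast+
    obtain M' where M': "M' summable_on I" "\<And>m w. m \<in> I \<Longrightarrow> w \<in> sphere \<nu> r \<Longrightarrow> norm (F m w) \<le> M' m"
      using M[OF compact_sphere sph(1)] by blast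
    have "bounded (?g ` sphere \<nu> r)"
      using holomorphic_on_imp_continuous_on[OF g] sph(2) continuous_on_subset
      by (intro compact_imp_bounded compact_continuous_image) auto
    then obtain b where b: "\<And>w. w \<in> sphere \<nu> r \<Longrightarrow> norm (?g w) \<le> b"
      unfolding bounded_iff by blast
    show "((\<lambda>m. contour_integral (circlepath \<nu> r) (\<lambda>w. F m w * ?g w)) has_sum
      contour_integral (circlepath \<nu> r) (\<lambda>w. H w * ?g w)) I"
    proof (rule has_sum_contour_integral_circlepath[OF r(1), where M = "\<lambda>m. M' m * b"])
      show "(\<lambda>w. F m w * ?g w) contour_integrable_on circlepath \<nu> r" if "m \<in> I" for m
        by (rule contour_integrable_on_circle[OF valid_radius_subset[OF r D(1) hol[OF that]] \<nu> g])
      show "((\<lambda>m. F m w * ?g w) has_sum H w * ?g w) I" if "w \<in> sphere \<nu> r" for w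
        using sum that sph(1) by (intro has_sum_cmult_left) auto
      show "(\<lambda>m. M' m * b) summable_on I"
        using M'(1) by (rule summable_on_cmult_left)
      show "norm (F m w * ?g w) \<le> M' m * b" if "m \<in> I" "w \<in> sphere \<nu> r" for m w
        unfolding norm_mult using M'(2)[OF that] b[OF that(2)]
        by (intro mult_mono) (auto intro: order_trans[OF norm_ge_zero])
    qed
  qed
  have eqH: "\<phi> (operator_fun V H A x) = cauchy_sum r H ?g"
    by (rule operator_fun_cauchy_sum[OF analytic[OF H] x \<phi> valid_radius_subset[OF r D(1) H]])
  have eqF: "\<phi> (operator_fun V (F m) A x) = cauchy_sum r (F m) ?g" if "m \<in> I" for m
    by (rule operator_fun_cauchy_sum[OF analytic[OF hol[OF that]] x \<phi> valid_radius_subset[OF r D(1) hol[OF that]]])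
  show ?thesis
    unfolding eqH by (rule has_sum_cong[THEN iffD2, OF eqF S])
qed

lemma finite_operator_shift: "finite_operator V (\<lambda>\<xi>. c *\<^sub>C \<xi> + A \<xi>)"
proof (rule finite_operator.intro)
  show "clinear (\<lambda>\<xi>. c *\<^sub>C \<xi> + A \<xi>)"
    unfolding clinear_iff
    by (simp add: clinear_add[OF A] clinear_scaleC[OF A] scaleC_add_right scaleC_scaleC mult.commute add_ac)
  show "c *\<^sub>C x + A x \<in> V" if "x \<in> V" for x
    by (intro complex_vector.subspace_add complex_vector.subspace_scale subspace inv that)
qed (rule fin)

text \<open>Needed because \<open>loop_R\<close> shifts the operator while the summands of the
  kernel shift the variable. The resolvent and the spectrum are translated by c, and residues are
  translation invariant; for the two independently chosen radii no such relation is
  available.\<close>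

lemma operator_fun_shift:
  assumes H: "(\<lambda>w. H (w + c)) analytic_on spectrum" and x: "x \<in> V"
  shows "operator_fun V H (\<lambda>\<xi>. c *\<^sub>C \<xi> + A \<xi>) x = operator_fun V (\<lambda>w. H (w + c)) A x"
proof -
  interpret shifted: finite_operator V "\<lambda>\<xi>. c *\<^sub>C \<xi> + A \<xi>"
    by (rule finite_operator_shift)
  have sp: "shifted.spectrum = (\<lambda>\<nu>. \<nu> + c) ` spectrum"
  proof -
    have "c *\<^sub>C y + A y = \<nu> *\<^sub>C y \<longleftrightarrow> A y = (\<nu> - c) *\<^sub>C y" for \<nu> y
      by (simp add: complex_vector.scale_left_diff_distrib eq_diff_eq add.commute)
    then have iff: "\<nu> \<in> shifted.spectrum \<longleftrightarrow> \<nu> - c \<in> spectrum" for \<nu>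
      by (simp add: spectrum_on_def)
    show ?thesis
    proof (intro set_eqI iffI)
      fix \<nu> assume "\<nu> \<in> shifted.spectrum"
      then have "\<nu> - c \<in> spectrum"
        by (simp only: iff)
      then show "\<nu> \<in> (\<lambda>\<nu>. \<nu> + c) ` spectrum"
        by (rule image_eqI[rotated]) simp
    next
      fix \<nu> assume "\<nu> \<in> (\<lambda>\<nu>. \<nu> + c) ` spectrum"
      then obtain \<nu>' where "\<nu> = \<nu>' + c" "\<nu>' \<in> spectrum"
        by blast
      then show "\<nu> \<in> shifted.spectrum"
        by (simp add: iff)
    qed
  qed
  have res: "resolvent_on V (\<lambda>\<xi>. c *\<^sub>C \<xi> + A \<xi>) w = resolvent_on V A (w - c)" for w
    by (simp add: resolvent_on_def complex_vector.scale_left_diff_distrib diff_diff_eq)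
  have H': "H analytic_on shifted.spectrum"
  proof -
    have "((\<lambda>w. H (w + c)) \<circ> (\<lambda>w. w - c)) analytic_on shifted.spectrum"
      unfolding sp using H by (intro analytic_on_compose analytic_intros) (auto simp: image_image)
    then show ?thesis
      by (simp add: o_def)
  qed
  show ?thesis
  proof (rule clinear_functionals_separate)
    fix \<phi> :: "'a \<Rightarrow> complex" assume \<phi>: "clinear \<phi>"
    have rf: "shifted.resolvent_functional \<phi> x w = resolvent_functional \<phi> x (w - c)" for w
      by (simp add: shifted.resolvent_functional_def resolvent_functional_def res)
    have "\<phi> (operator_fun V H (\<lambda>\<xi>. c *\<^sub>C \<xi> + A \<xi>) x) =
      (\<Sum>\<nu>\<in>shifted.spectrum. residue (\<lambda>w. H w * resolvent_functional \<phi> x (w - c)) \<nu>)"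
      unfolding shifted.operator_fun_spec(2)[OF H' x \<phi>] rf ..
    also have "\<dots> = (\<Sum>\<nu>\<in>spectrum. residue (\<lambda>w. H w * resolvent_functional \<phi> x (w - c)) (\<nu> + c))"
      unfolding sp by (subst sum.reindex) (auto simp: inj_on_def)
    also have "\<dots> = (\<Sum>\<nu>\<in>spectrum. residue (\<lambda>w. H (w + c) * resolvent_functional \<phi> x w) \<nu>)"
    proof (rule sum.cong[OF refl])
      fix \<nu>
      have "residue (\<lambda>w. H w * resolvent_functional \<phi> x (w - c)) (\<nu> + c) =
        residue (\<lambda>u. H (\<nu> + c + u) * resolvent_functional \<phi> x (\<nu> + c + u - c)) 0"
        by (rule residue_shift_0)
      also have "\<dots> = residue (\<lambda>w. H (w + c) * resolvent_functional \<phi> x w) \<nu>"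
        by (subst residue_shift_0[of _ \<nu>]) (simp add: algebra_simps)
      finally show "residue (\<lambda>w. H w * resolvent_functional \<phi> x (w - c)) (\<nu> + c) =
        residue (\<lambda>w. H (w + c) * resolvent_functional \<phi> x w) \<nu>" .
    qed
    also have "\<dots> = \<phi> (operator_fun V (\<lambda>w. H (w + c)) A x)"
      unfolding operator_fun_spec(2)[OF H x \<phi>] ..
    finally show "\<phi> (operator_fun V H (\<lambda>\<xi>. c *\<^sub>C \<xi> + A \<xi>) x) = \<phi> (operator_fun V (\<lambda>w. H (w + c)) A x)" .
  qed
qed

end

section \<open>Tensor products and dual bases\<close>

lemma clinearI:
  assumes "\<And>x y. f (x + y) = f x + f y" "\<And>c x. f (c *\<^sub>C x) = c *\<^sub>C f x"
  shows "clinear f"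
  using assms by (simp add: clinear_iff)

lemma cbilinear_iff:
  "cbilinear f \<longleftrightarrow> (\<forall>x y z. f (x + y) z = f x z + f y z) \<and> (\<forall>c x z. f (c *\<^sub>C x) z = c *\<^sub>C f x z)
    \<and> (\<forall>x y z. f x (y + z) = f x y + f x z) \<and> (\<forall>c x z. f x (c *\<^sub>C z) = c *\<^sub>C f x z)"
  unfolding cbilinear_def clinear_iff by blast

lemma sum_keys_superset:
  assumes "finite S" "Poly_Mapping.keys p \<subseteq> S" "\<And>n. g n 0 = 0"
  shows "(\<Sum>n\<in>Poly_Mapping.keys p. g n (Poly_Mapping.lookup p n)) = (\<Sum>n\<in>S. g n (Poly_Mapping.lookup p n))"
  by (rule sum.mono_neutral_left) (use assms in \<open>auto simp: in_keys_iff\<close>)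

text \<open>Cancellation can make the support of a sum smaller than the union of the supports, so
  all sums are first extended to a common finite set.\<close>

lemma clinear_sum_keys:
  fixes g :: "'k \<Rightarrow> 'b::complex_vector \<Rightarrow> 'c::complex_vector"
  assumes g: "\<And>n. clinear (g n)"
  shows "clinear (\<lambda>p. \<Sum>n\<in>Poly_Mapping.keys p. g n (Poly_Mapping.lookup p n))"
proof (rule clinearI)
  fix p q :: "'k \<Rightarrow>\<^sub>0 'b"
  let ?S = "Poly_Mapping.keys p \<union> Poly_Mapping.keys q"
  show "(\<Sum>n\<in>Poly_Mapping.keys (p + q). g n (Poly_Mapping.lookup (p + q) n)) =
    (\<Sum>n\<in>Poly_Mapping.keys p. g n (Poly_Mapping.lookup p n)) + (\<Sum>n\<in>Poly_Mapping.keys q. g n (Poly_Mapping.lookup q n))"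
    using sum_keys_superset[where S = ?S and p = p and g = g] sum_keys_superset[where S = ?S and p = q and g = g]
      sum_keys_superset[where S = ?S and p = "p + q" and g = g] Poly_Mapping.keys_add[of p q] clinear_0[OF g]
    by (simp add: lookup_add clinear_add[OF g] sum.distrib)
next
  fix c and p :: "'k \<Rightarrow>\<^sub>0 'b"
  have "Poly_Mapping.keys (c *\<^sub>C p) \<subseteq> Poly_Mapping.keys p"
    by (auto simp: in_keys_iff lookup_scaleC)
  then show "(\<Sum>n\<in>Poly_Mapping.keys (c *\<^sub>C p). g n (Poly_Mapping.lookup (c *\<^sub>C p) n)) =
    c *\<^sub>C (\<Sum>n\<in>Poly_Mapping.keys p. g n (Poly_Mapping.lookup p n))"
    using sum_keys_superset[where S = "Poly_Mapping.keys p" and p = "c *\<^sub>C p" and g = g] clinear_0[OF g]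
    by (simp add: lookup_scaleC clinear_scaleC[OF g] complex_vector.scale_sum_right)
qed

lemma tensor_prod_eq: "x \<otimes> y = abs_tensor (Poly_Mapping.single (x, y) 1)"
  by (rule tensor_prod.abs_eq)

lemma tensor_eqI: "p - q \<in> cspan tensor_relators \<Longrightarrow> abs_tensor p = abs_tensor q"
  using Quotient_rel_abs[OF Quotient_tensor, of p q] by (simp add: tensor_rel_def)

lemma clinear_abs_tensor: "clinear abs_tensor"
  by (rule clinearI) (simp_all add: plus_tensor.abs_eq scaleC_tensor.abs_eq)

lemma tensor_prod_add_left: "(x + x') \<otimes> y = x \<otimes> y + x' \<otimes> y"
  unfolding tensor_prod_eq plus_tensor.abs_eq
  by (rule tensor_eqI, rule complex_vector.span_base)
     (unfold tensor_relators_def diff_diff_eq[symmetric], blast)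

lemma tensor_prod_add_right: "x \<otimes> (y + y') = x \<otimes> y + x \<otimes> y'"
  unfolding tensor_prod_eq plus_tensor.abs_eq
  by (rule tensor_eqI, rule complex_vector.span_base)
     (unfold tensor_relators_def diff_diff_eq[symmetric], blast)

lemma tensor_prod_scaleC_left: "(c *\<^sub>C x) \<otimes> y = c *\<^sub>C (x \<otimes> y)"
  unfolding tensor_prod_eq scaleC_tensor.abs_eq
  by (rule tensor_eqI, rule complex_vector.span_base) (unfold tensor_relators_def, blast)

lemma tensor_prod_scaleC_right: "x \<otimes> (c *\<^sub>C y) = c *\<^sub>C (x \<otimes> y)"
  unfolding tensor_prod_eq scaleC_tensor.abs_eq
  by (rule tensor_eqI, rule complex_vector.span_base) (unfold tensor_relators_def, blast)

lemma clinear_tensor_prod_left: "clinear (\<lambda>x. x \<otimes> y)"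
  by (rule clinearI) (rule tensor_prod_add_left tensor_prod_scaleC_left)+

lemma clinear_tensor_prod_right: "clinear (\<lambda>y. x \<otimes> y)"
  by (rule clinearI) (rule tensor_prod_add_right tensor_prod_scaleC_right)+

text \<open>The existence half of the universal property: the linear extension to the free space
  kills the relators and so descends to the quotient. Uniqueness is
  \<open>clinear_tensor_eqI\<close>, and together they give meaning to
  \<open>tensor_map\<close>.\<close>

lemma tensor_lift:
  fixes \<beta> :: "'a::complex_vector \<Rightarrow> 'b::complex_vector \<Rightarrow> 'c::complex_vector"
  assumes "cbilinear \<beta>"
  shows "\<exists>h :: ('a, 'b) tensor \<Rightarrow> 'c. clinear h \<and> (\<forall>x y. h (x \<otimes> y) = \<beta> x y)"
proof -
  define ext where "ext p = (\<Sum>k\<in>Poly_Mapping.keys p. Poly_Mapping.lookup p k *\<^sub>C \<beta> (fst k) (snd k))"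
    for p :: "'a \<times> 'b \<Rightarrow>\<^sub>0 complex"
  have lin: "clinear ext"
    unfolding ext_def
    by (rule clinear_sum_keys) (auto intro!: clinearI simp: scaleC_add_left scaleC_scaleC scaleC_complex_def)
  have single: "ext (Poly_Mapping.single (x, y) 1) = \<beta> x y" for x y
    by (simp add: ext_def scaleC_one)
  have "ext r = 0" if "r \<in> tensor_relators" for r
    using that assms unfolding tensor_relators_def cbilinear_iff
    by (auto simp: clinear_diff[OF lin] clinear_scaleC[OF lin] single)
  then have span: "ext r = 0" if "r \<in> cspan tensor_relators" for r
    using complex_vector_pair.linear_eq_0_on_span[OF lin] that by blast
  define h where "h t = ext (rep_tensor t)" for t
  have abs: "h (abs_tensor p) = ext p" for p
  proof -
    have "tensor_rel (rep_tensor (abs_tensor p)) p"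
      by (metis Quotient_tensor Quotient_rep_abs equivp_reflp equivp_tensor_rel)
    then have "ext (rep_tensor (abs_tensor p) - p) = 0"
      unfolding tensor_rel_def by (rule span)
    then show ?thesis
      by (simp add: h_def clinear_diff[OF lin])
  qed
  have rep: "\<exists>p. t = abs_tensor p" for t :: "('a, 'b) tensor"
    by (metis Quotient_abs_rep Quotient_tensor)
  have "clinear h"
  proof (rule clinearI)
    fix s t :: "('a, 'b) tensor" and c
    obtain p q where "s = abs_tensor p" "t = abs_tensor q"
      using rep by metis
    then show "h (s + t) = h s + h t" "h (c *\<^sub>C s) = c *\<^sub>C h s"
      by (simp_all add: plus_tensor.abs_eq scaleC_tensor.abs_eq abs clinear_add[OF lin] clinear_scaleC[OF lin])
  qed
  moreover have "h (x \<otimes> y) = \<beta> x y" for x y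
    by (simp add: tensor_prod_eq abs single)
  ultimately show ?thesis
    by blast
qed

lemma clinear_tensor_eqI:
  fixes f g :: "('a::complex_vector, 'b::complex_vector) tensor \<Rightarrow> 'c::complex_vector"
  assumes f: "clinear f" and g: "clinear g" and eq: "\<And>x y. f (x \<otimes> y) = g (x \<otimes> y)"
  shows "f = g"
proof
  fix t :: "('a, 'b) tensor"
  obtain p where t: "t = abs_tensor p"
    by (metis Quotient_abs_rep Quotient_tensor)
  have single: "f (abs_tensor (Poly_Mapping.single k c)) = g (abs_tensor (Poly_Mapping.single k c))" for k c
  proof -
    have "Poly_Mapping.single k c = c *\<^sub>C Poly_Mapping.single k 1"
      by (rule poly_mapping_eqI) (simp add: lookup_scaleC lookup_single scaleC_complex_def when_def)
    then have "abs_tensor (Poly_Mapping.single k c) = c *\<^sub>C (fst k \<otimes> snd k)"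
      by (simp add: tensor_prod_eq scaleC_tensor.abs_eq)
    then show ?thesis
      by (simp add: clinear_scaleC[OF f] clinear_scaleC[OF g] eq)
  qed
  have "p = (\<Sum>k\<in>Poly_Mapping.keys p. Poly_Mapping.single k (Poly_Mapping.lookup p k))"
    by (rule poly_mapping_eqI) (simp add: lookup_sum lookup_single when_def in_keys_iff)
  then have "abs_tensor p = (\<Sum>k\<in>Poly_Mapping.keys p. abs_tensor (Poly_Mapping.single k (Poly_Mapping.lookup p k)))"
    by (metis clinear_sum[OF clinear_abs_tensor])
  then have "f (abs_tensor p) = g (abs_tensor p)"
    by (simp add: clinear_sum[OF f] clinear_sum[OF g] single)
  then show "f t = g t"
    by (simp add: t)
qed

lemma tensor_map:
  assumes f: "clinear f" and g: "clinear g"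
  shows "clinear (tensor_map f g)" "tensor_map f g (x \<otimes> y) = f x \<otimes> g y"
proof -
  have "cbilinear (\<lambda>x y. f x \<otimes> g y)"
    unfolding cbilinear_iff
    by (simp add: clinear_add[OF f] clinear_add[OF g] clinear_scaleC[OF f] clinear_scaleC[OF g] tensor_prod_add_left
        tensor_prod_add_right tensor_prod_scaleC_left tensor_prod_scaleC_right)
  then obtain h where h: "clinear h" "\<And>x y. h (x \<otimes> y) = f x \<otimes> g y"
    using tensor_lift by blast
  have "\<exists>!h. clinear h \<and> (\<forall>x y. h (x \<otimes> y) = f x \<otimes> g y)"
  proof (rule ex1I)
    show "clinear h \<and> (\<forall>x y. h (x \<otimes> y) = f x \<otimes> g y)"
      using h by blast
    show "h' = h" if "clinear h' \<and> (\<forall>x y. h' (x \<otimes> y) = f x \<otimes> g y)" for h'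
      using that h by (intro clinear_tensor_eqI) auto
  qed
  from theI'[OF this] show "clinear (tensor_map f g)" "tensor_map f g (x \<otimes> y) = f x \<otimes> g y"
    unfolding tensor_map_def by blast+
qed

text \<open>In an initial topology, convergence can be tested against the generating maps. From here
  on the theorem is a statement about complex-valued sums.\<close>

lemma has_sum_tensorI:
  fixes f :: "'i \<Rightarrow> ('a::complex_vector, 'b::complex_vector) tensor"
  assumes "\<And>\<phi> :: ('a, 'b) tensor \<Rightarrow> complex. clinear \<phi> \<Longrightarrow> ((\<lambda>n. \<phi> (f n)) has_sum \<phi> l) I"
  shows "(f has_sum l) I"
proof -
  have nhds: "nhds l = (INF S\<in>{S \<in> {\<phi> -` U | (\<phi> :: ('a, 'b) tensor \<Rightarrow> complex) U. clinear \<phi> \<and> open U}. l \<in> S}. principal S)"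
    by (rule nhds_generated_topology) (rule ext, simp add: open_tensor_def)
  have "filterlim (sum f) (nhds l) (finite_subsets_at_top I)"
    unfolding nhds filterlim_INF filterlim_principal
  proof safe
    fix \<phi> :: "('a, 'b) tensor \<Rightarrow> complex" and U assume \<phi>: "clinear \<phi>" "open U" "\<phi> l \<in> U"
    have "((\<lambda>X. \<Sum>n\<in>X. \<phi> (f n)) \<longlongrightarrow> \<phi> l) (finite_subsets_at_top I)"
      using assms[OF \<phi>(1)] by (simp add: has_sum_def)
    from topological_tendstoD[OF this \<phi>(2,3)]
    show "\<forall>\<^sub>F X in finite_subsets_at_top I. sum f X \<in> \<phi> -` U"
      by (simp add: clinear_sum[OF \<phi>(1)])
  qed
  then show ?thesis
    by (simp add: has_sum_def)
qed

section \<open>Expansions with respect to dual bases\<close>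

lemma is_cbasis_expansion:
  assumes "is_cbasis V d T" "x \<in> V"
  shows "\<exists>c. x = (\<Sum>i<d. c i *\<^sub>C T i)"
  using assms in_cspan_image_lessThan[of x T d] by (simp add: is_cbasis_def)

lemma is_cbasis_in: "is_cbasis V d T \<Longrightarrow> i < d \<Longrightarrow> T i \<in> V"
  unfolding is_cbasis_def by (metis complex_vector.span_base imageI lessThan_iff)

lemma dual_bases_expansion_right:
  assumes B: "cbilinear B" and dual: "dual_bases B V W d T T'" and y: "y \<in> W"
  shows "y = (\<Sum>i<d. B (T i) y *\<^sub>C T' i)"
proof -
  obtain c where c: "y = (\<Sum>i<d. c i *\<^sub>C T' i)"
    using is_cbasis_expansion dual y unfolding dual_bases_def by metis
  have lin: "clinear (B x)" for x
    using B by (simp add: cbilinear_def)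
  have "B (T i) y = c i" if "i < d" for i
    using that dual unfolding dual_bases_def c
    by (simp add: clinear_sum[OF lin] clinear_functional_scaleC[OF lin] if_distrib[of "\<lambda>x. _ * x"] cong: if_cong)
  then show ?thesis
    using c by simp
qed

lemma dual_bases_expansion_left:
  assumes B: "cbilinear B" and dual: "dual_bases B V W d T T'" and x: "x \<in> V"
  shows "x = (\<Sum>i<d. B x (T' i) *\<^sub>C T i)"
proof -
  obtain c where c: "x = (\<Sum>i<d. c i *\<^sub>C T i)"
    using is_cbasis_expansion dual x unfolding dual_bases_def by metis
  have lin: "clinear (\<lambda>x. B x y)" for y
    using B by (simp add: cbilinear_def)
  have "B x (T' i) = c i" if "i < d" for i
    using that dual unfolding dual_bases_def c
    by (simp add: clinear_sum[OF lin] clinear_functional_scaleC[OF lin] if_distrib[of "\<lambda>x. _ * x"] cong: if_cong)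
  then show ?thesis
    using c by simp
qed

section \<open>Operators of finite order and the loop algebra\<close>

definition eigenvalue :: "nat \<Rightarrow> int \<Rightarrow> complex"
  where "eigenvalue N a = exp (2 * of_real pi * \<i> * of_int a / of_nat N)"

lemma in_eigenspace_iff: "\<xi> \<in> eigenspace \<mu> N a \<longleftrightarrow> \<mu> \<xi> = eigenvalue N a *\<^sub>C \<xi>"
  by (simp add: eigenspace_def eigenvalue_def)

lemma eigenvalue_0 [simp]: "eigenvalue N 0 = 1"
  by (simp add: eigenvalue_def)

lemma eigenvalue_add: "eigenvalue N (a + b) = eigenvalue N a * eigenvalue N b"
  by (simp add: eigenvalue_def distrib_left add_divide_distrib exp_add)

lemma eigenvalue_eq_1_iff:
  assumes "N > 0"
  shows "eigenvalue N c = 1 \<longleftrightarrow> int N dvd c"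
proof -
  have "eigenvalue N c = 1 \<longleftrightarrow>
      (\<exists>j::int. 2 * of_real pi * \<i> * (of_int c / of_nat N) = 2 * of_real pi * \<i> * (of_int j :: complex))"
    using exp_eq[of "2 * of_real pi * \<i> * of_int c / of_nat N" 0] by (simp add: eigenvalue_def mult_ac)
  also have "\<dots> \<longleftrightarrow> (\<exists>j::int. of_int c / of_nat N = (of_int j :: complex))"
    by (simp only: mult_cancel_left) simp
  also have "\<dots> \<longleftrightarrow> (\<exists>j. c = int N * j)"
  proof -
    have "of_int c / of_nat N = (of_int j :: complex) \<longleftrightarrow> of_int c = (of_int (int N * j) :: complex)" for j
      using assms by (simp add: field_simps)
    then show ?thesis
      by (simp only: of_int_eq_iff)
  qed
  finally show ?thesis
    by (simp add: dvd_def)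
qed

lemma eigenvalue_power: "eigenvalue N c ^ j = eigenvalue N (int j * c)"
  by (simp add: eigenvalue_def exp_of_nat_mult[symmetric] mult_ac)

text \<open>Orthogonality of the characters of the cyclic group of order N: a geometric sum whose
  ratio is an N-th root of unity.\<close>

lemma sum_eigenvalue_powers:
  assumes "N > 0"
  shows "(\<Sum>j<N. eigenvalue N c ^ j) = (if int N dvd c then of_nat N else 0)"
proof (cases "int N dvd c")
  case True
  then show ?thesis
    using eigenvalue_eq_1_iff[OF assms, of c] by simp
next
  case False
  have "eigenvalue N c ^ N = 1"
    by (simp add: eigenvalue_power eigenvalue_eq_1_iff[OF assms])
  then show ?thesis
    using False eigenvalue_eq_1_iff[OF assms, of c] by (simp add: geometric_sum)
qed

locale finite_order_operator =
  fixes \<mu> :: "'g::complex_vector \<Rightarrow> 'g" and N :: nat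
  assumes mu: "clinear \<mu>" and N: "N > 0" and order: "\<mu> ^^ N = id"
begin

abbreviation E :: "int \<Rightarrow> 'g set"
  where "E a \<equiv> eigenspace \<mu> N a"

text \<open>The averaging projector of the cyclic group generated by \<open>\<mu>\<close> onto the
  eigenspace of index a, along the other eigenspaces.\<close>

definition projection :: "int \<Rightarrow> 'g \<Rightarrow> 'g"
  where "projection a \<xi> = (1 / of_nat N) *\<^sub>C (\<Sum>j<N. eigenvalue N (- a) ^ j *\<^sub>C (\<mu> ^^ j) \<xi>)"

text \<open>Allows a degree n to serve directly as the index of an eigenspace, without reduction
  modulo N.\<close>

lemma eigenspace_cong:
  assumes "int N dvd a - b"
  shows "E a = E b"
proof -
  have "eigenvalue N a = eigenvalue N (a - b) * eigenvalue N b"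
    by (subst eigenvalue_add[symmetric]) simp
  then show ?thesis
    using assms eigenvalue_eq_1_iff[OF N, of "a - b"] by (auto simp: in_eigenspace_iff)
qed

lemma subspace_eigenspace: "module.subspace scaleC (E a)"
  by (rule complex_vector.subspaceI)
     (auto simp: in_eigenspace_iff clinear_0[OF mu] clinear_add[OF mu] clinear_scaleC[OF mu] scaleC_add_right
       scaleC_scaleC mult.commute)

lemma clinear_funpow: "clinear (\<mu> ^^ j)"
proof (induction j)
  case (Suc j)
  then show ?case
    unfolding clinear_iff by (simp add: clinear_add[OF mu] clinear_scaleC[OF mu])
qed (simp add: clinear_iff)

lemma clinear_projection: "clinear (projection a)"
  unfolding projection_def clinear_iff
  by (simp add: clinear_add[OF clinear_funpow] clinear_scaleC[OF clinear_funpow] scaleC_add_right sum.distrib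
      scaleC_scaleC complex_vector.scale_sum_right mult_ac)

lemma funpow_eigenvector: "\<xi> \<in> E a \<Longrightarrow> (\<mu> ^^ j) \<xi> = eigenvalue N a ^ j *\<^sub>C \<xi>"
  by (induction j) (simp_all add: in_eigenspace_iff clinear_scaleC[OF mu] scaleC_scaleC scaleC_one mult.commute)

lemma projection_eigenvector:
  assumes "\<xi> \<in> E b"
  shows "projection a \<xi> = (if int N dvd b - a then \<xi> else 0)"
proof -
  have "projection a \<xi> = (1 / of_nat N) *\<^sub>C (\<Sum>j<N. (eigenvalue N (- a) * eigenvalue N b) ^ j *\<^sub>C \<xi>)"
    by (simp add: projection_def funpow_eigenvector[OF assms] scaleC_scaleC power_mult_distrib)
  also have "\<dots> = (1 / of_nat N * (\<Sum>j<N. eigenvalue N (b - a) ^ j)) *\<^sub>C \<xi>"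
    by (simp only: eigenvalue_add[symmetric] sum_scaleC[symmetric] scaleC_scaleC) simp
  finally show ?thesis
    using N by (simp add: sum_eigenvalue_powers scaleC_one)
qed

text \<open>Applying \<open>\<mu>\<close> shifts the summation index by one, and the sum is cyclic
  because both \<open>\<mu>\<close> and the root of unity have N-th power one.\<close>

lemma projection_in_eigenspace: "projection a \<xi> \<in> E a"
proof -
  let ?g = "\<lambda>j. eigenvalue N (- a) ^ j *\<^sub>C (\<mu> ^^ j) \<xi>"
  have inv: "eigenvalue N a * eigenvalue N (- a) = 1"
    by (subst eigenvalue_add[symmetric]) simp
  have "eigenvalue N (- a) ^ N = 1"
    by (simp add: eigenvalue_power eigenvalue_eq_1_iff[OF N])
  then have "?g N = ?g 0"
    by (simp add: order)
  moreover have "?g 0 + (\<Sum>j<N. ?g (Suc j)) = (\<Sum>j<N. ?g j) + ?g N"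
    using sum.lessThan_Suc_shift[of ?g N] sum.lessThan_Suc[of ?g N] by simp
  ultimately have cyc: "(\<Sum>j<N. ?g (Suc j)) = (\<Sum>j<N. ?g j)"
    by simp
  have "\<mu> (?g j) = eigenvalue N a *\<^sub>C ?g (Suc j)" for j
  proof -
    have "eigenvalue N a * eigenvalue N (- a) ^ Suc j = eigenvalue N (- a) ^ j"
      using inv by (simp add: mult.assoc[symmetric])
    then show ?thesis
      by (simp only: clinear_scaleC[OF mu] scaleC_scaleC funpow.simps o_apply)
  qed
  then have "\<mu> (projection a \<xi>) = (1 / of_nat N) *\<^sub>C (\<Sum>j<N. eigenvalue N a *\<^sub>C ?g (Suc j))"
    by (simp only: projection_def clinear_scaleC[OF mu] clinear_sum[OF mu])
  also have "\<dots> = eigenvalue N a *\<^sub>C projection a \<xi>"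
    unfolding projection_def complex_vector.scale_sum_right[symmetric] cyc
    by (simp only: scaleC_scaleC mult.commute)
  finally show ?thesis
    by (simp add: in_eigenspace_iff)
qed

text \<open>Summing over all residues a kills every power of \<open>\<mu>\<close> except the zeroth,
  by orthogonality. Indices outside \<open>eigen_indices\<close> contribute 0, so this is the
  decomposition of the Lie algebra into eigenspaces.\<close>

lemma sum_projections: "(\<Sum>a\<in>eigen_indices \<mu> N. projection a \<xi>) = \<xi>"
proof -
  have "(\<Sum>a<N. projection (int a) \<xi>) = (1 / of_nat N) *\<^sub>C (\<Sum>j<N. (\<Sum>a<N. eigenvalue N (- int j) ^ a) *\<^sub>C (\<mu> ^^ j) \<xi>)"
    unfolding projection_def complex_vector.scale_sum_right[symmetric]
    by (subst sum.swap) (simp add: sum_scaleC eigenvalue_power mult_ac)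
  also have "\<dots> = (1 / of_nat N) *\<^sub>C (\<Sum>j<N. (if j = 0 then of_nat N *\<^sub>C \<xi> else 0))"
  proof (intro arg_cong[where f = "scaleC _"] sum.cong refl)
    fix j assume "j \<in> {..<N}"
    then have "int N dvd - int j \<longleftrightarrow> j = 0"
      by (auto dest: nat_dvd_not_less)
    then show "(\<Sum>a<N. eigenvalue N (- int j) ^ a) *\<^sub>C (\<mu> ^^ j) \<xi> = (if j = 0 then of_nat N *\<^sub>C \<xi> else 0)"
      unfolding sum_eigenvalue_powers[OF N] by simp
  qed
  also have "\<dots> = \<xi>"
    using N by (simp add: scaleC_scaleC scaleC_one)
  finally have "(\<Sum>a<N. projection (int a) \<xi>) = \<xi>" .
  moreover have "(\<Sum>a<N. projection (int a) \<xi>) = (\<Sum>a\<in>{0..<int N}. projection a \<xi>)"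
    by (rule sum.reindex_bij_witness[of _ nat int]) auto
  moreover have "\<dots> = (\<Sum>a\<in>eigen_indices \<mu> N. projection a \<xi>)"
  proof (rule sum.mono_neutral_right)
    show "\<forall>a\<in>{0..<int N} - eigen_indices \<mu> N. projection a \<xi> = 0"
      using projection_in_eigenspace by (auto simp: eigen_indices_def)
  qed (auto simp: eigen_indices_def)
  ultimately show ?thesis
    by simp
qed

lemma finite_eigen_indices: "finite (eigen_indices \<mu> N)"
  by (rule finite_subset[of _ "{0..<int N}"]) (auto simp: eigen_indices_def)

lemma eigen_indices_dvd_iff:
  assumes "a \<in> eigen_indices \<mu> N" "b \<in> eigen_indices \<mu> N"
  shows "int N dvd a - b \<longleftrightarrow> a = b"
proof
  assume "int N dvd a - b"
  then have "a mod int N = b mod int N"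
    by (simp add: mod_eq_dvd_iff)
  then show "a = b"
    using assms by (auto simp: eigen_indices_def)
qed simp

section \<open>Homogeneous elements of the loop algebra\<close>

lemma loop_algebra_lookup:
  assumes "p \<in> loop_algebra \<mu> N"
  shows "Poly_Mapping.lookup p n \<in> E n"
proof -
  let ?S = "{p :: int \<Rightarrow>\<^sub>0 'g. \<forall>n. Poly_Mapping.lookup p n \<in> E n}"
  have "module.subspace scaleC ?S"
    by (rule complex_vector.subspaceI)
       (auto simp: lookup_add lookup_scaleC intro: complex_vector.subspace_0 complex_vector.subspace_add
         complex_vector.subspace_scale subspace_eigenspace)
  moreover have "{Poly_Mapping.single (a + int N * m) \<xi> | a m \<xi>. a \<in> eigen_indices \<mu> N \<and> \<xi> \<in> E a} \<subseteq> ?S"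
  proof safe
    fix a m \<xi> n assume "\<xi> \<in> E a"
    then have "\<xi> \<in> E (a + int N * m)"
      using eigenspace_cong[of "a + int N * m" a] by simp
    then show "Poly_Mapping.lookup (Poly_Mapping.single (a + int N * m) \<xi>) n \<in> E n"
      using complex_vector.subspace_0[OF subspace_eigenspace] by (auto simp: lookup_single when_def)
  qed
  ultimately have "loop_algebra \<mu> N \<subseteq> ?S"
    unfolding loop_algebra_def by (intro complex_vector.span_minimal)
  then show ?thesis
    using assms by blast
qed

lemma loop_homogeneousD:
  assumes "p \<in> loop_homogeneous \<mu> N n"
  shows "Poly_Mapping.lookup p n \<in> E n" "p = Poly_Mapping.single n (Poly_Mapping.lookup p n)"
proof -
  show "Poly_Mapping.lookup p n \<in> E n"
    using assms by (auto simp: loop_homogeneous_def loop_algebra_lookup)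
  show "p = Poly_Mapping.single n (Poly_Mapping.lookup p n)"
    using assms by (intro poly_mapping_eqI) (auto simp: loop_homogeneous_def lookup_single when_def in_keys_iff)
qed

lemma single_in_loop_homogeneous:
  assumes "n \<in> loop_degrees \<mu> N" "\<xi> \<in> E n"
  shows "Poly_Mapping.single n \<xi> \<in> loop_homogeneous \<mu> N n"
proof -
  obtain a m where n: "n = a + int N * m" "a \<in> eigen_indices \<mu> N"
    using assms(1) by (auto simp: loop_degrees_def)
  then have "E n = E a"
    by (intro eigenspace_cong) simp
  then have "Poly_Mapping.single n \<xi> \<in> loop_algebra \<mu> N"
    unfolding loop_algebra_def using n assms(2) by (intro complex_vector.span_base) blast
  then show ?thesis
    by (auto simp: loop_homogeneous_def)
qed

end

lemma clinear_evaluation: "clinear (evaluation v)"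
  unfolding evaluation_def
  by (rule clinear_sum_keys) (auto intro!: clinearI simp: scaleC_add_right scaleC_scaleC mult.commute)

lemma evaluation_single: "evaluation v (Poly_Mapping.single n \<xi>) = (v powi n) *\<^sub>C \<xi>"
  by (cases "\<xi> = 0") (simp_all add: evaluation_def)

lemma loop_form_single:
  assumes "cbilinear B"
  shows "loop_form B (Poly_Mapping.single n \<xi>) (Poly_Mapping.single (- n) \<eta>) = B \<xi> \<eta>"
proof -
  have "clinear (\<lambda>x. B x \<eta>)"
    using assms by (simp add: cbilinear_def)
  from clinear_0[OF this] show ?thesis
    by (cases "\<xi> = 0") (simp_all add: loop_form_def)
qed

section \<open>The evaluated r-matrix\<close>

lemma scaleC_single: "c *\<^sub>C Poly_Mapping.single n \<xi> = Poly_Mapping.single n (c *\<^sub>C \<xi>)"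
  by (rule poly_mapping_eqI) (simp add: lookup_scaleC lookup_single when_def)

lemma cbilinear_loop_form:
  assumes B: "cbilinear B"
  shows "cbilinear (loop_form B)"
proof -
  have lin: "clinear (B x)" "clinear (\<lambda>x. B x y)" for x y
    using B by (auto simp: cbilinear_def)
  have "clinear (\<lambda>p. loop_form B p q)" for q
    unfolding loop_form_def by (rule clinear_sum_keys[OF lin(2)])
  moreover have "clinear (loop_form B p)" for p
    unfolding loop_form_def
    by (rule clinearI) (simp_all add: lookup_add lookup_scaleC clinear_add[OF lin(1)] clinear_scaleC[OF lin(1)]
        sum.distrib complex_vector.scale_sum_right)
  ultimately show ?thesis
    by (simp add: cbilinear_def)
qed

locale twisted_lie_algebra = complex_lie_algebra lie + finite_order_operator \<mu> N
  for lie :: "'g::complex_vector \<Rightarrow> 'g \<Rightarrow> 'g" and \<mu> :: "'g \<Rightarrow> 'g" and N +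
  fixes B :: "'g \<Rightarrow> 'g \<Rightarrow> complex"
  assumes fin: "finite_dimensional (UNIV :: 'g set)" and B: "cbilinear B"
    and mu_lie: "\<mu> (lie x y) = lie (\<mu> x) (\<mu> y)" and mu_B: "B (\<mu> x) (\<mu> y) = B x y"
begin

lemma finite_operator_lie:
  assumes "\<omega> \<in> E 0"
  shows "finite_operator (E a) (lie \<omega>)"
proof (rule finite_operator.intro)
  show lin: "clinear (lie \<omega>)"
    using bilinear by (simp add: cbilinear_def)
  show "finite_dimensional (E a)"
    using fin subspace_eigenspace by (rule finite_dimensional_subspace)
  show "lie \<omega> x \<in> E a" if "x \<in> E a" for x
    using assms that by (simp add: in_eigenspace_iff mu_lie scaleC_one clinear_scaleC[OF lin])
qed

lemma B_funpow: "B ((\<mu> ^^ j) x) ((\<mu> ^^ j) y) = B x y"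
  by (induction j) (simp_all add: mu_B)

text \<open>Pairing with an element of E (- n) detects only the component in E n: by invariance of B
  under \<open>\<mu>\<close>, all N summands of the average equal B x y.\<close>

lemma B_projection:
  assumes y: "y \<in> E (- n)"
  shows "B (projection n x) y = B x y"
proof -
  have lin: "clinear (B x)" "clinear (\<lambda>x. B x y)" for x y
    using B by (auto simp: cbilinear_def)
  have "eigenvalue N (- n) ^ j * B ((\<mu> ^^ j) x) y = B x y" for j
    using B_funpow[of j x y] by (simp add: funpow_eigenvector[OF y] clinear_functional_scaleC[OF lin(1)])
  then show ?thesis
    using N by (simp add: projection_def clinear_functional_scaleC[OF lin(2)] clinear_sum[OF lin(2)])
qed

text \<open>Both sides are the image under \<open>g \<otimes> id\<close> of the canonical element of \<open>E n \<otimes> E (- n)\<close>.\<close>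

lemma dual_bases_tensor_eq:
  assumes g: "clinear g" and t': "\<And>i. i < d \<Longrightarrow> t' i \<in> E (- n)"
    and t: "\<And>x. x \<in> E n \<Longrightarrow> x = (\<Sum>i<d. B x (t' i) *\<^sub>C t i)" and U: "dual_bases B UNIV UNIV e U U'"
  shows "(\<Sum>i<d. g (t i) \<otimes> t' i) = (\<Sum>\<beta><e. g (projection n (U \<beta>)) \<otimes> U' \<beta>)"
proof -
  have "g (projection n (U \<beta>)) = (\<Sum>i<d. B (U \<beta>) (t' i) *\<^sub>C g (t i))" for \<beta>
  proof -
    have "projection n (U \<beta>) = (\<Sum>i<d. B (projection n (U \<beta>)) (t' i) *\<^sub>C t i)"
      by (rule t[OF projection_in_eigenspace])
    also have "\<dots> = (\<Sum>i<d. B (U \<beta>) (t' i) *\<^sub>C t i)"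
      using B_projection[OF t'] by (intro sum.cong) auto
    finally show ?thesis
      by (simp add: clinear_sum[OF g] clinear_scaleC[OF g])
  qed
  then have "(\<Sum>\<beta><e. g (projection n (U \<beta>)) \<otimes> U' \<beta>) = (\<Sum>\<beta><e. \<Sum>i<d. B (U \<beta>) (t' i) *\<^sub>C (g (t i) \<otimes> U' \<beta>))"
    by (simp add: clinear_sum[OF clinear_tensor_prod_left] tensor_prod_scaleC_left)
  also have "\<dots> = (\<Sum>i<d. g (t i) \<otimes> (\<Sum>\<beta><e. B (U \<beta>) (t' i) *\<^sub>C U' \<beta>))"
    by (subst sum.swap) (simp add: clinear_sum[OF clinear_tensor_prod_right] tensor_prod_scaleC_right)
  also have "\<dots> = (\<Sum>i<d. g (t i) \<otimes> t' i)"
    using dual_bases_expansion_right[OF B U] by simp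
  finally show ?thesis ..
qed

text \<open>For fixed second index the sum over the first is the expansion of
  \<open>elliptic_R\<close> applied to U in the dual basis, which leaves a single sum.\<close>

lemma r_elliptic_eq:
  assumes U: "dual_bases B UNIV UNIV e U U'"
  shows "r_elliptic lie B \<mu> N \<tau> e U U' \<omega> z = (\<Sum>\<beta><e. elliptic_R lie \<mu> N \<tau> \<omega> z (U \<beta>) \<otimes> U' \<beta>)"
proof -
  have "r_elliptic lie B \<mu> N \<tau> e U U' \<omega> z =
    (\<Sum>\<beta><e. (\<Sum>\<alpha><e. B (U \<alpha>) (elliptic_R lie \<mu> N \<tau> \<omega> z (U \<beta>)) *\<^sub>C U' \<alpha>) \<otimes> U' \<beta>)"
    unfolding r_elliptic_def
    by (subst sum.swap) (simp add: clinear_sum[OF clinear_tensor_prod_left] tensor_prod_scaleC_left)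
  then show ?thesis
    using dual_bases_expansion_right[OF B U] by simp
qed

text \<open>The prescription on the eigenspaces determines a unique linear map because they
  decompose the space. Analyticity near the spectrum is what makes each \<open>operator_fun\<close>
  linear.\<close>

lemma elliptic_R_eq:
  assumes \<omega>: "\<omega> \<in> E 0"
    and analytic: "\<And>a. a \<in> eigen_indices \<mu> N \<Longrightarrow> (\<lambda>w. chi_a N \<tau> a w z) analytic_on spectrum_on (E a) (lie \<omega>)"
  shows "elliptic_R lie \<mu> N \<tau> \<omega> z x =
    (\<Sum>a\<in>eigen_indices \<mu> N. operator_fun (E a) (\<lambda>w. chi_a N \<tau> a w z) (lie \<omega>) (projection a x))"
proof -
  let ?op = "\<lambda>a. operator_fun (E a) (\<lambda>w. chi_a N \<tau> a w z) (lie \<omega>)"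
  define L where "L x = (\<Sum>a\<in>eigen_indices \<mu> N. ?op a (projection a x))" for x
  have op_lincomb: "?op a (c *\<^sub>C x + y) = c *\<^sub>C ?op a x + ?op a y"
    if "a \<in> eigen_indices \<mu> N" "x \<in> E a" "y \<in> E a" for a c x y
    using finite_operator.operator_fun_lincomb[OF finite_operator_lie[OF \<omega>] analytic[OF that(1)] that(2,3)] .
  have op_0: "?op a 0 = 0" if "a \<in> eigen_indices \<mu> N" for a
    using op_lincomb[OF that, of 0 0 1] complex_vector.subspace_0[OF subspace_eigenspace] by (simp add: scaleC_one)
  have "clinear L"
  proof (rule clinearI)
    show "L (x + y) = L x + L y" for x y
      unfolding L_def sum.distrib[symmetric]
      using op_lincomb[OF _ projection_in_eigenspace projection_in_eigenspace, where c = 1]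
      by (intro sum.cong refl) (simp add: clinear_add[OF clinear_projection] scaleC_one)
    show "L (c *\<^sub>C x) = c *\<^sub>C L x" for c x
      unfolding L_def complex_vector.scale_sum_right
      using op_lincomb[OF _ projection_in_eigenspace complex_vector.subspace_0[OF subspace_eigenspace]] op_0
      by (intro sum.cong refl) (simp add: clinear_scaleC[OF clinear_projection])
  qed
  moreover have on_E: "L \<xi> = ?op a \<xi>" if a: "a \<in> eigen_indices \<mu> N" and \<xi>: "\<xi> \<in> E a" for a \<xi>
  proof -
    have "L \<xi> = (\<Sum>b\<in>eigen_indices \<mu> N. if b = a then ?op a \<xi> else 0)"
      unfolding L_def using projection_eigenvector[OF \<xi>] eigen_indices_dvd_iff[OF a] op_0
      by (intro sum.cong refl) auto
    then show ?thesis
      using a finite_eigen_indices by simp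
  qed
  ultimately have "elliptic_R lie \<mu> N \<tau> \<omega> z = L"
    unfolding elliptic_R_def
  proof (intro the_equality conjI ballI)
    fix L' assume L': "clinear L' \<and> (\<forall>a\<in>eigen_indices \<mu> N. \<forall>\<xi>\<in>E a. L' \<xi> = ?op a \<xi>)"
    show "L' = L"
    proof
      fix x
      have "L' x = L' (\<Sum>a\<in>eigen_indices \<mu> N. projection a x)"
        by (simp only: sum_projections)
      also have "\<dots> = (\<Sum>a\<in>eigen_indices \<mu> N. L' (projection a x))"
        using L' by (simp add: clinear_sum)
      also have "\<dots> = L x"
        unfolding L_def using L' projection_in_eigenspace by (intro sum.cong) auto
      finally show "L' x = L x" .
    qed
  qed auto
  then show ?thesis
    by (simp add: L_def)
qed

definition loop_operator :: "complex \<Rightarrow> 'g \<Rightarrow> int \<Rightarrow> 'g \<Rightarrow> 'g"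
  where "loop_operator k \<omega> n = (if n = 0 then operator_fun (E 0) coth_half_reg (lie \<omega>)
    else operator_fun (E (n mod int N)) coth_half (\<lambda>\<xi>. (k * of_int n) *\<^sub>C \<xi> + lie \<omega> \<xi>))"

text \<open>\<open>Poly_Mapping.single n 0\<close> has no keys, so \<open>loop_R\<close> maps it to
  0 by definition; the assumption makes the formula agree with this case.\<close>

lemma loop_R_plus_single:
  assumes "loop_operator k \<omega> n 0 = 0"
  shows "loop_R_plus lie \<mu> N k \<omega> (Poly_Mapping.single n t) = Poly_Mapping.single n (loop_operator k \<omega> n t + (1/2) *\<^sub>C t)"
proof (cases "t = 0")
  case True
  then show ?thesis
    using assms by (simp add: loop_R_plus_def loop_R_def)
next
  case False
  then have "loop_R lie \<mu> N k \<omega> (Poly_Mapping.single n t) = Poly_Mapping.single n (loop_operator k \<omega> n t)"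
    by (simp add: loop_R_def loop_operator_def)
  then show ?thesis
    by (simp add: loop_R_plus_def scaleC_single single_add)
qed

text \<open>Identifies a function of \<open>lie \<omega>\<close> in the analytic series with the
  operator of the loop algebra, up to the evaluation scalar. In degree 0 both are given by
  \<open>coth_half_reg\<close>; in other degrees the shift is moved from the variable to the
  operator.\<close>

lemma loop_operator_eq:
  assumes \<omega>: "\<omega> \<in> E 0" and strip: "elliptic_strip N \<tau> k z a"
    and spectrum: "spectrum_on (E a) (lie \<omega>) \<subseteq> elliptic_domain N \<tau> a" and t: "t \<in> E a"
  shows "operator_fun (E a) (elliptic_strip.loop_term N k z a m) (lie \<omega>) t =
    exp (2 * of_real pi * \<i> * of_int (a + int N * m) * z / of_nat N) *\<^sub>C (loop_operator k \<omega> (a + int N * m) t + (1/2) *\<^sub>C t)"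
    (is "_ = ?c *\<^sub>C _")
proof -
  interpret es: elliptic_strip N \<tau> k z a
    by (rule strip)
  interpret fo: finite_operator "E a" "lie \<omega>"
    by (rule finite_operator_lie[OF \<omega>])
  let ?n = "a + int N * m"
  \<comment> \<open>The function belonging to R_k itself, without the 1/2; written through
    \<open>loop_term\<close> it inherits holomorphy.\<close>
  define H where "H w = degree_factor k ?n w - 1/2" for w
  have op: "open (elliptic_domain N \<tau> a)"
    by (rule open_elliptic_domain[OF es.Im_tau])
  have "(\<lambda>w. 1 / ?c * es.loop_term m w - 1/2) holomorphic_on elliptic_domain N \<tau> a"
    by (intro holomorphic_intros es.loop_term_holomorphic)
  moreover have "(\<lambda>w. 1 / ?c * es.loop_term m w - 1/2) = H"
    by (simp add: fun_eq_iff H_def es.loop_term_def)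
  ultimately have H: "H analytic_on fo.spectrum"
    using op spectrum unfolding analytic_on_holomorphic by metis
  have "es.loop_term m = (\<lambda>w. ?c * (H w + 1/2))"
    by (simp add: fun_eq_iff H_def es.loop_term_def)
  then have "operator_fun (E a) (es.loop_term m) (lie \<omega>) t = ?c *\<^sub>C (operator_fun (E a) H (lie \<omega>) t + (1/2) *\<^sub>C t)"
    by (simp only: fo.operator_fun_affine[OF H t])
  moreover have "operator_fun (E a) H (lie \<omega>) t = loop_operator k \<omega> ?n t"
  proof (cases "?n = 0")
    case True
    then have "a = 0"
      using es.degree_eq_0_iff[of m] by (auto simp: singular_indices_def split: if_splits)
    moreover have "H = coth_half_reg"
      using True unfolding H_def degree_factor_def by (simp add: fun_eq_iff)
    ultimately show ?thesis
      using True unfolding loop_operator_def by simp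
  next
    case False
    then have H_eq: "H = (\<lambda>w. coth_half (w + k * of_int ?n))"
      unfolding H_def degree_factor_def by (simp add: fun_eq_iff)
    have "?n mod int N = a"
      using es.a by simp
    then show ?thesis
      using False fo.operator_fun_shift[OF H[unfolded H_eq] t] unfolding loop_operator_def H_eq by simp
  qed
  ultimately show ?thesis
    by simp
qed

text \<open>The value at 0 of the function of \<open>loop_term\<close> vanishes by linearity, and
  the nonzero evaluation scalar can be cancelled.\<close>

lemma loop_operator_0:
  assumes \<omega>: "\<omega> \<in> E 0" and strip: "elliptic_strip N \<tau> k z a"
    and spectrum: "spectrum_on (E a) (lie \<omega>) \<subseteq> elliptic_domain N \<tau> a"
  shows "loop_operator k \<omega> (a + int N * m) 0 = 0"
proof -
  interpret es: elliptic_strip N \<tau> k z a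
    by (rule strip)
  have "es.loop_term m analytic_on spectrum_on (E a) (lie \<omega>)"
    using es.loop_term_holomorphic open_elliptic_domain[OF es.Im_tau] spectrum
    unfolding analytic_on_holomorphic by blast
  from finite_operator.operator_fun_lincomb[OF finite_operator_lie[OF \<omega>] this, of 0 0 1]
  have "operator_fun (E a) (es.loop_term m) (lie \<omega>) 0 = 0"
    using complex_vector.subspace_0[OF subspace_eigenspace] by (simp add: scaleC_one)
  then show ?thesis
    using loop_operator_eq[OF assms complex_vector.subspace_0[OF subspace_eigenspace]] by simp
qed

text \<open>The evaluations contribute v1^n v2^(-n) = (v1/v2)^n, which is absorbed into
  \<open>loop_term\<close>. The bases of the graded pieces, which vary with n, are then traded for
  the one basis U, so that the sum over n can afterwards be taken separately for each index of
  U.\<close>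

lemma evaluated_r_loop_term:
  assumes \<omega>: "\<omega> \<in> E 0" and strip: "elliptic_strip N \<tau> k z a"
    and spectrum: "spectrum_on (E a) (lie \<omega>) \<subseteq> elliptic_domain N \<tau> a"
    and v: "v1 \<noteq> 0" "v2 \<noteq> 0" "v1 / v2 = exp (2 * of_real pi * \<i> * z / of_nat N)"
    and a: "a \<in> eigen_indices \<mu> N" and n: "n = a + int N * m"
    and T: "dual_bases (loop_form B) (loop_homogeneous \<mu> N n) (loop_homogeneous \<mu> N (- n)) (d n) (T n) (T' n)"
    and U: "dual_bases B UNIV UNIV e U U'"
  shows "tensor_map (evaluation v1) (evaluation v2) (r_loop_term lie \<mu> N k d T T' \<omega> n) =
    (\<Sum>\<beta><e. operator_fun (E a) (elliptic_strip.loop_term N k z a m) (lie \<omega>) (projection a (U \<beta>)) \<otimes> U' \<beta>)"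
proof -
  interpret es: elliptic_strip N \<tau> k z a
    by (rule strip)
  interpret fo: finite_operator "E a" "lie \<omega>"
    by (rule finite_operator_lie[OF \<omega>])
  define t t' where "t i = Poly_Mapping.lookup (T n i) n" and "t' i = Poly_Mapping.lookup (T' n i) (- n)" for i
  let ?op = "operator_fun (E a) (es.loop_term m) (lie \<omega>)"
  \<comment> \<open>The operator function is linear only on E a; composing it with the projection
    makes it linear on the whole space, as \<open>dual_bases_tensor_eq\<close> requires, and changes
    nothing on E a.\<close>
  define g where "g x = ?op (projection a x)" for x
  have analytic: "es.loop_term m analytic_on fo.spectrum"
    using es.loop_term_holomorphic open_elliptic_domain[OF es.Im_tau] spectrum
    unfolding analytic_on_holomorphic by blast
  have En: "E n = E a"
    using n by (intro eigenspace_cong) simp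
  have projn: "projection n x = projection a x" for x
  proof -
    have "eigenvalue N (- n) = eigenvalue N (- n + a) * eigenvalue N (- a)"
      by (subst eigenvalue_add[symmetric]) simp
    also have "eigenvalue N (- n + a) = 1"
      using n by (simp add: eigenvalue_eq_1_iff[OF N])
    finally show ?thesis
      by (simp add: projection_def)
  qed
  have n_deg: "n \<in> loop_degrees \<mu> N"
    using n a by (auto simp: loop_degrees_def)
  have Tn: "t i \<in> E n" "T n i = Poly_Mapping.single n (t i)" "t' i \<in> E (- n)" "T' n i = Poly_Mapping.single (- n) (t' i)"
    if "i < d n" for i
    using T that loop_homogeneousD[of "T n i" n] loop_homogeneousD[of "T' n i" "- n"]
    unfolding dual_bases_def t_def t'_def by (auto dest: is_cbasis_in)
  have g_lin: "clinear g"
  proof (rule clinearI)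
    note lc = fo.operator_fun_lincomb[OF analytic projection_in_eigenspace projection_in_eigenspace]
    show "g (x + y) = g x + g y" for x y
      using lc[of 1 x y] by (simp add: g_def clinear_add[OF clinear_projection] scaleC_one)
    show "g (c *\<^sub>C x) = c *\<^sub>C g x" for c x
      using fo.operator_fun_lincomb[OF analytic projection_in_eigenspace[of a x]
          complex_vector.subspace_0[OF subspace_eigenspace], of c]
        fo.operator_fun_lincomb[OF analytic complex_vector.subspace_0[OF subspace_eigenspace]
          complex_vector.subspace_0[OF subspace_eigenspace], of 1]
      by (simp add: g_def clinear_scaleC[OF clinear_projection] scaleC_one)
  qed
  have summand: "tensor_map (evaluation v1) (evaluation v2) (loop_R_plus lie \<mu> N k \<omega> (T n i) \<otimes> T' n i) = g (t i) \<otimes> t' i"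
    if i: "i < d n" for i
  proof -
    have "v1 powi n * v2 powi (- n) = (v1 / v2) powi n"
      by (subst power_int_divide_distrib) (simp only: power_int_minus divide_inverse)
    also have "\<dots> = exp (2 * of_real pi * \<i> * of_int n * z / of_nat N)"
      unfolding v(3) exp_power_int by (rule arg_cong[where f = exp]) simp
    finally have c: "v1 powi n * v2 powi (- n) = exp (2 * of_real pi * \<i> * of_int n * z / of_nat N)" .
    have ti: "t i \<in> E a"
      using Tn(1)[OF i] En by simp
    then have "g (t i) = ?op (t i)"
      by (simp add: g_def projection_eigenvector)
    also have "\<dots> = (v1 powi n * v2 powi (- n)) *\<^sub>C (loop_operator k \<omega> n (t i) + (1/2) *\<^sub>C t i)"
      unfolding c using loop_operator_eq[OF \<omega> strip spectrum ti, of m, folded n] .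
    finally have g: "g (t i) = (v1 powi n * v2 powi (- n)) *\<^sub>C (loop_operator k \<omega> n (t i) + (1/2) *\<^sub>C t i)" .
    have R: "loop_R_plus lie \<mu> N k \<omega> (T n i) = Poly_Mapping.single n (loop_operator k \<omega> n (t i) + (1/2) *\<^sub>C t i)"
      unfolding Tn(2)[OF i] using loop_operator_0[OF \<omega> strip spectrum, of m] n by (intro loop_R_plus_single) simp
    have "tensor_map (evaluation v1) (evaluation v2) (loop_R_plus lie \<mu> N k \<omega> (T n i) \<otimes> T' n i) =
      evaluation v1 (loop_R_plus lie \<mu> N k \<omega> (T n i)) \<otimes> evaluation v2 (T' n i)"
      by (rule tensor_map(2)[OF clinear_evaluation clinear_evaluation])
    also have "\<dots> = g (t i) \<otimes> t' i"
      unfolding R Tn(4)[OF i] evaluation_single g tensor_prod_scaleC_left tensor_prod_scaleC_right scaleC_scaleC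
      by (simp only: mult.commute)
    finally show ?thesis .
  qed
  \<comment> \<open>Duality in the loop algebra is brought down to coefficients: in the degrees n
    and -n the loop form is B, and reading off degree n gives an expansion in E n.\<close>
  have expansion: "x = (\<Sum>i<d n. B x (t' i) *\<^sub>C t i)" if x: "x \<in> E n" for x
  proof -
    have "Poly_Mapping.single n x = (\<Sum>i<d n. loop_form B (Poly_Mapping.single n x) (T' n i) *\<^sub>C T n i)"
      by (rule dual_bases_expansion_left[OF cbilinear_loop_form[OF B] T single_in_loop_homogeneous[OF n_deg x]])
    also have "\<dots> = (\<Sum>i<d n. B x (t' i) *\<^sub>C Poly_Mapping.single n (t i))"
      by (intro sum.cong refl) (simp add: Tn(2,4) loop_form_single[OF B])
    finally have "Poly_Mapping.lookup (Poly_Mapping.single n x) n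
        = Poly_Mapping.lookup (\<Sum>i<d n. B x (t' i) *\<^sub>C Poly_Mapping.single n (t i)) n"
      by simp
    then show ?thesis
      by (simp add: lookup_sum lookup_scaleC)
  qed
  from dual_bases_tensor_eq[OF g_lin Tn(3) expansion U]
  have "(\<Sum>i<d n. g (t i) \<otimes> t' i) = (\<Sum>\<beta><e. g (projection a (U \<beta>)) \<otimes> U' \<beta>)"
    unfolding projn .
  moreover have "g (projection a x) = ?op (projection a x)" for x
    using projection_eigenvector[OF projection_in_eigenspace[of a x], of a] by (simp add: g_def)
  ultimately show ?thesis
    unfolding r_loop_term_def clinear_sum[OF tensor_map(1)[OF clinear_evaluation clinear_evaluation]]
    using summand by simp
qed

end

text \<open>With k N = 2 pi i tau, the condition for (a, m) excludes 2 pi i times the lattice points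
  with tau-coefficient -m - a/N. Removing 0 from the shifted lattice matters only for a = m = 0,
  which is why that case is formulated apart. Since its condition is always part of
  \<open>admissible_k\<close>, the index 0 must occur among \<open>eigen_indices\<close>.\<close>

lemma admissible_k_eq_admissible_tau:
  assumes N: "N > 0" and k: "k * of_nat N = 2 * of_real pi * \<i> * \<tau>" and \<tau>: "Im \<tau> > 0"
    and zero: "0 \<in> eigen_indices \<mu> N"
  shows "admissible_k lie \<mu> N k = admissible_tau lie \<mu> N \<tau>"
proof -
  have k': "k = 2 * of_real pi * \<i> * \<tau> / of_nat N"
    using k N by (simp add: field_simps)
  have two_pi_i_nonzero: "2 * of_real pi * \<i> \<noteq> 0"
    by simp
  let ?p = "\<lambda>a j m. of_int j + \<tau> * of_int m - of_int a / of_nat N * \<tau>"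
  have iff: "\<nu> + k * of_int (a + m * int N) \<in> two_pi_i_int \<longleftrightarrow> (\<exists>j. \<nu> = 2 * of_real pi * \<i> * ?p a j (- m))" for \<nu> a m
  proof -
    have "\<nu> + k * of_int (a + m * int N) = 2 * of_real pi * \<i> * of_int j \<longleftrightarrow> \<nu> = 2 * of_real pi * \<i> * ?p a j (- m)" for j
      unfolding k' using N by (simp add: field_simps)
    then show ?thesis
      by (auto simp: two_pi_i_int_def)
  qed
  have nonzero: "?p a j m \<noteq> 0" if "0 \<le> a" "a < int N" "a \<noteq> 0 \<or> m \<noteq> 0" for a j m
  proof
    assume "?p a j m = 0"
    then have "m * int N = a"
      by (rule lattice_point_eq_0[OF N \<tau>])
    then have "a mod int N = 0"
      by auto
    then have "a = 0"
      using that by simp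
    with \<open>m * int N = a\<close> that N show False
      by simp
  qed
  have lattice: "\<nu> \<in> (\<lambda>x. 2 * of_real pi * \<i> * x) ` shifted_lattice N \<tau> a \<longleftrightarrow>
      \<nu> \<noteq> 0 \<and> (\<exists>m. \<nu> + k * of_int (a + m * int N) \<in> two_pi_i_int)" for \<nu> a
  proof -
    have negate: "(\<exists>m::int. Q m) \<longleftrightarrow> (\<exists>m. Q (- m))" for Q
      by (metis minus_minus)
    have "\<nu> \<in> (\<lambda>x. 2 * of_real pi * \<i> * x) ` shifted_lattice N \<tau> a \<longleftrightarrow>
      \<nu> \<noteq> 0 \<and> (\<exists>m j. \<nu> = 2 * of_real pi * \<i> * ?p a j m)"
    proof
      assume "\<nu> \<in> (\<lambda>x. 2 * of_real pi * \<i> * x) ` shifted_lattice N \<tau> a"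
      then obtain j m where "\<nu> = 2 * of_real pi * \<i> * ?p a j m" "?p a j m \<noteq> 0"
        unfolding shifted_lattice_def period_lattice_def by blast
      then show "\<nu> \<noteq> 0 \<and> (\<exists>m j. \<nu> = 2 * of_real pi * \<i> * ?p a j m)"
        by (metis mult_eq_0_iff two_pi_i_nonzero)
    next
      assume "\<nu> \<noteq> 0 \<and> (\<exists>m j. \<nu> = 2 * of_real pi * \<i> * ?p a j m)"
      then obtain j m where \<nu>: "\<nu> = 2 * of_real pi * \<i> * ?p a j m" "\<nu> \<noteq> 0"
        by blast
      then have "?p a j m \<noteq> 0"
        by (metis mult_zero_right)
      then have "?p a j m \<in> shifted_lattice N \<tau> a"
        unfolding shifted_lattice_def period_lattice_def by blast
      with \<nu>(1) show "\<nu> \<in> (\<lambda>x. 2 * of_real pi * \<i> * x) ` shifted_lattice N \<tau> a"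
        by (rule image_eqI)
    qed
    then show ?thesis
      unfolding iff negate[of "\<lambda>m. \<exists>j. \<nu> = 2 * of_real pi * \<i> * ?p a j m"] .
  qed
  have nz: "\<nu> \<noteq> 0" if "0 \<le> a" "a < int N" "a \<noteq> 0 \<or> m \<noteq> 0" "\<nu> + k * of_int (a + m * int N) \<in> two_pi_i_int" for \<nu> a m
    using that(4) nonzero[of a "- m"] that(1-3) unfolding iff by auto
  have a_nonzero: "\<nu> \<notin> (\<lambda>x. 2 * of_real pi * \<i> * x) ` shifted_lattice N \<tau> a \<longleftrightarrow>
      (\<forall>m. \<nu> + k * of_int (a + m * int N) \<notin> two_pi_i_int)" if "a \<in> eigen_indices \<mu> N - {0}" for \<nu> a
    unfolding lattice using nz[of a _ \<nu>] that by (auto simp: eigen_indices_def)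
  have a_zero: "\<nu> \<notin> (\<lambda>x. 2 * of_real pi * \<i> * x) ` shifted_lattice N \<tau> 0 \<longleftrightarrow>
      \<nu> \<notin> two_pi_i_int - {0} \<and> (\<forall>m. m \<noteq> 0 \<longrightarrow> \<nu> + k * of_int (m * int N) \<notin> two_pi_i_int)" for \<nu>
  proof -
    have degree_0: "(\<exists>m. \<nu> + k * of_int (0 + m * int N) \<in> two_pi_i_int) \<longleftrightarrow>
      \<nu> \<in> two_pi_i_int \<or> (\<exists>m. m \<noteq> 0 \<and> \<nu> + k * of_int (m * int N) \<in> two_pi_i_int)"
      by (metis add_0 add.right_neutral mult_zero_left mult_zero_right of_int_0)
    have nz0: "\<nu> \<noteq> 0" if "m \<noteq> 0" "\<nu> + k * of_int (m * int N) \<in> two_pi_i_int" for m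
      using nz[of 0 m \<nu>] that N by simp
    show ?thesis
    proof (cases "\<nu> = 0")
      case True
      then show ?thesis
        unfolding lattice using nz0 by auto
    next
      case False
      then have "\<nu> \<in> two_pi_i_int - {0} \<longleftrightarrow> \<nu> \<in> two_pi_i_int"
        by simp
      with False show ?thesis
        unfolding lattice degree_0 by blast
    qed
  qed
  show ?thesis
  proof (intro set_eqI)
    fix \<omega>
    define Sp where "Sp a = spectrum_on (eigenspace \<mu> N a) (lie \<omega>)" for a
    define L where "L a = (\<lambda>x. 2 * of_real pi * \<i> * x) ` shifted_lattice N \<tau> a" for a
    have "(\<forall>a\<in>eigen_indices \<mu> N. Sp a \<inter> L a = {}) \<longleftrightarrow>
        (\<forall>a\<in>eigen_indices \<mu> N - {0}. \<forall>\<nu>\<in>Sp a. \<nu> \<notin> L a) \<and> (\<forall>\<nu>\<in>Sp 0. \<nu> \<notin> L 0)"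
      using zero by blast
    also have "(\<forall>a\<in>eigen_indices \<mu> N - {0}. \<forall>\<nu>\<in>Sp a. \<nu> \<notin> L a) \<longleftrightarrow>
        (\<forall>a\<in>eigen_indices \<mu> N - {0}. \<forall>\<nu>\<in>Sp a. \<forall>m. \<nu> + k * of_int (a + m * int N) \<notin> two_pi_i_int)"
      unfolding L_def by (intro ball_cong refl a_nonzero)
    also have "\<dots> \<longleftrightarrow>
        (\<forall>m. \<forall>a\<in>eigen_indices \<mu> N - {0}. \<forall>\<nu>\<in>Sp a. \<nu> + k * of_int (a + m * int N) \<notin> two_pi_i_int)"
      by blast
    also have "(\<forall>\<nu>\<in>Sp 0. \<nu> \<notin> L 0) \<longleftrightarrow> (\<forall>\<nu>\<in>Sp 0. \<nu> \<notin> two_pi_i_int - {0} \<and>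
        (\<forall>m. m \<noteq> 0 \<longrightarrow> \<nu> + k * of_int (m * int N) \<notin> two_pi_i_int))"
      unfolding L_def by (intro ball_cong refl a_zero)
    finally show "\<omega> \<in> admissible_k lie \<mu> N k \<longleftrightarrow> \<omega> \<in> admissible_tau lie \<mu> N \<tau>"
      unfolding admissible_k_def admissible_tau_def mem_Collect_eq Sp_def L_def by (simp only:)
  qed
qed

section \<open>Assembling the series over all degrees\<close>

lemma has_sum_finite_times:
  fixes f :: "'a \<Rightarrow> 'b \<Rightarrow> complex"
  assumes "finite A" "\<And>a. a \<in> A \<Longrightarrow> (f a has_sum g a) B"
  shows "((\<lambda>(a, m). f a m) has_sum (\<Sum>a\<in>A. g a)) (A \<times> B)"
  using assms
proof (induction A rule: finite_induct)
  case (insert a A)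
  have "((\<lambda>(a, m). f a m) has_sum g a) ({a} \<times> B)"
    using insert.prems[of a]
    by (subst has_sum_reindex_bij_witness[where T = B and i = "\<lambda>m. (a, m)" and j = snd and h = "f a" and s' = "g a"]) auto
  moreover have "((\<lambda>(a, m). f a m) has_sum (\<Sum>a\<in>A. g a)) (A \<times> B)"
    using insert by blast
  ultimately have "((\<lambda>(a, m). f a m) has_sum (g a + (\<Sum>a\<in>A. g a))) ({a} \<times> B \<union> A \<times> B)"
    using insert.hyps by (intro has_sum_Un_disjoint) auto
  moreover have "{a} \<times> B \<union> A \<times> B = insert a A \<times> B"
    by auto
  ultimately show ?case
    using insert.hyps by simp
qed simp

context twisted_lie_algebra
begin

lemma has_sum_loop_degrees:
  fixes f :: "int \<Rightarrow> complex"
  shows "((\<lambda>(a, m). f (a + int N * m)) has_sum s) (eigen_indices \<mu> N \<times> UNIV) \<longleftrightarrow> (f has_sum s) (loop_degrees \<mu> N)"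
proof (rule has_sum_reindex_bij_witness[where i = "\<lambda>n. (n mod int N, n div int N)" and j = "\<lambda>(a, m). a + int N * m"])
  have mod: "(a + int N * m) mod int N = a" "(a + int N * m) div int N = m" if "a \<in> eigen_indices \<mu> N" for a m
    using that by (simp_all add: eigen_indices_def)
  show "(\<lambda>n. (n mod int N, n div int N)) ((\<lambda>(a, m). a + int N * m) p) = p"
    if "p \<in> eigen_indices \<mu> N \<times> UNIV" for p
    using that mod by (cases p) simp
  show "(n mod int N, n div int N) \<in> eigen_indices \<mu> N \<times> UNIV" if "n \<in> loop_degrees \<mu> N" for n
    using that mod by (fastforce simp: loop_degrees_def)
  show "(\<lambda>(a, m). a + int N * m) p \<in> loop_degrees \<mu> N" if "p \<in> eigen_indices \<mu> N \<times> UNIV" for p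
    using that by (cases p) (auto simp: loop_degrees_def)
qed auto

lemma has_sum_evaluated_r_loop_term:
  assumes \<omega>: "\<omega> \<in> E 0" and strip: "\<And>a. a \<in> eigen_indices \<mu> N \<Longrightarrow> elliptic_strip N \<tau> k z a"
    and spectrum: "\<And>a. a \<in> eigen_indices \<mu> N \<Longrightarrow> spectrum_on (E a) (lie \<omega>) \<subseteq> elliptic_domain N \<tau> a"
    and v: "v1 \<noteq> 0" "v2 \<noteq> 0" "v1 / v2 = exp (2 * of_real pi * \<i> * z / of_nat N)"
    and T: "\<And>n. n \<in> loop_degrees \<mu> N \<Longrightarrow>
      dual_bases (loop_form B) (loop_homogeneous \<mu> N n) (loop_homogeneous \<mu> N (- n)) (d n) (T n) (T' n)"
    and U: "dual_bases B UNIV UNIV e U U'"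
  shows "((\<lambda>n. tensor_map (evaluation v1) (evaluation v2) (r_loop_term lie \<mu> N k d T T' \<omega> n))
    has_sum r_elliptic lie B \<mu> N \<tau> e U U' \<omega> z) (loop_degrees \<mu> N)"
proof (rule has_sum_tensorI)
  fix \<phi> :: "('g, 'g) tensor \<Rightarrow> complex" assume \<phi>: "clinear \<phi>"
  let ?t = "\<lambda>n. \<phi> (tensor_map (evaluation v1) (evaluation v2) (r_loop_term lie \<mu> N k d T T' \<omega> n))"
  let ?chi = "\<lambda>a \<beta>. operator_fun (E a) (\<lambda>w. chi_a N \<tau> a w z) (lie \<omega>) (projection a (U \<beta>))"
  let ?S = "\<lambda>a. \<Sum>\<beta><e. \<phi> (?chi a \<beta> \<otimes> U' \<beta>)"
  have chi_holomorphic: "(\<lambda>w. chi_a N \<tau> a w z) holomorphic_on elliptic_domain N \<tau> a" if "a \<in> eigen_indices \<mu> N" for a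
  proof -
    interpret es: elliptic_strip N \<tau> k z a
      by (rule strip[OF that])
    show ?thesis
      using es.loop_sum_holomorphic by (rule holomorphic_transform) (simp add: es.chi_a_eq_loop_sum)
  qed
  \<comment> \<open>For fixed a the only infinite sum is the one over m. It is moved through the
    functional calculus separately for each index of the finite basis U, where
    \<open>loop_term\<close> sums to \<open>chi_a\<close>.\<close>
  have part: "((\<lambda>m. ?t (a + int N * m)) has_sum ?S a) UNIV" if a: "a \<in> eigen_indices \<mu> N" for a
  proof -
    interpret es: elliptic_strip N \<tau> k z a
      by (rule strip[OF a])
    interpret fo: finite_operator "E a" "lie \<omega>"
      by (rule finite_operator_lie[OF \<omega>])
    have "((\<lambda>m. \<Sum>\<beta><e. \<phi> (operator_fun (E a) (es.loop_term m) (lie \<omega>) (projection a (U \<beta>)) \<otimes> U' \<beta>)) has_sum ?S a) UNIV"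
    proof (rule has_sum_finite_sum)
      fix \<beta>
      have lin: "clinear (\<lambda>x. \<phi> (x \<otimes> U' \<beta>))"
        by (rule clinearI) (simp_all add: tensor_prod_add_left tensor_prod_scaleC_left clinear_add[OF \<phi>] clinear_scaleC[OF \<phi>])
      show "((\<lambda>m. \<phi> (operator_fun (E a) (es.loop_term m) (lie \<omega>) (projection a (U \<beta>)) \<otimes> U' \<beta>)) has_sum
          \<phi> (?chi a \<beta> \<otimes> U' \<beta>)) UNIV"
      proof (rule fo.has_sum_operator_fun[OF _ spectrum[OF a] projection_in_eigenspace lin])
        show "open (elliptic_domain N \<tau> a)"
          by (rule open_elliptic_domain[OF es.Im_tau])
        show "es.loop_term m holomorphic_on elliptic_domain N \<tau> a" for m
          by (rule es.loop_term_holomorphic)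
        show "((\<lambda>m. es.loop_term m w) has_sum chi_a N \<tau> a w z) UNIV" if "w \<in> elliptic_domain N \<tau> a" for w
          unfolding es.chi_a_eq_loop_sum[OF that] by (rule es.has_sum_loop_sum[OF that])
        show "\<exists>M. M summable_on UNIV \<and> (\<forall>m\<in>UNIV. \<forall>w\<in>K. norm (es.loop_term m w) \<le> M m)"
          if "compact K" "K \<subseteq> elliptic_domain N \<tau> a" for K
          by (rule es.loop_term_M_test[OF that])
      qed
    qed simp
    moreover have "?t (a + int N * m) = (\<Sum>\<beta><e. \<phi> (operator_fun (E a) (es.loop_term m) (lie \<omega>) (projection a (U \<beta>)) \<otimes> U' \<beta>))" for m
    proof -
      have "a + int N * m \<in> loop_degrees \<mu> N"
        using a by (auto simp: loop_degrees_def)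
      from evaluated_r_loop_term[where n = "a + int N * m" and m = m and d = d and T = T and T' = T', OF \<omega> strip[OF a] spectrum[OF a] v a refl T[OF this] U]
      show ?thesis
        by (simp add: clinear_sum[OF \<phi>])
    qed
    ultimately show ?thesis
      by simp
  qed
  have "((\<lambda>(a, m). ?t (a + int N * m)) has_sum (\<Sum>a\<in>eigen_indices \<mu> N. ?S a)) (eigen_indices \<mu> N \<times> UNIV)"
    using finite_eigen_indices part by (rule has_sum_finite_times)
  also have "?this \<longleftrightarrow> (?t has_sum (\<Sum>a\<in>eigen_indices \<mu> N. ?S a)) (loop_degrees \<mu> N)"
    by (rule has_sum_loop_degrees)
  also have "(\<Sum>a\<in>eigen_indices \<mu> N. ?S a) = \<phi> (r_elliptic lie B \<mu> N \<tau> e U U' \<omega> z)"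
  proof -
    have R: "elliptic_R lie \<mu> N \<tau> \<omega> z (U \<beta>) = (\<Sum>a\<in>eigen_indices \<mu> N. ?chi a \<beta>)" for \<beta>
    proof (rule elliptic_R_eq[OF \<omega>])
      fix a assume a: "a \<in> eigen_indices \<mu> N"
      interpret es: elliptic_strip N \<tau> k z a
        by (rule strip[OF a])
      show "(\<lambda>w. chi_a N \<tau> a w z) analytic_on spectrum_on (E a) (lie \<omega>)"
        using chi_holomorphic[OF a] open_elliptic_domain[OF es.Im_tau] spectrum[OF a]
        unfolding analytic_on_holomorphic by blast
    qed
    have "\<phi> (r_elliptic lie B \<mu> N \<tau> e U U' \<omega> z) = (\<Sum>\<beta><e. \<phi> (elliptic_R lie \<mu> N \<tau> \<omega> z (U \<beta>) \<otimes> U' \<beta>))"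
      by (simp only: r_elliptic_eq[OF U] clinear_sum[OF \<phi>])
    also have "\<dots> = (\<Sum>\<beta><e. \<Sum>a\<in>eigen_indices \<mu> N. \<phi> (?chi a \<beta> \<otimes> U' \<beta>))"
      by (simp only: R clinear_sum[OF clinear_tensor_prod_left] clinear_sum[OF \<phi>])
    also have "\<dots> = (\<Sum>a\<in>eigen_indices \<mu> N. ?S a)"
      by (rule sum.swap)
    finally show ?thesis ..
  qed
  finally show "(?t has_sum \<phi> (r_elliptic lie B \<mu> N \<tau> e U U' \<omega> z)) (loop_degrees \<mu> N)" .
qed

end

theorem proposition3:
  fixes lie :: "'g::complex_vector \<Rightarrow> 'g \<Rightarrow> 'g"
    and B :: "'g \<Rightarrow> 'g \<Rightarrow> complex"
    and \<mu> :: "'g \<Rightarrow> 'g"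
    and N :: nat
    and k z v1 v2 \<tau> :: complex
  assumes "complex_lie_algebra lie"
    and "finite_dimensional (UNIV :: 'g set)"
    and "cbilinear B" and "\<forall>x y. B x y = B y x"
    and "invariant_form lie B" and "nondegenerate_form B"
    and "lie_automorphism lie \<mu>" and "has_finite_order \<mu> N"
    and "\<forall>x y. B (\<mu> x) (\<mu> y) = B x y"
    and "\<exists>\<xi>. \<xi> \<noteq> 0 \<and> \<mu> \<xi> = \<xi>"
    and "Re k \<noteq> 0"
    and "v1 \<noteq> 0" and "v2 \<noteq> 0"
    and "\<tau> = k * of_nat N / (2 * of_real pi * \<i>)"
    and "v1 / v2 = exp (2 * of_real pi * \<i> * z / of_nat N)"
    and "- Im \<tau> < Im z" and "Im z < 0"
  shows "admissible_k lie \<mu> N k = admissible_tau lie \<mu> N \<tau> \<and>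
    (\<forall>\<omega>\<in>admissible_k lie \<mu> N k. \<forall>d T T' e U U'.
      (\<forall>n\<in>loop_degrees \<mu> N.
        dual_bases (loop_form B) (loop_homogeneous \<mu> N n) (loop_homogeneous \<mu> N (- n)) (d n) (T n) (T' n))
      \<longrightarrow> dual_bases B UNIV UNIV e U U'
      \<longrightarrow> ((\<lambda>n. tensor_map (evaluation v1) (evaluation v2) (r_loop_term lie \<mu> N k d T T' \<omega> n))
            has_sum r_elliptic lie B \<mu> N \<tau> e U U' \<omega> z) (loop_degrees \<mu> N))"
proof -
  have mu: "clinear \<mu>" "\<And>x y. \<mu> (lie x y) = lie (\<mu> x) (\<mu> y)"
    using assms(7) by (simp_all add: lie_automorphism_def)
  have order: "N > 0" "\<mu> ^^ N = id"
    using assms(8) by (simp_all add: has_finite_order_def)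
  interpret twisted_lie_algebra lie \<mu> N B
    by (intro twisted_lie_algebra.intro twisted_lie_algebra_axioms.intro finite_order_operator.intro
        assms(1-3) mu order assms(9)[rule_format])
  have k: "k * of_nat N = 2 * of_real pi * \<i> * \<tau>"
    unfolding assms(14) by simp
  have \<tau>: "Im \<tau> > 0"
    using assms(16,17) by linarith
  obtain \<xi> where "\<xi> \<noteq> 0" "\<mu> \<xi> = \<xi>"
    using assms(10) by blast
  then have "\<xi> \<in> eigenspace \<mu> N 0"
    by (simp add: in_eigenspace_iff scaleC_one)
  with \<open>\<xi> \<noteq> 0\<close> N have zero: "0 \<in> eigen_indices \<mu> N"
    by (auto simp: eigen_indices_def)
  have admissible: "admissible_k lie \<mu> N k = admissible_tau lie \<mu> N \<tau>"
    by (rule admissible_k_eq_admissible_tau[OF N k \<tau> zero])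
  have strip: "elliptic_strip N \<tau> k z a" if "a \<in> eigen_indices \<mu> N" for a
    using that by (intro elliptic_strip.intro N k assms(16,17)) (simp_all add: eigen_indices_def)
  have "((\<lambda>n. tensor_map (evaluation v1) (evaluation v2) (r_loop_term lie \<mu> N k d T T' \<omega> n))
      has_sum r_elliptic lie B \<mu> N \<tau> e U U' \<omega> z) (loop_degrees \<mu> N)"
    if \<omega>: "\<omega> \<in> admissible_k lie \<mu> N k"
      and T: "\<forall>n\<in>loop_degrees \<mu> N.
        dual_bases (loop_form B) (loop_homogeneous \<mu> N n) (loop_homogeneous \<mu> N (- n)) (d n) (T n) (T' n)"
      and U: "dual_bases B UNIV UNIV e U U'" for \<omega> d T T' e U U'
  proof (rule has_sum_evaluated_r_loop_term[OF _ strip _ assms(12,13,15) bspec[OF T] U])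
    show "\<omega> \<in> E 0"
      using \<omega> by (simp add: admissible_k_def)
    show "spectrum_on (E a) (lie \<omega>) \<subseteq> elliptic_domain N \<tau> a" if "a \<in> eigen_indices \<mu> N" for a
      using \<omega> that unfolding admissible admissible_tau_def elliptic_domain_def by blast
  qed
  with admissible show ?thesis
    by blast
qed

end
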